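(* Let $G$ be a uniform pro-$p$ group and let $J$ be a left ideal of $RG$ such that $RG/J$ is $p$-torsion-free. Then there exists a real number $w_0>1$, depending only on $J$, such that for all real $w\ge w_0$ the associated graded module $\operatorname{gr}^w(RG/J)$ is $t_w$-torsion-free.
   Context: $R$ is a complete discrete valuation ring with uniformizer $p$, residue field $k$, valuation $v$ with $v(p)=1$; $RG=\varprojlim_NR[G/N]$. With $g_1,\dots,g_d$ a minimal topological generating set of $G$, $b_i=g_i-1$, every element of $RG$ is uniquely $\sum_{\alpha\in\mathbb N^d}\lambda_\alpha\mathbf b^\alpha$, $\mathbf b^\alpha=b_1^{\alpha_1}\cdots b_d^{\alpha_d}$. For real $w\ge1$, $\deg_w(\sum\lambda_\alpha\mathbf b^\alpha)=\min_\alpha\{w\,v(\lambda_\alpha)+|\alpha|\}$; this is a degree function defining an $\mathbb R$-filtration $F_\mu RG=\{x:\deg_w(x)\ge-\mu\}$ with associated graded ring $\operatorname{gr}^wRG$. $t_w\in\operatorname{gr}^wRG$ is the principal symbol of $p$ (of degree $-w$). $\operatorname{gr}^w(RG/J)$ is the associated graded module of $RG/J$ for the quotient filtration; $t_w$-torsion-free means multiplication by $t_w$ is injective. *)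

theory Defs
  imports "HOL-Analysis.Analysis" "HOL-Algebra.Algebra"
begin

definition complete_dvr_unif :: "'r::idom \<Rightarrow> bool" where
  "complete_dvr_unif \<pi> \<longleftrightarrow>
     \<pi> \<noteq> 0 \<and> \<not> (\<pi> dvd 1) \<and>
     (\<forall>x. x \<noteq> 0 \<longrightarrow> (\<exists>u n. u dvd 1 \<and> x = u * \<pi> ^ n)) \<and>
     (\<forall>s::nat \<Rightarrow> 'r. (\<forall>k. \<exists>M. \<forall>m\<ge>M. \<forall>n\<ge>M. \<pi> ^ k dvd (s m - s n)) \<longrightarrow>
        (\<exists>L. \<forall>k. \<exists>M. \<forall>n\<ge>M. \<pi> ^ k dvd (s n - L)))"

text \<open>normalised valuation, v(pi) = 1 (used only for nonzero elements)\<close>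
definition val :: "'r::idom \<Rightarrow> 'r \<Rightarrow> nat" where
  "val \<pi> x = (GREATEST n. \<pi> ^ n dvd x)"

definition topological_group :: "'g monoid \<Rightarrow> 'g topology \<Rightarrow> bool" where
  "topological_group G T \<longleftrightarrow> group G \<and> topspace T = carrier G \<and>
     continuous_map (prod_topology T T) T (\<lambda>(x, y). x \<otimes>\<^bsub>G\<^esub> y) \<and>
     continuous_map T T (\<lambda>x. inv\<^bsub>G\<^esub> x)"

definition totally_disconnected_space :: "'a topology \<Rightarrow> bool" where
  "totally_disconnected_space T \<longleftrightarrow>
     (\<forall>S. connectedin T S \<longrightarrow> (\<exists>a. S \<subseteq> {a}))"

definition profinite_group :: "'g monoid \<Rightarrow> 'g topology \<Rightarrow> bool" where
  "profinite_group G T \<longleftrightarrow> topological_group G T \<and> compact_space T \<and>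
     Hausdorff_space T \<and> totally_disconnected_space T"

definition open_normal :: "'g monoid \<Rightarrow> 'g topology \<Rightarrow> 'g set \<Rightarrow> bool" where
  "open_normal G T N \<longleftrightarrow> N \<lhd> G \<and> openin T N"

definition idx :: "'g monoid \<Rightarrow> 'g set \<Rightarrow> 'g set \<Rightarrow> nat" where
  "idx G A B = card {B #>\<^bsub>G\<^esub> x | x. x \<in> A}"

definition pro_p_group :: "nat \<Rightarrow> 'g monoid \<Rightarrow> 'g topology \<Rightarrow> bool" where
  "pro_p_group p G T \<longleftrightarrow> profinite_group G T \<and>
     (\<forall>N. open_normal G T N \<longrightarrow> (\<exists>k. idx G (carrier G) N = p ^ k))"

definition commutator :: "'g monoid \<Rightarrow> 'g \<Rightarrow> 'g \<Rightarrow> 'g" where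
  "commutator G x y = x \<otimes>\<^bsub>G\<^esub> y \<otimes>\<^bsub>G\<^esub> inv\<^bsub>G\<^esub> x \<otimes>\<^bsub>G\<^esub> inv\<^bsub>G\<^esub> y"

definition closed_power_subgroup :: "'g monoid \<Rightarrow> 'g topology \<Rightarrow> nat \<Rightarrow> 'g set" where
  "closed_power_subgroup G T m =
     T closure_of (generate G {x [^]\<^bsub>G\<^esub> m | x. x \<in> carrier G})"

definition powerful :: "nat \<Rightarrow> 'g monoid \<Rightarrow> 'g topology \<Rightarrow> bool" where
  "powerful p G T \<longleftrightarrow> pro_p_group p G T \<and>
     (\<forall>x\<in>carrier G. \<forall>y\<in>carrier G.
        commutator G x y \<in> closed_power_subgroup G T (if p = 2 then 4 else p))"

definition top_generates :: "'g monoid \<Rightarrow> 'g topology \<Rightarrow> 'g set \<Rightarrow> bool" where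
  "top_generates G T S \<longleftrightarrow> S \<subseteq> carrier G \<and> T closure_of (generate G S) = carrier G"

text \<open>lower p-series: lower_p_series 0 = G (= P_1(G)),
  P_{i+1} = closure(P_i^p [P_i, G])\<close>
primrec lower_p_series :: "nat \<Rightarrow> 'g monoid \<Rightarrow> 'g topology \<Rightarrow> nat \<Rightarrow> 'g set" where
  "lower_p_series p G T 0 = carrier G"
| "lower_p_series p G T (Suc i) =
     T closure_of (generate G
       ({x [^]\<^bsub>G\<^esub> p | x. x \<in> lower_p_series p G T i} \<union>
        {commutator G x y | x y. x \<in> lower_p_series p G T i \<and> y \<in> carrier G}))"

text \<open>uniform pro-p group (Dixon-du Sautoy-Mann-Segal, Def. 4.1)\<close>
definition uniform_pro_p :: "nat \<Rightarrow> 'g monoid \<Rightarrow> 'g topology \<Rightarrow> bool" where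
  "uniform_pro_p p G T \<longleftrightarrow> powerful p G T \<and>
     (\<exists>S. finite S \<and> top_generates G T S) \<and>
     (\<forall>i. idx G (lower_p_series p G T i) (lower_p_series p G T (Suc i)) =
          idx G (lower_p_series p G T 0) (lower_p_series p G T 1))"

definition minimal_top_gens :: "'g monoid \<Rightarrow> 'g topology \<Rightarrow> 'g list \<Rightarrow> bool" where
  "minimal_top_gens G T gs \<longleftrightarrow> top_generates G T (set gs) \<and>
     (\<forall>hs. top_generates G T (set hs) \<longrightarrow> length gs \<le> length hs)"

text \<open>An element x is a compatible family: x N is an element of R[G/N], i.e. a function
  on the cosets of the open normal subgroup N.\<close>
type_synonym ('g, 'r) rg = "'g set \<Rightarrow> 'g set \<Rightarrow> 'r"

definition RG :: "'g monoid \<Rightarrow> 'g topology \<Rightarrow> ('g, 'r::comm_ring_1) rg set" where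
  "RG G T = {x.
     (\<forall>N. \<not> open_normal G T N \<longrightarrow> x N = (\<lambda>_. 0)) \<and>
     (\<forall>N C. open_normal G T N \<longrightarrow> C \<notin> rcosets\<^bsub>G\<^esub> N \<longrightarrow> x N C = 0) \<and>
     (\<forall>N M. open_normal G T N \<longrightarrow> open_normal G T M \<longrightarrow> N \<subseteq> M \<longrightarrow>
        (\<forall>C \<in> rcosets\<^bsub>G\<^esub> M. x M C = (\<Sum>D\<in>{D \<in> rcosets\<^bsub>G\<^esub> N. D \<subseteq> C}. x N D)))}"

definition rg_add :: "('g, 'r::comm_ring_1) rg \<Rightarrow> ('g, 'r) rg \<Rightarrow> ('g, 'r) rg" where
  "rg_add x y = (\<lambda>N C. x N C + y N C)"

definition rg_smult :: "'r::comm_ring_1 \<Rightarrow> ('g, 'r) rg \<Rightarrow> ('g, 'r) rg" where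
  "rg_smult c x = (\<lambda>N C. c * x N C)"

definition rg_mult :: "'g monoid \<Rightarrow> 'g topology \<Rightarrow> ('g, 'r::comm_ring_1) rg \<Rightarrow> ('g, 'r) rg \<Rightarrow> ('g, 'r) rg" where
  "rg_mult G T x y = (\<lambda>N C. if open_normal G T N then
      (\<Sum>(D, E)\<in>{(D, E). D \<in> rcosets\<^bsub>G\<^esub> N \<and> E \<in> rcosets\<^bsub>G\<^esub> N \<and> D <#>\<^bsub>G\<^esub> E = C}.
          x N D * y N E) else 0)"

definition rg_one :: "'g monoid \<Rightarrow> 'g topology \<Rightarrow> ('g, 'r::comm_ring_1) rg" where
  "rg_one G T = (\<lambda>N C. if open_normal G T N \<and> C = N then 1 else 0)"

definition rg_of :: "'g monoid \<Rightarrow> 'g topology \<Rightarrow> 'g \<Rightarrow> ('g, 'r::comm_ring_1) rg" where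
  "rg_of G T g = (\<lambda>N C. if open_normal G T N \<and> C = N #>\<^bsub>G\<^esub> g then 1 else 0)"

definition rg_pow :: "'g monoid \<Rightarrow> 'g topology \<Rightarrow> ('g, 'r::comm_ring_1) rg \<Rightarrow> nat \<Rightarrow> ('g, 'r) rg" where
  "rg_pow G T x n = ((rg_mult G T x) ^^ n) (rg_one G T)"

definition bvar :: "'g monoid \<Rightarrow> 'g topology \<Rightarrow> 'g \<Rightarrow> ('g, 'r::comm_ring_1) rg" where
  "bvar G T g = (\<lambda>N C. rg_of G T g N C - rg_one G T N C)"

fun bmono :: "'g monoid \<Rightarrow> 'g topology \<Rightarrow> 'g list \<Rightarrow> nat list \<Rightarrow> ('g, 'r::comm_ring_1) rg" where
  "bmono G T (g # gs) (a # as) = rg_mult G T (rg_pow G T (bvar G T g) a) (bmono G T gs as)"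
| "bmono G T _ _ = rg_one G T"

definition multi_indices :: "nat \<Rightarrow> nat \<Rightarrow> nat list set" where
  "multi_indices d n = {\<alpha>. length \<alpha> = d \<and> sum_list \<alpha> \<le> n}"

text \<open>x = sum_alpha lam(alpha) b^alpha, convergence in RG (inverse limit of the
  pi-adic topologies on R[G/N])\<close>
definition has_expansion :: "'r::comm_ring_1 \<Rightarrow> 'g monoid \<Rightarrow> 'g topology \<Rightarrow> 'g list \<Rightarrow>
    ('g, 'r) rg \<Rightarrow> (nat list \<Rightarrow> 'r) \<Rightarrow> bool" where
  "has_expansion \<pi> G T gs x lam \<longleftrightarrow>
     (\<forall>\<alpha>. length \<alpha> \<noteq> length gs \<longrightarrow> lam \<alpha> = 0) \<and>
     (\<forall>N k. open_normal G T N \<longrightarrow> (\<exists>n0. \<forall>n\<ge>n0. \<forall>C.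
        \<pi> ^ k dvd (x N C - (\<Sum>\<alpha>\<in>multi_indices (length gs) n. lam \<alpha> * bmono G T gs \<alpha> N C))))"

definition coeffs :: "'r::comm_ring_1 \<Rightarrow> 'g monoid \<Rightarrow> 'g topology \<Rightarrow> 'g list \<Rightarrow>
    ('g, 'r) rg \<Rightarrow> nat list \<Rightarrow> 'r" where
  "coeffs \<pi> G T gs x = (THE lam. has_expansion \<pi> G T gs x lam)"

text \<open>deg_w(sum lam_alpha b^alpha) = min {w v(lam_alpha) + |alpha|}, (= infinity for x = 0)\<close>
definition deg_w :: "'r::idom \<Rightarrow> 'g monoid \<Rightarrow> 'g topology \<Rightarrow> 'g list \<Rightarrow> real \<Rightarrow>
    ('g, 'r) rg \<Rightarrow> ereal" where
  "deg_w \<pi> G T gs w x = Inf {ereal (w * real (val \<pi> (coeffs \<pi> G T gs x \<alpha>)) + real (sum_list \<alpha>)) | \<alpha>.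
      length \<alpha> = length gs \<and> coeffs \<pi> G T gs x \<alpha> \<noteq> 0}"

definition left_ideal_RG :: "'g monoid \<Rightarrow> 'g topology \<Rightarrow> ('g, 'r::comm_ring_1) rg set \<Rightarrow> bool" where
  "left_ideal_RG G T J \<longleftrightarrow> J \<subseteq> RG G T \<and> (\<lambda>N C. 0) \<in> J \<and>
     (\<forall>x\<in>J. \<forall>y\<in>J. rg_add x y \<in> J) \<and> (\<forall>x\<in>J. rg_smult (-1) x \<in> J) \<and>
     (\<forall>r\<in>RG G T. \<forall>x\<in>J. rg_mult G T r x \<in> J)"

definition quotient_p_torsion_free :: "'r::comm_ring_1 \<Rightarrow> 'g monoid \<Rightarrow> 'g topology \<Rightarrow> ('g, 'r) rg set \<Rightarrow> bool" where
  "quotient_p_torsion_free \<pi> G T J \<longleftrightarrow> (\<forall>x\<in>RG G T. rg_smult \<pi> x \<in> J \<longrightarrow> x \<in> J)"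

text \<open>F_mu(RG/J) = (F_mu RG + J)/J, described by representatives in RG;
  F_mu RG = {x. deg_w x \<ge> -mu}\<close>
definition quot_filt :: "'r::idom \<Rightarrow> 'g monoid \<Rightarrow> 'g topology \<Rightarrow> 'g list \<Rightarrow> ('g, 'r) rg set \<Rightarrow>
    real \<Rightarrow> real \<Rightarrow> ('g, 'r) rg set" where
  "quot_filt \<pi> G T gs J w \<mu> = {x \<in> RG G T. \<exists>j\<in>J. deg_w \<pi> G T gs w (rg_add x j) \<ge> ereal (- \<mu>)}"

definition quot_filt_less :: "'r::idom \<Rightarrow> 'g monoid \<Rightarrow> 'g topology \<Rightarrow> 'g list \<Rightarrow> ('g, 'r) rg set \<Rightarrow>
    real \<Rightarrow> real \<Rightarrow> ('g, 'r) rg set" where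
  "quot_filt_less \<pi> G T gs J w \<mu> = (\<Union>\<nu>\<in>{\<nu>. \<nu> < \<mu>}. quot_filt \<pi> G T gs J w \<nu>)"

text \<open>gr^w(RG/J) = (+)_mu F_mu/F_{<mu}; t_w = symbol of pi (degree -w) maps the class of x in
  gr_mu to the class of pi x in gr_{mu - w}.  t_w-torsion-freeness = injectivity of this map
  on every homogeneous component.\<close>
definition gr_tw_torsion_free :: "'r::idom \<Rightarrow> 'g monoid \<Rightarrow> 'g topology \<Rightarrow> 'g list \<Rightarrow> ('g, 'r) rg set \<Rightarrow>
    real \<Rightarrow> bool" where
  "gr_tw_torsion_free \<pi> G T gs J w \<longleftrightarrow>
     (\<forall>\<mu> x. x \<in> quot_filt \<pi> G T gs J w \<mu> \<longrightarrow>
        rg_smult \<pi> x \<in> quot_filt_less \<pi> G T gs J w (\<mu> - w) \<longrightarrow>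
        x \<in> quot_filt_less \<pi> G T gs J w \<mu>)"

end

theory Submission
  imports Defs
begin

text \<open>
  Everything is read off the coordinates \<open>x = \<Sum> \<lambda>\<^sub>c \<^bold>b\<^sup>c\<close>. Since each layer of the lower \<open>p\<close>-series
  of a uniform group is elementary abelian of rank \<open>d\<close> and is the image of the previous one under
  \<open>x \<mapsto> x\<^sup>p\<close>, every element of \<open>G/P\<^sub>n\<close> is uniquely \<open>g\<^sub>1\<^sup>a\<^sup>1 \<cdots> g\<^sub>d\<^sup>a\<^sup>d\<close> with exponents modulo \<open>p\<^sup>n\<close>.
  The coefficient \<open>\<lambda>\<^sub>c\<close> of \<open>x\<close> is the integral of the binomial function \<open>a \<mapsto> \<Prod> (a\<^sub>i choose c\<^sub>i)\<close>
  against the measure \<open>x\<close>, as in Mahler's theorem; it exists because binomial functions are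
  \<open>p\<close>-adically continuous.

  Give \<open>p\<close> degree 2 and each \<open>b\<^sub>i\<close> degree 1. Because \<open>G\<close> is powerful, the commutators
  \<open>b\<^sub>i b\<^sub>j - b\<^sub>j b\<^sub>i\<close> have degree at least 3, so a product of monomials is the sorted monomial plus terms
  of higher degree. Hence for \<open>w \<ge> 2\<close> the function \<open>deg\<^sub>w\<close> is superadditive on products, and lowest
  monomials modulo \<open>p\<close> (for the graded lexicographic order) multiply.

  By Dickson's lemma the lowest exponents of the elements of \<open>J\<close> not divisible by \<open>p\<close> are multiples of
  those of finitely many \<open>f\<^sub>s \<in> J\<close>; take \<open>w\<close> larger than all \<open>\<bar>s\<bar>\<close>, so that \<open>deg\<^sub>w f\<^sub>s = \<bar>s\<bar>\<close>.
  If \<open>p x + j\<close> has degree at least \<open>D\<close> with \<open>j \<in> J\<close>, then modulo \<open>p\<close> the lowest degree of \<open>j\<close> is at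
  least \<open>D\<close>, and division by the \<open>f\<^sub>s\<close> yields \<open>k = \<Sum> r\<^sub>s f\<^sub>s \<in> J\<close> of degree at least \<open>D\<close>
  with \<open>j - k \<in> p RG\<close>. Torsion-freeness gives \<open>j - k = p y\<close> with \<open>y \<in> J\<close>, and
  \<open>p (x + y) = (p x + j) - k\<close> has degree at least \<open>D\<close>, so \<open>x + y\<close> has degree at least \<open>D - w\<close>.
\<close>

text \<open>The obstacle is that degrees exist only in the limit. R[G/P_n] has finite rank and
  b_i^(p^n) is a multiple of p there, so a finite level has no expansion from which a degree could
  be read. Identities are therefore proved at a finite level modulo p^k, and coefficients are
  extracted by functionals that become dual to the monomials modulo p^k once n is large. Convergence
  rests on the augmentation ideal being nilpotent modulo p at each level, shown along a chain of
  open normal subgroups with central factors of order p.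

  Weight 2 is the least integer weight of p for which p b_i, a typical term of g_i^p - 1, has degree
  above 2, the degree of b_i b_j. Real w >= 2 are then covered as well: the correction terms are
  multiples p^a b^c, and enlarging w only raises their degree.

  Division is carried out modulo p only, so nothing is iterated p-adically: torsion-freeness divides
  the remainder by p inside J. The quotients are infinite series, hence the lowest exponents and the
  recursion along a well-founded order.\<close>

subsection \<open>Topological groups\<close>

lemma (in group) inv_cancel_left [simp]:
  "x \<in> carrier G \<Longrightarrow> z \<in> carrier G \<Longrightarrow> inv x \<otimes> (x \<otimes> z) = z"
  "x \<in> carrier G \<Longrightarrow> z \<in> carrier G \<Longrightarrow> x \<otimes> (inv x \<otimes> z) = z"
  by (simp_all add: m_assoc[symmetric])

locale topgroup = group G for G :: "'g monoid" (structure) +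
  fixes T :: "'g topology"
  assumes topspace_eq: "topspace T = carrier G"
    and mult_cont: "continuous_map (prod_topology T T) T (\<lambda>(x, y). x \<otimes> y)"
    and inv_cont: "continuous_map T T (\<lambda>x. inv x)"
begin

lemma lmult_cont: "a \<in> carrier G \<Longrightarrow> continuous_map T T (\<lambda>x. a \<otimes> x)"
  using continuous_map_compose[OF _ mult_cont, of T "\<lambda>x. (a, x)"]
  by (simp add: o_def continuous_map_pairedI topspace_eq)

lemma rmult_cont: "a \<in> carrier G \<Longrightarrow> continuous_map T T (\<lambda>x. x \<otimes> a)"
  using continuous_map_compose[OF _ mult_cont, of T "\<lambda>x. (x, a)"]
  by (simp add: o_def continuous_map_pairedI topspace_eq)

lemma rcos_preimage: "U \<subseteq> carrier G \<Longrightarrow> a \<in> carrier G \<Longrightarrow> U #> a = {x \<in> topspace T. x \<otimes> inv a \<in> U}"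
proof (intro equalityI subsetI)
  fix x assume "U \<subseteq> carrier G" "a \<in> carrier G" "x \<in> {x \<in> topspace T. x \<otimes> inv a \<in> U}"
  then show "x \<in> U #> a"
    unfolding r_coset_def topspace_eq
    by (auto intro!: bexI[of _ "x \<otimes> inv a"] simp: m_assoc)
qed (auto simp: r_coset_def topspace_eq m_assoc subset_iff)

lemma openin_rcos: "openin T U \<Longrightarrow> a \<in> carrier G \<Longrightarrow> openin T (U #> a)"
  using openin_continuous_map_preimage[OF rmult_cont, of "inv a" U] rcos_preimage[of U a]
    openin_subset[of T U] by (simp add: topspace_eq)

lemma closedin_rcos: "closedin T U \<Longrightarrow> a \<in> carrier G \<Longrightarrow> closedin T (U #> a)"
  using closedin_continuous_map_preimage[OF rmult_cont, of "inv a" U] rcos_preimage[of U a]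
    closedin_subset[of T U] by (simp add: topspace_eq)

lemma closure_carrier: "T closure_of S \<subseteq> carrier G"
  using closure_of_subset_topspace[of T S] by (simp add: topspace_eq)

text \<open>Products are treated one variable at a time: right translation by \<open>h\<close> in
  \<open>H\<close> preserves the closure, and then left translation by a point of the closure maps
  \<open>H\<close>, hence also its closure, into the closure.\<close>

lemma subgroup_closure:
  assumes "subgroup H G" shows "subgroup (T closure_of H) G"
proof -
  have Hc: "H \<subseteq> carrier G" using assms by (rule subgroup.subset)
  have HH: "H \<subseteq> T closure_of H" using Hc by (simp add: closure_of_subset topspace_eq)
  have 1: "x \<otimes> h \<in> T closure_of H" if "x \<in> T closure_of H" "h \<in> H" for x h
  proof -
    have "(\<lambda>x. x \<otimes> h) ` (T closure_of H) \<subseteq> T closure_of ((\<lambda>x. x \<otimes> h) ` H)"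
      using that Hc by (intro continuous_map_image_closure_subset rmult_cont) auto
    also have "\<dots> \<subseteq> T closure_of H"
      using that assms by (intro closure_of_mono) (auto intro: subgroup.m_closed)
    finally show ?thesis using that by auto
  qed
  have 2: "x \<otimes> y \<in> T closure_of H" if "x \<in> T closure_of H" "y \<in> T closure_of H" for x y
  proof -
    have "(\<lambda>y. x \<otimes> y) ` (T closure_of H) \<subseteq> T closure_of ((\<lambda>y. x \<otimes> y) ` H)"
      using that closure_carrier by (intro continuous_map_image_closure_subset lmult_cont) auto
    also have "\<dots> \<subseteq> T closure_of H"
      using that 1 by (intro closure_of_minimal) auto
    finally show ?thesis using that by auto
  qed
  have 3: "inv x \<in> T closure_of H" if "x \<in> T closure_of H" for x
  proof -
    have "(\<lambda>x. inv x) ` (T closure_of H) \<subseteq> T closure_of ((\<lambda>x. inv x) ` H)"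
      by (intro continuous_map_image_closure_subset inv_cont)
    also have "\<dots> \<subseteq> T closure_of H"
      using that assms by (intro closure_of_mono) (auto intro: subgroup.m_inv_closed)
    finally show ?thesis using that by auto
  qed
  show ?thesis
    using 2 3 HH subgroup.one_closed[OF assms] closure_carrier by (intro subgroupI) auto
qed

lemma normal_closure:
  assumes "H \<lhd> G" shows "(T closure_of H) \<lhd> G"
proof -
  have "x \<otimes> h \<otimes> inv x \<in> T closure_of H" if "x \<in> carrier G" "h \<in> T closure_of H" for x h
  proof -
    have "continuous_map T T ((\<lambda>y. y \<otimes> inv x) \<circ> (\<lambda>y. x \<otimes> y))"
      using that by (intro continuous_map_compose[OF lmult_cont rmult_cont]) auto
    then have "((\<lambda>y. y \<otimes> inv x) \<circ> (\<lambda>y. x \<otimes> y)) ` (T closure_of H)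
        \<subseteq> T closure_of (((\<lambda>y. y \<otimes> inv x) \<circ> (\<lambda>y. x \<otimes> y)) ` H)"
      by (rule continuous_map_image_closure_subset)
    also have "\<dots> \<subseteq> T closure_of H"
      using that assms by (intro closure_of_mono) (auto simp: normal.inv_op_closed2)
    finally show ?thesis using that by (auto simp: o_def image_subset_iff)
  qed
  then show ?thesis
    using subgroup_closure normal_imp_subgroup[OF assms] by (simp add: normal_inv_iff)
qed

text \<open>The coset \<open>N #> x\<close> is an open neighbourhood of \<open>x\<close> and so
  meets \<open>S\<close>. This turns closures into congruences modulo open subgroups, the form in
  which they enter \<open>pseries\<close>.\<close>

lemma closure_mem_cong:
  assumes "x \<in> T closure_of S" "subgroup N G" "openin T N"
  shows "\<exists>s\<in>S. \<exists>n\<in>N. x = n \<otimes> s"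
proof -
  have x: "x \<in> carrier G" using assms closure_carrier by blast
  have "x \<in> N #> x" using assms x by (simp add: rcos_self)
  moreover have "openin T (N #> x)" using assms x by (simp add: openin_rcos)
  ultimately obtain s where s: "s \<in> S" "s \<in> N #> x"
    using assms(1) unfolding in_closure_of by blast
  then obtain n where n: "n \<in> N" "s = n \<otimes> x" by (auto simp: r_coset_def)
  have nc: "n \<in> carrier G" using n assms subgroup.mem_carrier by metis
  have "x = inv n \<otimes> s" using n nc x by (simp add: m_assoc[symmetric])
  then show ?thesis using s n assms subgroup.m_inv_closed by metis
qed

lemma closure_subset_open_subgroup:
  assumes "S \<subseteq> N" "subgroup N G" "openin T N"
  shows "T closure_of S \<subseteq> N"
  using closure_mem_cong[OF _ assms(2,3), where S = S] assms by (auto intro: subgroup.m_closed)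

lemma closedin_open_subgroup: "subgroup N G \<Longrightarrow> openin T N \<Longrightarrow> closedin T N"
  using closure_subset_open_subgroup[of N N] closure_of_subset_eq[of N T]
  by (simp add: subgroup.subset topspace_eq)

lemma openin_subgroup_if_nbhd:
  assumes "subgroup H G" "openin T S" "\<one> \<in> S" "S \<subseteq> H"
  shows "openin T H"
proof (subst openin_subopen, intro ballI)
  fix h assume h: "h \<in> H"
  then have hc: "h \<in> carrier G" using assms subgroup.mem_carrier by metis
  have "S #> h \<subseteq> H" using h assms by (auto simp: r_coset_def intro: subgroup.m_closed)
  moreover have "h \<in> S #> h" using hc assms by (force simp: r_coset_def)
  ultimately show "\<exists>W. openin T W \<and> h \<in> W \<and> W \<subseteq> H"
    using openin_rcos[OF assms(2) hc] by blast
qed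

text \<open>Inside \<open>K\<close> the complement of \<open>H\<close> is a finite union of closed
  cosets.\<close>

lemma openin_finite_index:
  assumes "subgroup H G" "subgroup K G" "H \<subseteq> K" "openin T K" "closedin T H"
    "finite {H #> x | x. x \<in> K}"
  shows "openin T H"
proof -
  have Kc: "K \<subseteq> carrier G" using assms subgroup.subset by blast
  have H: "H \<subseteq> carrier G" using assms subgroup.subset by blast
  let ?F = "{H #> x | x. x \<in> K} - {H}"
  have cl: "closedin T (\<Union>?F)"
    using assms Kc by (intro closedin_Union) (auto intro!: closedin_rcos)
  have "H = K - \<Union>?F"
  proof (intro equalityI subsetI)
    fix x assume x: "x \<in> H"
    have "x \<notin> C" if "C \<in> ?F" for C
    proof
      assume xC: "x \<in> C"
      from that obtain y where y: "C = H #> y" "y \<in> K" by auto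
      then have "H #> y = H #> x"
        using xC Kc assms(1) repr_independence by (metis subsetD)
      moreover have "H #> x = H" using x assms H by (meson coset_join2 subsetD)
      ultimately show False using that y by auto
    qed
    then show "x \<in> K - \<Union>?F" using x assms by blast
  next
    fix x assume x: "x \<in> K - \<Union>?F"
    then have "x \<in> H #> x" using Kc assms by (auto intro: rcos_self)
    then have "H #> x = H" using x by blast
    then show "x \<in> H" using \<open>x \<in> H #> x\<close> by simp
  qed
  moreover have "openin T (K - \<Union>?F)" using assms(4) cl by (rule openin_diff)
  ultimately show ?thesis by simp
qed

end

section \<open>Profinite groups: open normal subgroups form a base at the identity\<close>

locale profinite_group_loc = topgroup +
  assumes comp: "compact_space T" and haus: "Hausdorff_space T"
    and tdisc: "totally_disconnected_space T"
begin

text \<open>The cosets are a disjoint open cover of a compact space, so a finite subcover can omit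
  none of them.\<close>

lemma finite_rcosets_open:
  assumes "subgroup H G" "openin T H" shows "finite (rcosets H)"
proof -
  have "\<exists>F. finite F \<and> F \<subseteq> rcosets H \<and> topspace T \<subseteq> \<Union>F"
  proof -
    have "Ball (rcosets H) (openin T)" using assms openin_rcos by (auto simp: RCOSETS_def)
    moreover have "topspace T \<subseteq> \<Union>(rcosets H)"
      using assms rcosets_part_G topspace_eq by simp
    ultimately show ?thesis using comp unfolding compact_space_alt by blast
  qed
  then obtain F where F: "finite F" "F \<subseteq> rcosets H" "topspace T \<subseteq> \<Union>F" by auto
  have "rcosets H \<subseteq> F"
  proof
    fix C assume C: "C \<in> rcosets H"
    then obtain x where x: "x \<in> carrier G" "C = H #> x" by (auto simp: RCOSETS_def)
    then have "x \<in> C" using assms by (simp add: rcos_self)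
    obtain D where D: "D \<in> F" "x \<in> D" using F x topspace_eq by blast
    then have "D = C" using \<open>x \<in> C\<close> C F rcos_disjoint[OF assms(1)] by (metis (no_types, lifting) disjnt_iff pairwiseD subsetD)
    then show "C \<in> F" using D by simp
  qed
  then show ?thesis using F finite_subset by blast
qed

text \<open>The conjugate \<open>cj x\<close> of \<open>H\<close> depends only on the coset
  \<open>H #> x\<close>, and there are finitely many cosets, so the intersection of all conjugates
  is open.\<close>

lemma open_normal_core:
  assumes H: "subgroup H G" "openin T H"
  shows "\<exists>N\<subseteq>H. open_normal G T N"
proof -
  define cj where "cj x = {y \<in> carrier G. x \<otimes> y \<otimes> inv x \<in> H}" for x
  have Hc: "H \<subseteq> carrier G" using H subgroup.subset by blast
  have opn: "openin T (cj x)" if "x \<in> carrier G" for x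
  proof -
    have "continuous_map T T ((\<lambda>y. y \<otimes> inv x) \<circ> (\<lambda>y. x \<otimes> y))"
      using that by (intro continuous_map_compose[OF lmult_cont rmult_cont]) auto
    from openin_continuous_map_preimage[OF this H(2)]
    show ?thesis by (simp add: cj_def topspace_eq)
  qed
  have cos: "cj (h \<otimes> x) = cj x" if "h \<in> H" "x \<in> carrier G" for h x
  proof -
    have hc: "h \<in> carrier G" using that Hc by auto
    have e: "(h \<otimes> x) \<otimes> y \<otimes> inv (h \<otimes> x) = h \<otimes> (x \<otimes> y \<otimes> inv x) \<otimes> inv h" if "y \<in> carrier G" for y
      using that hc \<open>x \<in> carrier G\<close> by (simp add: inv_mult_group m_assoc)
    have i: "h \<otimes> z \<otimes> inv h \<in> H \<longleftrightarrow> z \<in> H" if "z \<in> carrier G" for z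
    proof
      assume a: "h \<otimes> z \<otimes> inv h \<in> H"
      have "inv h \<otimes> (h \<otimes> z \<otimes> inv h) \<otimes> h \<in> H"
        using a \<open>h \<in> H\<close> H by (meson subgroup.m_closed subgroup.m_inv_closed)
      moreover have "inv h \<otimes> (h \<otimes> z \<otimes> inv h) \<otimes> h = z"
        using that hc by (simp add: m_assoc inv_solve_left)
      ultimately show "z \<in> H" by simp
    qed (use \<open>h \<in> H\<close> H in \<open>meson subgroup.m_closed subgroup.m_inv_closed\<close>)
    show ?thesis unfolding cj_def using e i that by auto
  qed
  have "finite (cj ` carrier G)"
  proof -
    have "\<exists>r. C \<in> rcosets H \<longrightarrow> r \<in> carrier G \<and> C = H #> r" for C by (auto simp: RCOSETS_def)
    then obtain r where r: "\<And>C. C \<in> rcosets H \<Longrightarrow> r C \<in> carrier G \<and> C = H #> r C" by metis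
    have "cj ` carrier G \<subseteq> (\<lambda>C. cj (r C)) ` (rcosets H)"
    proof
      fix S assume "S \<in> cj ` carrier G"
      then obtain x where x: "x \<in> carrier G" "S = cj x" by auto
      have C: "H #> x \<in> rcosets H" using x by (auto simp: RCOSETS_def)
      have "x \<in> H #> r (H #> x)" using r[OF C] rcos_self[OF x(1) H(1)] by simp
      then obtain h where "h \<in> H" "x = h \<otimes> r (H #> x)" by (auto simp: r_coset_def)
      then have "S = cj (r (H #> x))" using cos r[OF C] x by metis
      then show "S \<in> (\<lambda>C. cj (r C)) ` (rcosets H)" using C by blast
    qed
    then show ?thesis using finite_rcosets_open[OF H] finite_subset by blast
  qed
  then have "openin T (\<Inter>(cj ` carrier G))"
    using opn by (intro openin_Inter) auto
  moreover have "\<Inter>(cj ` carrier G) \<lhd> G"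
    unfolding normal_inv_iff
  proof (intro conjI ballI)
    show "subgroup (\<Inter>(cj ` carrier G)) G"
    proof (rule subgroupI)
      show "\<Inter>(cj ` carrier G) \<subseteq> carrier G" unfolding cj_def using one_closed by blast
      show "\<Inter>(cj ` carrier G) \<noteq> {}"
        using subgroup.one_closed[OF H(1)] by (auto simp: cj_def intro!: exI[of _ \<one>])
    next
      fix a assume a: "a \<in> \<Inter>(cj ` carrier G)"
      then have ac: "a \<in> carrier G" unfolding cj_def using one_closed by blast
      show "inv a \<in> \<Inter>(cj ` carrier G)"
      proof (rule InterI)
        fix S assume "S \<in> cj ` carrier G"
        then obtain x where x: "x \<in> carrier G" "S = cj x" by auto
        have "x \<otimes> a \<otimes> inv x \<in> H" using a x by (auto simp: cj_def)
        then have "inv (x \<otimes> a \<otimes> inv x) \<in> H" using H by (simp add: subgroup.m_inv_closed)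
        then show "inv a \<in> S" using x ac by (simp add: cj_def inv_mult_group m_assoc)
      qed
    next
      fix a b assume a: "a \<in> \<Inter>(cj ` carrier G)" and b: "b \<in> \<Inter>(cj ` carrier G)"
      then have ac: "a \<in> carrier G" "b \<in> carrier G" unfolding cj_def using one_closed by blast+
      show "a \<otimes> b \<in> \<Inter>(cj ` carrier G)"
      proof (rule InterI)
        fix S assume "S \<in> cj ` carrier G"
        then obtain x where x: "x \<in> carrier G" "S = cj x" by auto
        have "x \<otimes> a \<otimes> inv x \<in> H" "x \<otimes> b \<otimes> inv x \<in> H" using a b x by (auto simp: cj_def)
        then have "(x \<otimes> a \<otimes> inv x) \<otimes> (x \<otimes> b \<otimes> inv x) \<in> H" using H by (simp add: subgroup.m_closed)
        moreover have "(x \<otimes> a \<otimes> inv x) \<otimes> (x \<otimes> b \<otimes> inv x) = x \<otimes> (a \<otimes> b) \<otimes> inv x"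
          using x ac by (simp add: m_assoc inv_solve_left)
        ultimately show "a \<otimes> b \<in> S" using x ac by (simp add: cj_def)
      qed
    qed
  next
    fix g a assume g: "g \<in> carrier G" and a: "a \<in> \<Inter>(cj ` carrier G)"
    then have ac: "a \<in> carrier G" unfolding cj_def using one_closed by blast
    show "g \<otimes> a \<otimes> inv g \<in> \<Inter>(cj ` carrier G)"
    proof (rule InterI)
      fix S assume "S \<in> cj ` carrier G"
      then obtain x where x: "x \<in> carrier G" "S = cj x" by auto
      have "a \<in> cj (x \<otimes> g)" using a x g by blast
      then show "g \<otimes> a \<otimes> inv g \<in> S" using x g ac by (simp add: cj_def inv_mult_group m_assoc)
    qed
  qed
  moreover have "\<Inter>(cj ` carrier G) \<subseteq> H"
  proof -
    have "cj \<one> \<subseteq> H" by (auto simp: cj_def)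
    then show ?thesis by blast
  qed
  ultimately show ?thesis unfolding open_normal_def by blast
qed

text \<open>Van Dantzig: a compact open neighbourhood \<open>C\<close> of the identity absorbs a symmetric
  neighbourhood under right multiplication, hence contains the subgroup it generates.\<close>
lemma open_normal_base:
  assumes U: "openin T U" "\<one> \<in> U" shows "\<exists>N\<subseteq>U. open_normal G T N"
proof -
  \<comment> \<open>In a compact Hausdorff space two closed sets that no connected set meets
    simultaneously are separated by a clopen set; here connected sets have at most one
    point.\<close>
  have "separated_between T {\<one>} (topspace T - U)"
  proof (rule cut_wire_fence_theorem[OF comp haus])
    show "closedin T {\<one>}" using haus by (simp add: closedin_Hausdorff_sing_eq topspace_eq)
    show "closedin T (topspace T - U)" using U by blast
    fix C assume "connectedin T C"
    then obtain a where "C \<subseteq> {a}" using tdisc unfolding totally_disconnected_space_def by blast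
    then show "disjnt C {\<one>} \<or> disjnt C (topspace T - U)" using U by (auto simp: disjnt_iff)
  qed
  then obtain C D where CD: "openin T C" "openin T D" "C \<union> D = topspace T" "disjnt C D"
    "\<one> \<in> C" "topspace T - U \<subseteq> D" unfolding separated_between_def by auto
  have CU: "C \<subseteq> U" using CD by (auto simp: disjnt_iff)
  have Cc: "C \<subseteq> carrier G" using CD topspace_eq by blast
  have "C = topspace T - D" using CD by (auto simp: disjnt_iff)
  then have "closedin T C" using CD by auto
  then have cC: "compactin T C" using comp closedin_compact_space by blast
  define W where "W = {z \<in> topspace (prod_topology T T). (case z of (x, y) \<Rightarrow> x \<otimes> y) \<in> C}"
  have "openin (prod_topology T T) W"
    unfolding W_def using mult_cont CD(1) by (rule openin_continuous_map_preimage)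
  moreover have "C \<times> {\<one>} \<subseteq> W" using Cc by (auto simp: W_def topspace_eq)
  \<comment> \<open>The tube lemma makes the choice of \<open>B\<close> uniform over
    \<open>C\<close>, so right multiplication by \<open>B\<close> maps \<open>C\<close> into
    itself.\<close>
  ultimately obtain A B where AB: "openin T A" "openin T B" "C \<subseteq> A" "\<one> \<in> B" "A \<times> B \<subseteq> W"
    using tube_lemma_left[OF _ cC, where y = \<one> and Y = T and W = W] topspace_eq by auto
  define S where "S = B \<inter> {x \<in> topspace T. inv x \<in> B}"
  have opS: "openin T S" unfolding S_def
    using AB openin_continuous_map_preimage[OF inv_cont AB(2)] by blast
  have oneS: "\<one> \<in> S" using AB by (simp add: S_def topspace_eq)
  have Sc: "S \<subseteq> carrier G" by (auto simp: S_def topspace_eq)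
  have CS: "c \<otimes> s \<in> C" if "c \<in> C" "s \<in> B" for c s
    using AB(3) subsetD[OF AB(5), of "(c, s)"] that unfolding W_def by auto
  have gen: "\<forall>c\<in>C. c \<otimes> h \<in> C" if "h \<in> generate G S" for h
    using that
  proof induction
    case one then show ?case using Cc by auto
  next
    case (incl h) then show ?case using CS by (auto simp: S_def)
  next
    case (inv h) then show ?case using CS by (auto simp: S_def)
  next
    case (eng h1 h2)
    then show ?case
      using generate_in_carrier[OF Sc] Cc by (metis m_assoc subsetD)
  qed
  have "generate G S \<subseteq> C"
  proof
    fix h assume h: "h \<in> generate G S"
    then have "\<one> \<otimes> h \<in> C" using gen CD by blast
    then show "h \<in> C" using h generate_in_carrier[OF Sc] by simp
  qed
  moreover have "subgroup (generate G S) G" using Sc by (rule generate_is_subgroup)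
  moreover have "openin T (generate G S)"
    using openin_subgroup_if_nbhd[OF \<open>subgroup (generate G S) G\<close> opS oneS] by (auto intro: generate.incl)
  ultimately show ?thesis using open_normal_core CU by (meson subset_trans)
qed

text \<open>By \<open>open_normal_base\<close> every open neighbourhood of \<open>x\<close> contains
  a coset \<open>N #> x\<close>, so meeting all such cosets is density.\<close>

lemma dense_if_all_quotients:
  assumes H: "S \<subseteq> carrier G" and d: "\<And>N x. open_normal G T N \<Longrightarrow> x \<in> carrier G \<Longrightarrow> \<exists>s\<in>S. \<exists>n\<in>N. x = n \<otimes> s"
  shows "T closure_of S = carrier G"
proof (intro equalityI closure_carrier subsetI)
  fix x assume x: "x \<in> carrier G"
  show "x \<in> T closure_of S" unfolding in_closure_of
  proof (intro conjI allI impI)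
    show "x \<in> topspace T" using x topspace_eq by simp
    fix U assume U: "x \<in> U \<and> openin T U"
    then have Uc: "U \<subseteq> carrier G" using openin_subset topspace_eq by blast
    have "openin T (U #> inv x)" using U x openin_rcos by simp
    moreover have "\<one> \<in> U #> inv x" using x U by (force simp: r_coset_def)
    ultimately obtain N where N: "N \<subseteq> U #> inv x" "open_normal G T N" using open_normal_base by blast
    obtain s n where s: "s \<in> S" "n \<in> N" "x = n \<otimes> s" using d[OF N(2) x] by blast
    have sn: "subgroup N G" using N unfolding open_normal_def by (simp add: normal_imp_subgroup)
    have nc: "n \<in> carrier G" using s sn subgroup.mem_carrier by metis
    have sc: "s \<in> carrier G" using s H by auto
    have "inv n \<in> N" using sn s(2) by (rule subgroup.m_inv_closed)
    then have "inv n \<in> U #> inv x" using N by blast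
    then obtain u where u: "u \<in> U" "inv n = u \<otimes> inv x" by (auto simp: r_coset_def)
    have "s = inv n \<otimes> x" using s nc sc by (simp add: m_assoc[symmetric])
    also have "\<dots> = u" using u x Uc by (simp add: m_assoc subset_iff)
    finally show "\<exists>y. y \<in> S \<and> y \<in> U" using u s by blast
  qed
qed

end

subsection \<open>Groups of class two and finite \<open>p\<close>-groups\<close>

text \<open>\<open>commutator\<close> is only typed for \<open>monoid\<close> records without extension fields.\<close>
locale mgroup = group G for G :: "'a monoid" (structure)
begin

lemma commutator_closed [simp]:
  "x \<in> carrier G \<Longrightarrow> y \<in> carrier G \<Longrightarrow> commutator G x y \<in> carrier G"
  by (simp add: commutator_def)

lemma commutator_swap:
  "x \<in> carrier G \<Longrightarrow> y \<in> carrier G \<Longrightarrow> commutator G x y \<otimes> (y \<otimes> x) = x \<otimes> y"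
  by (simp add: commutator_def m_assoc)

lemma commutator_inv:
  "x \<in> carrier G \<Longrightarrow> y \<in> carrier G \<Longrightarrow> inv (commutator G x y) = commutator G y x"
  by (simp add: commutator_def m_assoc inv_mult_group)

lemma commutator_eq_one_iff:
  "x \<in> carrier G \<Longrightarrow> y \<in> carrier G \<Longrightarrow> commutator G x y = \<one> \<longleftrightarrow> x \<otimes> y = y \<otimes> x"
  using commutator_swap[of x y]
  by (metis commutator_closed l_one m_closed r_cancel_one')

lemma commutator_mult_left_central:
  assumes c: "w \<in> carrier G" "w' \<in> carrier G" "y \<in> carrier G"
    and cen: "w \<otimes> commutator G w' y = commutator G w' y \<otimes> w"
  shows "commutator G (w \<otimes> w') y = commutator G w' y \<otimes> commutator G w y"
proof -
  let ?C = "commutator G w' y"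
  have C: "?C \<in> carrier G" using c by simp
  have "w \<otimes> w' \<otimes> y = w \<otimes> (?C \<otimes> (y \<otimes> w'))" using c by (simp add: commutator_swap m_assoc)
  also have "\<dots> = (w \<otimes> ?C) \<otimes> (y \<otimes> w')" using c C by (simp add: m_assoc)
  also have "\<dots> = ?C \<otimes> (w \<otimes> y) \<otimes> w'" using c C cen by (simp add: m_assoc)
  also have "w \<otimes> y = commutator G w y \<otimes> (y \<otimes> w)" using c by (simp add: commutator_swap)
  finally have e: "w \<otimes> w' \<otimes> y = ?C \<otimes> (commutator G w y \<otimes> (y \<otimes> w)) \<otimes> w'" .
  have "commutator G (w \<otimes> w') y = (w \<otimes> w' \<otimes> y) \<otimes> inv (w \<otimes> w') \<otimes> inv y"
    using c by (simp add: commutator_def)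
  also have "\<dots> = ?C \<otimes> commutator G w y"
    unfolding e using c C by (simp add: m_assoc inv_mult_group)
  finally show ?thesis .
qed

text \<open>Conjugation by \<open>x\<close> sends \<open>z\<close> to \<open>c \<otimes> z\<close>,
  and the power of a product of commuting elements splits.\<close>

lemma twisted_pow:
  assumes c: "x \<in> carrier G" "z \<in> carrier G" "c \<in> carrier G"
    and xz: "x \<otimes> z = c \<otimes> (z \<otimes> x)" and cz: "c \<otimes> z = z \<otimes> c"
  shows "x \<otimes> z [^] (k::nat) = c [^] k \<otimes> (z [^] k \<otimes> x)"
proof (induction k)
  case 0 then show ?case using c by simp
next
  case (Suc k)
  have zc: "z [^] k \<otimes> c = c \<otimes> z [^] k" using c cz by (metis group_commutes_pow)
  have "x \<otimes> z [^] Suc k = (x \<otimes> z [^] k) \<otimes> z" using c by (simp add: m_assoc)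
  also have "\<dots> = c [^] k \<otimes> z [^] k \<otimes> (x \<otimes> z)" using c Suc by (simp add: m_assoc)
  also have "\<dots> = c [^] k \<otimes> (z [^] k \<otimes> c) \<otimes> (z \<otimes> x)" using c xz by (simp add: m_assoc)
  also have "\<dots> = c [^] Suc k \<otimes> (z [^] Suc k \<otimes> x)" using c zc by (simp add: m_assoc)
  finally show ?case .
qed

text \<open>Moving the last \<open>c\<close> past \<open>z [^] n\<close> costs
  \<open>e [^] n\<close>, so the exponent of \<open>e\<close> is 0 + 1 + ... + (n - 1).\<close>

lemma pow_mult_class2:
  assumes c: "c \<in> carrier G" "z \<in> carrier G" "e \<in> carrier G"
    and zc: "z \<otimes> c = e \<otimes> (c \<otimes> z)" and ec: "e \<otimes> c = c \<otimes> e" and ez: "e \<otimes> z = z \<otimes> e"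
  shows "(c \<otimes> z) [^] (n::nat) = e [^] (n * (n - 1) div 2) \<otimes> (c [^] n \<otimes> z [^] n)"
proof (induction n)
  case 0 then show ?case using c by simp
next
  case (Suc n)
  let ?t = "n * (n - 1) div 2"
  have t: "Suc n * (Suc n - 1) div 2 = ?t + n"
  proof -
    have "Suc n * (Suc n - 1) = n * (n - 1) + n * 2" by (cases n) auto
    then have "Suc n * (Suc n - 1) div 2 = (n * (n - 1) + n * 2) div 2" by (rule arg_cong)
    then show ?thesis by (simp only: div_mult_self3)
  qed
  have znc: "z [^] n \<otimes> c = e [^] n \<otimes> (c \<otimes> z [^] n)"
  proof -
    have "c \<otimes> z = inv e \<otimes> (z \<otimes> c)" using zc c by simp
    moreover have "inv e \<otimes> z = z \<otimes> inv e"
    proof -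
      have "z \<otimes> inv e = inv e \<otimes> (e \<otimes> z) \<otimes> inv e" using c by simp
      also have "\<dots> = inv e \<otimes> ((z \<otimes> e) \<otimes> inv e)" using c by (simp only: ez m_assoc m_closed inv_closed)
      also have "\<dots> = inv e \<otimes> z" using c by (simp add: m_assoc)
      finally show ?thesis by simp
    qed
    ultimately have "c \<otimes> z [^] n = (inv e) [^] n \<otimes> (z [^] n \<otimes> c)"
      using c by (intro twisted_pow) auto
    then show ?thesis using c by (simp add: nat_pow_inv)
  qed
  have enc: "c [^] n \<otimes> e [^] n = e [^] n \<otimes> c [^] n"
    using ec c by (metis group_commutes_pow nat_pow_closed)
  have "(c \<otimes> z) [^] Suc n = e [^] ?t \<otimes> (c [^] n \<otimes> z [^] n) \<otimes> (c \<otimes> z)"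
    using Suc by simp
  also have "\<dots> = e [^] ?t \<otimes> (c [^] n \<otimes> (z [^] n \<otimes> c) \<otimes> z)" using c by (simp add: m_assoc)
  also have "\<dots> = e [^] ?t \<otimes> ((c [^] n \<otimes> e [^] n) \<otimes> (c \<otimes> z [^] n) \<otimes> z)"
    using c znc by (simp add: m_assoc)
  also have "\<dots> = (e [^] ?t \<otimes> e [^] n) \<otimes> (c [^] Suc n \<otimes> z [^] Suc n)"
    using c enc by (simp add: m_assoc)
  also have "e [^] ?t \<otimes> e [^] n = e [^] (Suc n * (Suc n - 1) div 2)"
    unfolding t using c by (simp add: nat_pow_mult)
  finally show ?case .
qed

text \<open>For odd \<open>p\<close> the exponent p (p - 1) / 2 is a multiple of \<open>p\<close>;
  for \<open>p = 2\<close> it is 1, so \<open>e\<close> itself has to be trivial.\<close>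

lemma prime_pow_mult_class2:
  assumes c: "c \<in> carrier G" "z \<in> carrier G" "e \<in> carrier G"
    and zc: "z \<otimes> c = e \<otimes> (c \<otimes> z)" and ec: "e \<otimes> c = c \<otimes> e" and ez: "e \<otimes> z = z \<otimes> e"
    and p: "Factorial_Ring.prime (p::nat)" "e [^] p = \<one>" "p = 2 \<Longrightarrow> e = \<one>"
  shows "(c \<otimes> z) [^] p = c [^] p \<otimes> z [^] p"
proof -
  have "e [^] (p * (p - 1) div 2) = \<one>"
  proof (cases "p = 2")
    case False
    then have "even (p - 1)" using p prime_odd_nat[of p] prime_ge_2_nat[of p] by simp
    then have "p * (p - 1) div 2 = p * ((p - 1) div 2)" by (simp add: div_mult_swap)
    then show ?thesis using c p by (metis nat_pow_one nat_pow_pow)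
  qed (use p in simp)
  then show ?thesis using pow_mult_class2[OF assms(1-6), of p] c by simp
qed

text \<open>Class equation: if \<open>\<one>\<close> were the only fixed point of conjugation, the
  order would be 1 modulo \<open>p\<close>. A suitable p-power of the central element so found has
  order \<open>p\<close>.\<close>

lemma p_group_central_element:
  assumes p: "Factorial_Ring.prime (p::nat)" and o: "order G = p ^ k" and k: "k > 0"
  shows "\<exists>z\<in>carrier G. z \<noteq> \<one> \<and> z [^] p = \<one> \<and> (\<forall>x\<in>carrier G. x \<otimes> z = z \<otimes> x)"
proof -
  define \<phi> where "\<phi> = (\<lambda>g. \<lambda>h \<in> carrier G. g \<otimes> h \<otimes> inv g)"
  interpret A: group_action G "carrier G" \<phi>
    unfolding \<phi>_def by (rule action_by_conjugation)
  have fin: "finite (carrier G)" using o p order_gt_0_iff_finite by (simp add: prime_gt_0_nat)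
  have orb1: "orbit G \<phi> \<one> = {\<one>}"
    unfolding orbit_def \<phi>_def by (auto intro!: exI[of _ \<one>])
  have central: "\<forall>g\<in>carrier G. g \<otimes> x = x \<otimes> g" if "x \<in> carrier G" "card (orbit G \<phi> x) = 1" for x
  proof
    fix g assume g: "g \<in> carrier G"
    have "x \<in> orbit G \<phi> x" using that by (simp add: A.orbit_refl)
    then have "orbit G \<phi> x = {x}" using that(2) card_1_singletonE by (metis singletonD)
    moreover have "g \<otimes> x \<otimes> inv g \<in> orbit G \<phi> x" using g that unfolding orbit_def \<phi>_def by auto
    ultimately have "g \<otimes> x \<otimes> inv g = x" by simp
    then show "g \<otimes> x = x \<otimes> g" using g that by (metis inv_solve_right' m_closed)
  qed
  have "\<exists>x\<in>carrier G. x \<noteq> \<one> \<and> card (orbit G \<phi> x) = 1"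
  proof (rule ccontr)
    assume neg: "\<not> ?thesis"
    have dv: "p dvd card (orbit G \<phi> x)" if x: "x \<in> carrier G" "x \<noteq> \<one>" for x
    proof -
      have "card (orbit G \<phi> x) dvd p ^ k"
        using A.orbit_stabilizer_theorem[OF x(1)] o by (metis dvd_triv_left)
      then obtain j where "card (orbit G \<phi> x) = p ^ j" using p by (auto simp: divides_primepow_nat)
      moreover have "card (orbit G \<phi> x) \<noteq> 1" using neg x by blast
      ultimately show ?thesis by (cases j) auto
    qed
    have part: "partition (carrier G) (orbits G (carrier G) \<phi>)" by (rule A.orbit_partition)
    have "\<Union>(orbits G (carrier G) \<phi>) = carrier G"
      using part by (auto simp: partition_def)
    moreover have "pairwise disjnt (orbits G (carrier G) \<phi>)"
      using part unfolding partition_def pairwise_def disjnt_iff by blast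
    moreover have fo: "finite (orbits G (carrier G) \<phi>)"
      using fin unfolding orbits_def by (simp add: setcompr_eq_image)
    moreover have "finite C" if "C \<in> orbits G (carrier G) \<phi>" for C
      using that fin calculation(1) by (metis Union_upper finite_subset)
    ultimately have "order G = sum card (orbits G (carrier G) \<phi>)"
      unfolding order_def using card_Union_disjoint by metis
    also have "\<dots> = card {\<one>} + sum card (orbits G (carrier G) \<phi> - {{\<one>}})"
      using orb1 fo by (intro sum.remove) (auto simp: orbits_def intro!: exI[of _ \<one>])
    finally have "p ^ k = 1 + sum card (orbits G (carrier G) \<phi> - {{\<one>}})" using o by simp
    moreover have "p dvd sum card (orbits G (carrier G) \<phi> - {{\<one>}})"
    proof (rule dvd_sum)
      fix C assume "C \<in> orbits G (carrier G) \<phi> - {{\<one>}}"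
      then obtain x where "x \<in> carrier G" "C = orbit G \<phi> x" "x \<noteq> \<one>"
        using orb1 by (auto simp: orbits_def)
      then show "p dvd card C" using dv by simp
    qed
    moreover have "p dvd p ^ k" using k by simp
    ultimately have "p dvd 1" by (metis dvd_add_left_iff)
    then show False using p by simp
  qed
  then obtain x where x: "x \<in> carrier G" "x \<noteq> \<one>" "\<And>g. g \<in> carrier G \<Longrightarrow> g \<otimes> x = x \<otimes> g"
    using central by blast
  have ex: "x [^] (p ^ k) = \<one>" using pow_order_eq_1[OF x(1)] o by simp
  define j where "j = (LEAST j. x [^] (p ^ j) = \<one>)"
  have j: "x [^] (p ^ j) = \<one>" unfolding j_def using ex by (rule LeastI)
  then obtain i where i: "j = Suc i" using x by (cases j) auto
  have "x [^] (p ^ i) \<noteq> \<one>" using i not_less_Least[of i "\<lambda>j. x [^] (p ^ j) = \<one>"] j_def by auto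
  moreover have "(x [^] (p ^ i)) [^] p = \<one>" using j x unfolding i by (simp add: nat_pow_pow mult.commute)
  moreover have "\<forall>g\<in>carrier G. g \<otimes> x [^] (p ^ i) = x [^] (p ^ i) \<otimes> g"
    using x by (metis group_commutes_pow)
  ultimately show ?thesis using x by blast
qed

end

section \<open>Cosets of normal subgroups and ordered products of powers\<close>

lemma (in normal) quotient_hom: "group_hom G (G Mod H) (\<lambda>x. H #> x)"
  by (intro group_hom.intro group_hom_axioms.intro is_group factorgroup_is_group r_coset_hom_Mod)

lemma (in normal) coset_eq_iff:
  assumes "x \<in> carrier G" "y \<in> carrier G"
  shows "H #> x = H #> y \<longleftrightarrow> x \<otimes> inv y \<in> H"
proof
  assume "H #> x = H #> y"
  then have "x \<in> H #> y" using rcos_self[OF assms(1) is_subgroup] by simp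
  then show "x \<otimes> inv y \<in> H" using assms by (auto simp: r_coset_def m_assoc)
next
  assume "x \<otimes> inv y \<in> H"
  then have "x \<in> H #> y" using assms by (auto simp: r_coset_def m_assoc intro!: bexI[of _ "x \<otimes> inv y"])
  then show "H #> x = H #> y" using repr_independence[OF _ assms(2) is_subgroup] by simp
qed

lemma (in normal) coset_eq_self_iff: "x \<in> carrier G \<Longrightarrow> H #> x = H \<longleftrightarrow> x \<in> H"
  using coset_eq_iff[of x \<one>] subset by simp

lemma hom_commutator:
  fixes G :: "'a monoid" and H :: "'b monoid"
  assumes "group_hom G H h" "x \<in> carrier G" "y \<in> carrier G"
  shows "h (commutator G x y) = commutator H (h x) (h y)"
proof -
  interpret group_hom G H h by fact
  show ?thesis using assms by (simp add: commutator_def)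
qed

fun mprod :: "('a, 'b) monoid_scheme \<Rightarrow> 'a list \<Rightarrow> nat list \<Rightarrow> 'a" where
  "mprod G (g # gs) (a # as) = g [^]\<^bsub>G\<^esub> a \<otimes>\<^bsub>G\<^esub> mprod G gs as"
| "mprod G _ _ = \<one>\<^bsub>G\<^esub>"

lemma (in monoid) mprod_closed [simp]: "set gs \<subseteq> carrier G \<Longrightarrow> mprod G gs as \<in> carrier G"
proof (induction gs arbitrary: as)
  case (Cons g gs)
  then show ?case by (cases as) auto
qed simp

lemma (in group) mprod_mem:
  assumes "subgroup S G" and "set gs \<subseteq> carrier G"
    and "length as = length gs" "\<And>i. i < length gs \<Longrightarrow> gs ! i [^] as ! i \<in> S"
  shows "mprod G gs as \<in> S"
  using assms(2-)
proof (induction gs as rule: list_induct2'[case_names nil c1 c2 cons])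
  case (cons g gs a as)
  have "g [^] a \<in> S" using cons.prems(3)[of 0] by simp
  moreover have "mprod G gs as \<in> S"
    using cons.prems(1,2) cons.prems(3)[of "Suc _"] by (intro cons.IH) auto
  ultimately show ?case using assms(1) by (simp add: subgroup.m_closed)
qed (use assms(1) subgroup.one_closed in auto)

lemma (in group_hom) hom_mprod:
  "set gs \<subseteq> carrier G \<Longrightarrow> h (mprod G gs as) = mprod H (map h gs) as"
proof (induction gs arbitrary: as)
  case (Cons g gs)
  then show ?case by (cases as) (auto simp: hom_nat_pow)
qed simp

text \<open>Each power from the second product is moved left past the remaining factors of the
  first, which is why exactly these powers are assumed central.\<close>

lemma (in group) mprod_add:
  assumes "set gs \<subseteq> carrier G" "length as = length gs" "length bs = length gs"
    and "\<And>i x. i < length gs \<Longrightarrow> x \<in> carrier G \<Longrightarrow> x \<otimes> gs ! i [^] (bs ! i) = gs ! i [^] (bs ! i) \<otimes> x"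
  shows "mprod G gs (map2 (+) as bs) = mprod G gs as \<otimes> mprod G gs bs"
  using assms
proof (induction gs arbitrary: as bs)
  case (Cons g gs)
  obtain a as' b bs' where ab: "as = a # as'" "bs = b # bs'"
    using Cons.prems by (metis length_Suc_conv)
  have c: "g \<in> carrier G" "mprod G gs as' \<in> carrier G" "mprod G gs bs' \<in> carrier G"
    using Cons.prems by auto
  have cen: "x \<otimes> g [^] b = g [^] b \<otimes> x" if "x \<in> carrier G" for x
    using Cons.prems(4)[of 0 x] that ab by simp
  have IH: "mprod G gs (map2 (+) as' bs') = mprod G gs as' \<otimes> mprod G gs bs'"
    using Cons.prems(1-3) Cons.prems(4)[of "Suc _"] ab by (intro Cons.IH) auto
  have "mprod G (g # gs) (map2 (+) as bs) = (g [^] a \<otimes> g [^] b) \<otimes> (mprod G gs as' \<otimes> mprod G gs bs')"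
    using c IH ab by (simp add: nat_pow_mult)
  also have "\<dots> = g [^] a \<otimes> ((g [^] b \<otimes> mprod G gs as') \<otimes> mprod G gs bs')" using c by (simp add: m_assoc)
  also have "g [^] b \<otimes> mprod G gs as' = mprod G gs as' \<otimes> g [^] b" using cen c by simp
  finally show ?case using c ab by (simp add: m_assoc)
qed auto

subsection \<open>The \<open>p\<close>-power map on the lower \<open>p\<close>-series\<close>

text \<open>The hypotheses of the class-two identities hold only modulo a term of the series.
  Applying the identities in the image of \<open>h\<close> while stating them for representatives
  keeps the later computations inside \<open>G\<close>.\<close>

lemma hom_prime_pow_mult_class2:
  fixes G :: "'a monoid" (structure) and H :: "'b monoid"
  assumes "group_hom G H h" and c: "c \<in> carrier G" "z \<in> carrier G" "e \<in> carrier G"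
    and "h (z \<otimes> c) = h (e \<otimes> (c \<otimes> z))" "h (e \<otimes> c) = h (c \<otimes> e)" "h (e \<otimes> z) = h (z \<otimes> e)"
    and "Factorial_Ring.prime (p::nat)" "h (e [^] p) = h \<one>" "p = 2 \<Longrightarrow> h e = h \<one>"
  shows "h ((c \<otimes> z) [^] p) = h (c [^] p \<otimes> z [^] p)"
proof -
  interpret group_hom G H h by fact
  interpret H: mgroup H by (rule mgroup.intro) (rule H.is_group)
  show ?thesis
    using H.prime_pow_mult_class2[of "h c" "h z" "h e" p] assms by (simp add: hom_nat_pow)
qed

lemma hom_twisted_pow:
  fixes G :: "'a monoid" (structure) and H :: "'b monoid"
  assumes "group_hom G H h" and c: "x \<in> carrier G" "z \<in> carrier G" "c \<in> carrier G"
    and "h (x \<otimes> z) = h (c \<otimes> (z \<otimes> x))" "h (c \<otimes> z) = h (z \<otimes> c)"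
  shows "h (x \<otimes> z [^] (k::nat)) = h (c [^] k \<otimes> (z [^] k \<otimes> x))"
proof -
  interpret group_hom G H h by fact
  interpret H: mgroup H by (rule mgroup.intro) (rule H.is_group)
  show ?thesis using H.twisted_pow[of "h x" "h z" "h c" k] assms by (simp add: hom_nat_pow)
qed

lemma hom_commutator_mult_left:
  fixes G :: "'a monoid" (structure) and H :: "'b monoid"
  assumes h: "group_hom G H h" and c: "w \<in> carrier G" "w' \<in> carrier G" "y \<in> carrier G"
    and "h (w \<otimes> commutator G w' y) = h (commutator G w' y \<otimes> w)"
  shows "h (commutator G (w \<otimes> w') y) = h (commutator G w' y \<otimes> commutator G w y)"
proof -
  interpret group_hom G H h by fact
  interpret G: mgroup G by (rule mgroup.intro) (rule G.is_group)
  interpret H: mgroup H by (rule mgroup.intro) (rule H.is_group)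
  show ?thesis
    using H.commutator_mult_left_central[of "h w" "h w'" "h y"] assms
    by (simp add: hom_commutator[OF h] del: G.commutator_closed)
       (simp add: hom_commutator[OF h])
qed

lemma hom_commutator_eq_one_iff:
  fixes G :: "'a monoid" (structure) and H :: "'b monoid"
  assumes h: "group_hom G H h" and c: "x \<in> carrier G" "y \<in> carrier G"
  shows "h (commutator G x y) = h \<one> \<longleftrightarrow> h (x \<otimes> y) = h (y \<otimes> x)"
proof -
  interpret group_hom G H h by fact
  interpret H: mgroup H by (rule mgroup.intro) (rule H.is_group)
  show ?thesis using H.commutator_eq_one_iff[of "h x" "h y"] c by (simp add: hom_commutator[OF h])
qed

text \<open>The algebraic content of the lower \<open>p\<close>-series of a powerful group: closures only enter through
  congruences modulo later (open) terms.\<close>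
locale pseries = mgroup G for G :: "'g monoid" (structure) +
  fixes p :: nat and P :: "nat \<Rightarrow> 'g set"
  assumes p_prime: "Factorial_Ring.prime p"
    and P_0: "P 0 = carrier G"
    and P_normal: "P n \<lhd> G"
    and P_dec: "P (Suc n) \<subseteq> P n"
    and P_pow: "x \<in> P n \<Longrightarrow> x [^] p \<in> P (Suc n)"
    and P_comm: "x \<in> P n \<Longrightarrow> y \<in> carrier G \<Longrightarrow> commutator G x y \<in> P (Suc n)"
    and P_gen: "x \<in> P (Suc n) \<Longrightarrow>
      \<exists>s\<in>generate G ({x [^] p | x. x \<in> P n} \<union> {commutator G x y | x y. x \<in> P n \<and> y \<in> carrier G}).
      \<exists>u\<in>P (Suc (Suc n)). x = u \<otimes> s"
    and P_powerful: "x \<in> P 1 \<Longrightarrow> \<exists>s\<in>generate G {x [^] p | x. x \<in> carrier G}. \<exists>u\<in>P m. x = u \<otimes> s"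
    and P_two: "p = 2 \<Longrightarrow> x \<in> carrier G \<Longrightarrow> y \<in> carrier G \<Longrightarrow> commutator G x y \<in> P 2"
begin

lemma P_sub: "subgroup (P n) G" using P_normal by (rule normal_imp_subgroup)

lemma P_mem [simp]: "x \<in> P n \<Longrightarrow> x \<in> carrier G" using P_sub subgroup.mem_carrier by metis

lemma P_anti: "m \<le> n \<Longrightarrow> P n \<subseteq> P m"
  by (rule lift_Suc_antimono_le[of P]) (rule P_dec)

lemma hom: "group_hom G (G Mod P n) (\<lambda>x. P n #> x)"
  using P_normal by (rule normal.quotient_hom)

lemma cs_iff: "x \<in> carrier G \<Longrightarrow> y \<in> carrier G \<Longrightarrow> P n #> x = P n #> y \<longleftrightarrow> x \<otimes> inv y \<in> P n"
  using P_normal by (rule normal.coset_eq_iff)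

lemma cs_one_iff: "x \<in> carrier G \<Longrightarrow> P n #> x = P n #> \<one> \<longleftrightarrow> x \<in> P n"
  by (simp add: cs_iff)

lemma cs_mult_cong:
  assumes "P n #> x = P n #> x'" "P n #> y = P n #> y'"
    "x \<in> carrier G" "x' \<in> carrier G" "y \<in> carrier G" "y' \<in> carrier G"
  shows "P n #> (x \<otimes> y) = P n #> (x' \<otimes> y')"
proof -
  interpret h: group_hom G "G Mod P n" "\<lambda>x. P n #> x" by (rule hom)
  show ?thesis using assms h.hom_mult by metis
qed

lemma cs_inv_cong:
  assumes "P n #> x = P n #> x'" "x \<in> carrier G" "x' \<in> carrier G"
  shows "P n #> inv x = P n #> inv x'"
proof -
  interpret h: group_hom G "G Mod P n" "\<lambda>x. P n #> x" by (rule hom)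
  show ?thesis using assms h.hom_inv by metis
qed

lemma cs_mono:
  "m \<le> n \<Longrightarrow> x \<in> carrier G \<Longrightarrow> y \<in> carrier G \<Longrightarrow> P n #> x = P n #> y \<Longrightarrow> P m #> x = P m #> y"
  using P_anti by (auto simp: cs_iff)

lemma cs_absorb: "u \<in> P n \<Longrightarrow> x \<in> carrier G \<Longrightarrow> P n #> (u \<otimes> x) = P n #> x"
  by (simp add: cs_iff m_assoc)

lemma cs_comm_iff:
  "x \<in> carrier G \<Longrightarrow> y \<in> carrier G \<Longrightarrow>
    commutator G x y \<in> P n \<longleftrightarrow> P n #> (x \<otimes> y) = P n #> (y \<otimes> x)"
  using hom_commutator_eq_one_iff[OF hom, of x y n] by (simp add: cs_one_iff)

lemma cs_central: "x \<in> P n \<Longrightarrow> y \<in> carrier G \<Longrightarrow> P (Suc n) #> (x \<otimes> y) = P (Suc n) #> (y \<otimes> x)"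
  using P_comm[of x n y] by (simp add: cs_comm_iff)

lemma P_comm': "x \<in> P n \<Longrightarrow> y \<in> carrier G \<Longrightarrow> commutator G y x \<in> P (Suc n)"
  using cs_central[of x n y] by (simp add: cs_comm_iff)

text \<open>Modulo \<open>P (Suc (Suc n))\<close> the elements of \<open>P 1\<close> are products of
  p-th powers and their inverses. For such a power, x z^p = c^p z^p x with c = [x, z] in
  \<open>P (Suc n)\<close>, which is central there and has its p-th power in the modulus.\<close>

lemma commutator_P_P1:
  assumes x: "x \<in> P n" and y: "y \<in> P 1" shows "commutator G x y \<in> P (Suc (Suc n))"
proof -
  let ?N = "P (Suc (Suc n))"
  have sc: "{x [^] p | x. x \<in> carrier G} \<subseteq> carrier G" by auto
  have cen: "?N #> (x \<otimes> s) = ?N #> (s \<otimes> x)" if "s \<in> generate G {x [^] p | x. x \<in> carrier G}" for s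
    using that
  proof induction
    case one then show ?case using x by simp
  next
    have *: "?N #> (x \<otimes> z [^] p) = ?N #> (z [^] p \<otimes> x)" if z: "z \<in> carrier G" for z
    proof -
      let ?c = "commutator G x z"
      have c: "?c \<in> P (Suc n)" using P_comm x z by simp
      have "?N #> (x \<otimes> z [^] p) = ?N #> (?c [^] p \<otimes> (z [^] p \<otimes> x))"
      proof (rule hom_twisted_pow[OF hom])
        show "?N #> (x \<otimes> z) = ?N #> (?c \<otimes> (z \<otimes> x))" using x z by (simp add: commutator_swap)
        show "?N #> (?c \<otimes> z) = ?N #> (z \<otimes> ?c)" using cs_central[OF c z] .
      qed (use x z in auto)
      also have "\<dots> = ?N #> (z [^] p \<otimes> x)" using P_pow[OF c] x z by (intro cs_absorb) auto
      finally show ?thesis .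
    qed
    { case (incl s) then show ?case using * by auto }
    { case (inv s)
      then obtain z where z: "z \<in> carrier G" "s = z [^] p" by auto
      then have "inv s = (inv z) [^] p" by (simp add: nat_pow_inv)
      then show ?case using *[of "inv z"] z by simp }
  next
    case (eng s t)
    have st: "s \<in> carrier G" "t \<in> carrier G" using eng generate_in_carrier[OF sc] by auto
    have "?N #> (x \<otimes> (s \<otimes> t)) = ?N #> ((x \<otimes> s) \<otimes> t)" using x st by (simp add: m_assoc)
    also have "\<dots> = ?N #> ((s \<otimes> x) \<otimes> t)" by (rule cs_mult_cong; use eng x st in auto)
    also have "\<dots> = ?N #> (s \<otimes> (x \<otimes> t))" using x st by (simp add: m_assoc)
    also have "\<dots> = ?N #> (s \<otimes> (t \<otimes> x))" by (rule cs_mult_cong; use eng x st in auto)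
    finally show ?case using x st by (simp add: m_assoc)
  qed
  obtain s u where su: "s \<in> generate G {x [^] p | x. x \<in> carrier G}" "u \<in> ?N" "y = u \<otimes> s"
    using P_powerful[OF y, of "Suc (Suc n)"] by blast
  have sC: "s \<in> carrier G" using su generate_in_carrier[OF sc] by auto
  have e: "?N #> y = ?N #> s" using su sC by (simp add: cs_absorb)
  have "?N #> (x \<otimes> y) = ?N #> (x \<otimes> s)" by (rule cs_mult_cong; use e x y sC in auto)
  also have "\<dots> = ?N #> (s \<otimes> x)" by (rule cen[OF su(1)])
  also have "\<dots> = ?N #> (y \<otimes> x)" by (rule cs_mult_cong; use e x y sC in auto)
  finally show ?thesis using x y by (simp add: cs_comm_iff)
qed

text \<open>The p-power map is a homomorphism on \<open>P n\<close> up to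
  \<open>P (Suc (Suc n))\<close>, because the commutator of \<open>y\<close> and \<open>x\<close> is
  central of exponent \<open>p\<close> there. For \<open>p = 2\<close> it must be trivial:
  \<open>P_two\<close> gives this at n = 0 and \<open>commutator_P_P1\<close> beyond.\<close>

lemma pow_mult_mod:
  assumes x: "x \<in> P n" and y: "y \<in> P n"
  shows "P (Suc (Suc n)) #> ((x \<otimes> y) [^] p) = P (Suc (Suc n)) #> (x [^] p \<otimes> y [^] p)"
proof (rule hom_prime_pow_mult_class2[OF hom, where e = "commutator G y x"])
  let ?e = "commutator G y x"
  have e: "?e \<in> P (Suc n)" using P_comm y x by simp
  show "P (Suc (Suc n)) #> (y \<otimes> x) = P (Suc (Suc n)) #> (?e \<otimes> (x \<otimes> y))"
    using x y by (simp add: commutator_swap)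
  show "P (Suc (Suc n)) #> (?e \<otimes> x) = P (Suc (Suc n)) #> (x \<otimes> ?e)"
    "P (Suc (Suc n)) #> (?e \<otimes> y) = P (Suc (Suc n)) #> (y \<otimes> ?e)"
    by (intro cs_central[OF e]; use x y in simp)+
  show "P (Suc (Suc n)) #> (?e [^] p) = P (Suc (Suc n)) #> \<one>"
    using P_pow[OF e] by (simp add: cs_one_iff)
  show "P (Suc (Suc n)) #> ?e = P (Suc (Suc n)) #> \<one>" if "p = 2"
  proof (cases n)
    case 0
    then show ?thesis using P_two[OF that, of y x] x y by (simp add: cs_one_iff numeral_2_eq_2)
  next
    case (Suc m)
    then have "x \<in> P 1" using P_anti[of 1 n] x by auto
    then show ?thesis using commutator_P_P1[OF y] x y by (simp add: cs_one_iff)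
  qed
qed (use x y p_prime in auto)

text \<open>One layer more precise than \<open>pow_mult_mod\<close>: since \<open>c\<close> is
  itself a commutator, [z, c] lies one layer deeper. It evaluates y z^p y^(-1) = (c z)^p in
  \<open>P_Suc_powers\<close>.\<close>

lemma pow_mult_mod_comm:
  assumes c: "c = commutator G y z" and y: "y \<in> carrier G" and z: "z \<in> P n"
  shows "P (Suc (Suc (Suc n))) #> ((c \<otimes> z) [^] p) = P (Suc (Suc (Suc n))) #> (c [^] p \<otimes> z [^] p)"
proof (rule hom_prime_pow_mult_class2[OF hom, where e = "commutator G z c"])
  let ?e = "commutator G z c" and ?N = "P (Suc (Suc (Suc n)))"
  have cP: "c \<in> P (Suc n)" using P_comm' y z c by simp
  have e: "?e \<in> P (Suc (Suc n))" using P_comm'[OF cP] z by simp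
  show "?N #> (z \<otimes> c) = ?N #> (?e \<otimes> (c \<otimes> z))"
    using cP z by (simp add: commutator_swap)
  show "?N #> (?e \<otimes> c) = ?N #> (c \<otimes> ?e)" "?N #> (?e \<otimes> z) = ?N #> (z \<otimes> ?e)"
    by (intro cs_central[OF e]; use cP z in simp)+
  show "?N #> (?e [^] p) = ?N #> \<one>" using P_pow[OF e] by (simp add: cs_one_iff)
  show "?N #> ?e = ?N #> \<one>" if p2: "p = 2"
  proof (cases n)
    case 0
    have "c \<in> P 2" using P_two[OF p2, of y z] y z c by simp
    then show ?thesis using P_comm'[of c 2 z] z 0 by (simp add: cs_one_iff numeral_2_eq_2)
  next
    case (Suc m)
    then have "z \<in> P 1" using P_anti[of 1 n] z by auto
    then have "commutator G c z \<in> ?N" using commutator_P_P1[OF cP] by simp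
    then have "commutator G z c \<in> ?N" using cP z by (simp add: cs_comm_iff)
    then show ?thesis using cP z by (simp add: cs_one_iff)
  qed
  show "c \<in> carrier G" using cP by simp
qed (use y z c p_prime in auto)

text \<open>Powerfulness removes the commutators from the generators of \<open>P 1\<close>, and the
  induction carries this down the series: [y, z^p] is congruent to [y, z]^p, so commutators with
  products of p-th powers are again products of p-th powers.\<close>

lemma P_Suc_powers:
  "x \<in> P (Suc n) \<Longrightarrow> \<exists>s\<in>generate G {w [^] p | w. w \<in> P n}. P (Suc (Suc n)) #> x = P (Suc (Suc n)) #> s"
proof (induction n arbitrary: x)
  case 0
  then obtain s u where su: "s \<in> generate G {w [^] p | w. w \<in> carrier G}" "u \<in> P (Suc (Suc 0))" "x = u \<otimes> s"
    using P_powerful[of x "Suc (Suc 0)"] by (auto simp del: One_nat_def simp: One_nat_def[symmetric])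
  have "s \<in> carrier G" using generate_in_carrier[OF _ su(1)] by auto
  then have "P (Suc (Suc 0)) #> x = P (Suc (Suc 0)) #> s" using su cs_absorb by simp
  then show ?case using su(1) unfolding P_0 by blast
next
  case (Suc n)
  let ?N = "P (Suc (Suc (Suc n)))" and ?L = "generate G {w [^] p | w. w \<in> P (Suc n)}"
  have Lc: "{w [^] p | w. w \<in> P (Suc n)} \<subseteq> carrier G" by auto
  have Ls: "subgroup ?L G" using Lc by (rule generate_is_subgroup)
  have Lcc: "s \<in> carrier G" if "s \<in> ?L" for s using generate_in_carrier[OF Lc that] .
  \<comment> \<open>A subgroup that contains the modulus, so it is enough to place the generators of
    the next term of the series in it.\<close>
  define W where "W = {x \<in> carrier G. \<exists>s\<in>?L. ?N #> x = ?N #> s}"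
  have WI: "y \<in> W" if "y \<in> carrier G" "x \<in> W" "?N #> y = ?N #> x" for x y
    using that by (auto simp: W_def)
  have Wm: "x \<otimes> y \<in> W" if "x \<in> W" "y \<in> W" for x y
  proof -
    obtain s t where st: "s \<in> ?L" "t \<in> ?L" "?N #> x = ?N #> s" "?N #> y = ?N #> t"
      using \<open>x \<in> W\<close> \<open>y \<in> W\<close> W_def by auto
    have "?N #> (x \<otimes> y) = ?N #> (s \<otimes> t)"
      by (rule cs_mult_cong; use st \<open>x \<in> W\<close> \<open>y \<in> W\<close> W_def Lcc in auto)
    moreover have "s \<otimes> t \<in> ?L" using st by (intro generate.eng)
    ultimately show ?thesis using \<open>x \<in> W\<close> \<open>y \<in> W\<close> unfolding W_def by blast
  qed
  have Wi: "inv x \<in> W" if xW: "x \<in> W" for x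
  proof -
    obtain s where st: "s \<in> ?L" "?N #> x = ?N #> s" "x \<in> carrier G" using xW unfolding W_def by blast
    have "?N #> inv x = ?N #> inv s" by (rule cs_inv_cong; use st Lcc in auto)
    moreover have "inv s \<in> ?L" using st Ls by (simp add: subgroup.m_inv_closed)
    ultimately show ?thesis using st unfolding W_def by blast
  qed
  have W1: "\<one> \<in> W" unfolding W_def using generate.one by blast
  have Wsub: "subgroup W G" using Wm Wi W1 by (intro subgroupI) (auto simp: W_def)
  have WN: "u \<in> W" if "u \<in> ?N" for u
    using that W1 cs_one_iff[of u] by (intro WI[of u \<one>]) auto
  have comm_z: "commutator G (z [^] p) y \<in> W" if z: "z \<in> P n" and y: "y \<in> carrier G" for z y
  proof -
    define c where "c = commutator G y z"
    have cP: "c \<in> P (Suc n)" using P_comm' y z c_def by simp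
    have "y \<otimes> z \<otimes> inv y = c \<otimes> z" using y z by (simp add: c_def commutator_def m_assoc)
    have "y \<otimes> z [^] p \<otimes> inv y = (c \<otimes> z) [^] p"
    proof -
      have "(y \<otimes> z \<otimes> inv y) [^] k = y \<otimes> z [^] k \<otimes> inv y" for k :: nat
        using y z by (induction k) (simp_all add: m_assoc)
      from this[of p] show ?thesis using \<open>y \<otimes> z \<otimes> inv y = c \<otimes> z\<close> by simp
    qed
    then have 1: "?N #> (y \<otimes> z [^] p \<otimes> inv y) = ?N #> (c [^] p \<otimes> z [^] p)"
      using pow_mult_mod_comm[OF c_def y z] by simp
    have "?N #> commutator G y (z [^] p) = ?N #> ((y \<otimes> z [^] p \<otimes> inv y) \<otimes> inv (z [^] p))"
      using y z by (simp add: commutator_def)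
    also have "\<dots> = ?N #> ((c [^] p \<otimes> z [^] p) \<otimes> inv (z [^] p))"
      by (rule cs_mult_cong; use 1 y z cP in auto)
    also have "\<dots> = ?N #> (c [^] p)" using z cP by (simp add: m_assoc)
    finally have f1: "?N #> commutator G y (z [^] p) = ?N #> (c [^] p)" .
    have f2: "c [^] p \<in> W"
    proof -
      have "c [^] p \<in> ?L" using cP by (intro generate.incl) blast
      then show ?thesis using cP unfolding W_def by auto
    qed
    have "commutator G y (z [^] p) \<in> W" using y z by (intro WI[OF _ f2 f1]) simp
    then have "inv (commutator G y (z [^] p)) \<in> W" by (rule Wi)
    then show ?thesis using y z by (simp add: commutator_inv)
  qed
  have powP: "z [^] p \<in> P (Suc n)" if "z \<in> P n" for z using that by (rule P_pow)
  have bil: "?N #> commutator G (w \<otimes> w') y = ?N #> (commutator G w' y \<otimes> commutator G w y)"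
    if "w \<in> P (Suc n)" "w' \<in> P (Suc n)" "y \<in> carrier G" for w w' y
    using that P_comm[of w' "Suc n" y]
    by (intro hom_commutator_mult_left[OF hom]) (auto intro!: cs_central[symmetric])
  have comm_s: "s \<in> P (Suc n) \<and> (\<forall>y\<in>carrier G. commutator G s y \<in> W)"
    if "s \<in> generate G {w [^] p | w. w \<in> P n}" for s
    using that
  proof induction
    case one then show ?case using W1 subgroup.one_closed[OF P_sub] by (simp add: commutator_def)
  next
    case (incl s) then show ?case using comm_z powP by auto
  next
    case (inv s)
    then obtain z where z: "z \<in> P n" "s = z [^] p" by auto
    then have "inv s = (inv z) [^] p" by (simp add: nat_pow_inv)
    moreover have "inv z \<in> P n" using z P_sub subgroup.m_inv_closed by metis
    ultimately show ?case using comm_z powP by metis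
  next
    case (eng s t)
    have "commutator G (s \<otimes> t) y \<in> W" if "y \<in> carrier G" for y
      using that eng by (intro WI[OF _ Wm bil]) auto
    then show ?case using eng P_sub by (simp add: subgroup.m_closed)
  qed
  have comm_w: "commutator G w y \<in> W" if w: "w \<in> P (Suc n)" and y: "y \<in> carrier G" for w y
  proof -
    obtain s where s: "s \<in> generate G {w [^] p | w. w \<in> P n}" "P (Suc (Suc n)) #> w = P (Suc (Suc n)) #> s"
      using Suc.IH[OF w] by blast
    have sP: "s \<in> P (Suc n)" "commutator G s y \<in> W" using comm_s[OF s(1)] y by auto
    \<comment> \<open>The error \<open>u\<close> lies one layer deeper than \<open>w\<close>, so its
      commutators already lie in the modulus.\<close>
    define u where "u = w \<otimes> inv s"
    have u: "u \<in> P (Suc (Suc n))" "u \<in> P (Suc n)" "w = u \<otimes> s"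
      using s sP w P_dec[of "Suc n"] unfolding u_def by (auto simp: cs_iff m_assoc)
    have "commutator G u y \<in> W" using P_comm[OF u(1) y] by (rule WN)
    then show ?thesis unfolding u(3) using sP u y by (intro WI[OF _ Wm bil]) auto
  qed
  have "generate G ({x [^] p | x. x \<in> P (Suc n)} \<union> {commutator G x y | x y. x \<in> P (Suc n) \<and> y \<in> carrier G}) \<subseteq> W"
  proof (rule generate_subgroup_incl[OF _ Wsub])
    have "w [^] p \<in> W" if "w \<in> P (Suc n)" for w
    proof -
      have "w [^] p \<in> ?L" using that by (intro generate.incl) blast
      then show ?thesis using that unfolding W_def by auto
    qed
    then show "{x [^] p | x. x \<in> P (Suc n)} \<union> {commutator G x y | x y. x \<in> P (Suc n) \<and> y \<in> carrier G} \<subseteq> W"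
      using comm_w by auto
  qed
  then obtain s u where su: "s \<in> W" "u \<in> ?N" "x = u \<otimes> s" using P_gen[OF Suc.prems] by blast
  then have "x \<in> W" using Wm WN by blast
  then show ?case by (auto simp: W_def)
qed

text \<open>By \<open>pow_mult_mod\<close> a product of p-th powers is congruent to the p-th power
  of the product.\<close>

lemma P_Suc_root:
  assumes "y \<in> P (Suc n)"
  shows "\<exists>x\<in>P n. P (Suc (Suc n)) #> y = P (Suc (Suc n)) #> (x [^] p)"
proof -
  let ?N = "P (Suc (Suc n))"
  have *: "s \<in> carrier G \<and> (\<exists>x\<in>P n. ?N #> s = ?N #> (x [^] p))" if "s \<in> generate G {w [^] p | w. w \<in> P n}" for s
    using that
  proof induction
    case one then show ?case using subgroup.one_closed[OF P_sub] by (auto intro!: bexI[of _ \<one>])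
  next
    case (incl s) then show ?case by auto
  next
    case (inv s)
    then obtain z where z: "z \<in> P n" "s = z [^] p" by auto
    then have "inv s = (inv z) [^] p" by (simp add: nat_pow_inv)
    moreover have "inv z \<in> P n" using z P_sub subgroup.m_inv_closed by metis
    ultimately show ?case by auto
  next
    case (eng s t)
    then obtain x y where xy: "x \<in> P n" "y \<in> P n" "?N #> s = ?N #> (x [^] p)" "?N #> t = ?N #> (y [^] p)"
      by auto
    have "?N #> (s \<otimes> t) = ?N #> (x [^] p \<otimes> y [^] p)" by (rule cs_mult_cong; use xy eng in auto)
    also have "\<dots> = ?N #> ((x \<otimes> y) [^] p)" using pow_mult_mod xy by simp
    finally have "?N #> (s \<otimes> t) = ?N #> ((x \<otimes> y) [^] p)" .
    moreover have "x \<otimes> y \<in> P n" using xy P_sub by (simp add: subgroup.m_closed)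
    ultimately show ?case using eng by auto
  qed
  obtain s where s: "s \<in> generate G {w [^] p | w. w \<in> P n}" "?N #> y = ?N #> s"
    using P_Suc_powers[OF assms] by blast
  show ?thesis using *[OF s(1)] s(2) by simp
qed

end

subsection \<open>Coordinates of the second kind\<close>

definition ibox :: "nat \<Rightarrow> nat \<Rightarrow> nat list set" where
  "ibox d m = {a. length a = d \<and> set a \<subseteq> {..<m}}"

lemma finite_ibox [simp]: "finite (ibox d m)"
  using finite_lists_length_eq[of "{..<m}" d] by (simp add: ibox_def conj_commute)

lemma card_ibox: "card (ibox d m) = m ^ d"
  using card_lists_length_eq[of "{..<m}" d] by (simp add: ibox_def conj_commute)

lemma map_mod_in_ibox: "m > 0 \<Longrightarrow> length a = d \<Longrightarrow> map (\<lambda>x. x mod m) a \<in> ibox d m"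
  by (auto simp: ibox_def)

lemma map_mod_ibox: "a \<in> ibox d m \<Longrightarrow> map (\<lambda>x. x mod m) a = a"
  by (auto simp: ibox_def intro!: map_idI)

lemma (in group) mprod_replicate_zero: "set gs \<subseteq> carrier G \<Longrightarrow> mprod G gs (replicate (length gs) 0) = \<one>"
  by (induction gs) auto

lemma (in group) mprod_single:
  assumes "set gs \<subseteq> carrier G" "g \<in> set gs"
  shows "\<exists>a. length a = length gs \<and> mprod G gs a = g"
  using assms
proof (induction gs)
  case (Cons h gs)
  show ?case
  proof (cases "g = h")
    case True
    then show ?thesis using Cons mprod_replicate_zero[of gs]
      by (intro exI[of _ "1 # replicate (length gs) 0"]) simp
  next
    case False
    then obtain a where "length a = length gs" "mprod G gs a = g" using Cons by auto
    then show ?thesis using Cons by (intro exI[of _ "0 # a"]) auto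
  qed
qed simp

lemma (in comm_group) mprod_exponent_span:
  assumes gs: "set gs \<subseteq> carrier G" and p: "p > 0" and ex: "\<And>x. x \<in> carrier G \<Longrightarrow> x [^] (p::nat) = \<one>"
    and s: "s \<in> generate G (set gs)"
  shows "\<exists>a\<in>ibox (length gs) p. s = mprod G gs a"
proof -
  define S where "S = {mprod G gs a | a. length a = length gs}"
  have Sc: "S \<subseteq> carrier G" using gs by (auto simp: S_def)
  have m: "x \<otimes> y \<in> S" if x: "x \<in> S" and y: "y \<in> S" for x y
  proof -
    obtain a b where ab: "length a = length gs" "length b = length gs" "x = mprod G gs a" "y = mprod G gs b"
      using x y S_def by auto
    have "x \<otimes> y = mprod G gs (map2 (+) a b)"
      unfolding ab using ab gs by (intro mprod_add[symmetric] m_comm nat_pow_closed) (auto dest: nth_mem)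
    then show ?thesis using ab unfolding S_def by (auto intro!: exI[of _ "map2 (+) a b"])
  qed
  have one: "\<one> \<in> S" unfolding S_def using mprod_replicate_zero[OF gs]
    by (auto intro!: exI[of _ "replicate (length gs) 0"])
  have i: "inv x \<in> S" if x: "x \<in> S" for x
  proof -
    have xc: "x \<in> carrier G" using x Sc by auto
    have pw: "x [^] k \<in> S" for k :: nat by (induction k) (use x one m in auto)
    \<comment> \<open>Finite exponent makes inverses into powers, so nonnegative exponents describe
      the whole subgroup.\<close>
    have "x [^] (p - 1) \<otimes> x = \<one>" using ex[OF xc] p nat_pow_Suc[of x "p - 1"] by simp
    then have "inv x = x [^] (p - 1)" using xc by (simp add: inv_equality)
    then show ?thesis using pw by simp
  qed
  have "subgroup S G" using m i one Sc by (intro subgroupI) auto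
  moreover have "set gs \<subseteq> S" unfolding S_def using mprod_single[OF gs] by force
  ultimately have "generate G (set gs) \<subseteq> S" by (intro generate_subgroup_incl)
  then obtain a where a: "length a = length gs" "s = mprod G gs a" using s S_def by auto
  have "mprod G gs a = mprod G gs (map (\<lambda>x. x mod p) a)"
    using a(1) gs
  proof (induction gs arbitrary: a)
    case (Cons g gs)
    obtain c a' where a: "a = c # a'" using Cons.prems by (metis length_Suc_conv)
    have g: "g \<in> carrier G" using Cons.prems by simp
    have "g [^] c = g [^] (p * (c div p) + c mod p)" by simp
    also have "\<dots> = (g [^] p) [^] (c div p) \<otimes> g [^] (c mod p)"
      using g by (simp only: nat_pow_mult nat_pow_pow)
    finally have gc: "g [^] c = g [^] (c mod p)" using ex[OF g] g by simp
    have "mprod G gs a' = mprod G gs (map (\<lambda>x. x mod p) a')" using Cons.prems a by (intro Cons.IH) auto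
    then show ?case unfolding a using gc by (simp only: mprod.simps list.map)
  qed simp
  then show ?thesis using a map_mod_in_ibox[OF p a(1)] by auto
qed

lemma (in comm_group) mprod_update_zero:
  assumes "set gs \<subseteq> carrier G" "length as = length gs" "i < length gs"
  shows "mprod G gs as = gs ! i [^] (as ! i) \<otimes> mprod G gs (as[i := 0])"
  using assms
proof (induction gs arbitrary: as i)
  case (Cons g gs)
  obtain a as' where as: "as = a # as'" using Cons.prems by (metis length_Suc_conv)
  show ?case
  proof (cases i)
    case 0
    then show ?thesis using as Cons.prems(1) by simp
  next
    case (Suc j)
    have j: "gs ! j \<in> carrier G" using Cons.prems Suc by auto
    have "mprod G gs as' = gs ! j [^] (as' ! j) \<otimes> mprod G gs (as'[j := 0])"
      using Cons.IH[of as' j] Cons.prems as Suc by simp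
    then show ?thesis using Cons.prems(1) as Suc j by (simp add: m_lcomm)
  qed
qed simp

lemma (in normal) quotient_comm_group:
  assumes "\<And>x y. x \<in> carrier G \<Longrightarrow> y \<in> carrier G \<Longrightarrow> (x \<otimes> y) \<otimes> inv (y \<otimes> x) \<in> H"
  shows "comm_group (G Mod H)"
proof (rule group.group_comm_groupI[OF factorgroup_is_group])
  fix A B assume "A \<in> carrier (G Mod H)" "B \<in> carrier (G Mod H)"
  then obtain x y where xy: "x \<in> carrier G" "y \<in> carrier G" "A = H #> x" "B = H #> y"
    by (auto simp: carrier_FactGroup)
  then show "A \<otimes>\<^bsub>G Mod H\<^esub> B = B \<otimes>\<^bsub>G Mod H\<^esub> A"
    using assms by (simp add: rcos_sum coset_eq_iff)
qed

lemma (in mgroup) elementary_abelian_quotient: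
  assumes N: "N \<lhd> G"
    and comm: "\<And>x y. x \<in> carrier G \<Longrightarrow> y \<in> carrier G \<Longrightarrow> commutator G x y \<in> N"
    and pow: "\<And>x. x \<in> carrier G \<Longrightarrow> x [^] (p::nat) \<in> N"
  shows "comm_group (G Mod N)" "\<And>A. A \<in> carrier (G Mod N) \<Longrightarrow> A [^]\<^bsub>G Mod N\<^esub> p = \<one>\<^bsub>G Mod N\<^esub>"
proof -
  interpret N: normal N G by (rule N)
  show "comm_group (G Mod N)"
    using comm by (intro N.quotient_comm_group) (simp add: commutator_def inv_mult_group m_assoc)
  fix A assume "A \<in> carrier (G Mod N)"
  then obtain x where x: "x \<in> carrier G" "A = N #> x" by (auto simp: carrier_FactGroup)
  then show "A [^]\<^bsub>G Mod N\<^esub> p = \<one>\<^bsub>G Mod N\<^esub>"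
    using pow[OF x(1)] group_hom.hom_nat_pow[OF N.quotient_hom x(1), of p] N.coset_eq_self_iff[of "x [^] p"] by simp
qed

lemma (in mgroup) elementary_abelian_span:
  assumes N: "N \<lhd> G" and gs: "set gs \<subseteq> carrier G" and p: "p > 0"
    and comm: "\<And>x y. x \<in> carrier G \<Longrightarrow> y \<in> carrier G \<Longrightarrow> commutator G x y \<in> N"
    and pow: "\<And>x. x \<in> carrier G \<Longrightarrow> x [^] (p::nat) \<in> N"
    and s: "s \<in> generate G (set gs)"
  shows "\<exists>a\<in>ibox (length gs) p. N #> s = N #> mprod G gs a"
proof -
  define h where "h = (\<lambda>x. N #> x)"
  define Q where "Q = G Mod N"
  interpret h: group_hom G Q h unfolding h_def Q_def by (rule normal.quotient_hom[OF N])
  interpret Q: comm_group Q unfolding Q_def by (rule elementary_abelian_quotient(1)[OF N comm pow])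
  have "h s \<in> generate Q (set (map h gs))" using s h.generate_img[OF gs] by auto
  then have "\<exists>a\<in>ibox (length (map h gs)) p. h s = mprod Q (map h gs) a"
    using gs p elementary_abelian_quotient(2)[OF N comm pow] unfolding Q_def[symmetric]
    by (intro Q.mprod_exponent_span) auto
  then show ?thesis using h.hom_mprod[OF gs] unfolding h_def by auto
qed

context pseries begin

lemma Q_mem: "Y \<in> carrier (G Mod P n) \<Longrightarrow> \<exists>x\<in>carrier G. Y = P n #> x"
  by (auto simp: carrier_FactGroup)

lemma cs_mprod_add:
  assumes "set gs \<subseteq> carrier G" "length as = length gs" "length bs = length gs"
    and "\<And>i x. i < length gs \<Longrightarrow> x \<in> carrier G \<Longrightarrow>
      P n #> (x \<otimes> gs ! i [^] (bs ! i)) = P n #> (gs ! i [^] (bs ! i) \<otimes> x)"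
  shows "P n #> mprod G gs (map2 (+) as bs) = P n #> (mprod G gs as \<otimes> mprod G gs bs)"
proof -
  define h where "h = (\<lambda>x. P n #> x)"
  define Q where "Q = G Mod P n"
  interpret h: group_hom G Q h unfolding h_def Q_def by (rule hom)
  have a4: "h (x \<otimes> gs ! i [^] (bs ! i)) = h (gs ! i [^] (bs ! i) \<otimes> x)"
    if "i < length gs" "x \<in> carrier G" for i x unfolding h_def using assms(4) that by simp
  have sur: "\<exists>x\<in>carrier G. Y = h x" if "Y \<in> carrier Q" for Y
    using that Q_mem unfolding h_def Q_def by simp
  have gi: "gs ! i \<in> carrier G" if "i < length gs" for i using that assms(1) by auto
  have "mprod Q (map h gs) (map2 (+) as bs) = mprod Q (map h gs) as \<otimes>\<^bsub>Q\<^esub> mprod Q (map h gs) bs"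
  proof (rule h.H.mprod_add)
    fix i Y assume i: "i < length (map h gs)" and Y: "Y \<in> carrier Q"
    then obtain x where x: "x \<in> carrier G" "Y = h x" using sur by blast
    show "Y \<otimes>\<^bsub>Q\<^esub> (map h gs ! i) [^]\<^bsub>Q\<^esub> (bs ! i) = (map h gs ! i) [^]\<^bsub>Q\<^esub> (bs ! i) \<otimes>\<^bsub>Q\<^esub> Y"
      using a4[of i x] i x gi[of i] by (simp add: h.hom_nat_pow)
  qed (use assms in auto)
  then have "h (mprod G gs (map2 (+) as bs)) = h (mprod G gs as \<otimes> mprod G gs bs)"
    using assms(1) by (simp add: h.hom_mprod)
  then show ?thesis by (simp add: h_def)
qed

lemma cs_mprod_cong:
  assumes "set gs \<subseteq> carrier G" "length as = length gs" "length bs = length gs"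
    and "\<And>i. i < length gs \<Longrightarrow> P n #> (gs ! i [^] (as ! i)) = P n #> (gs ! i [^] (bs ! i))"
  shows "P n #> mprod G gs as = P n #> mprod G gs bs"
  using assms
proof (induction gs arbitrary: as bs)
  case (Cons g gs)
  obtain a as' b bs' where ab: "as = a # as'" "bs = b # bs'"
    using Cons.prems by (metis length_Suc_conv)
  have IH: "P n #> mprod G gs as' = P n #> mprod G gs bs'"
    using Cons.prems(1-3) Cons.prems(4)[of "Suc _"] ab by (intro Cons.IH) auto
  have "P n #> (g [^] a) = P n #> (g [^] b)" using Cons.prems(4)[of 0] ab by simp
  then have "P n #> (g [^] a \<otimes> mprod G gs as') = P n #> (g [^] b \<otimes> mprod G gs bs')"
    using IH by (rule cs_mult_cong) (use Cons.prems(1) in auto)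
  then show ?case using ab by simp
qed simp

end

text \<open>Stated for any list that generates \<open>G\<close> modulo \<open>P 1\<close>, because
  \<open>frattini\<close> applies it to lists other than the given minimal one.\<close>

locale pspan = pseries +
  fixes gs :: "'a list"
  assumes gs_carrier: "set gs \<subseteq> carrier G"
    and gs_gen: "x \<in> carrier G \<Longrightarrow> \<exists>s\<in>generate G (set gs). P 1 #> x = P 1 #> s"
begin

abbreviation "d \<equiv> length gs"

lemma p_gt1: "p > 1" using p_prime by (rule prime_gt_1_nat)

lemma gs_mem [simp]: "i < d \<Longrightarrow> gs ! i \<in> carrier G" "g \<in> set gs \<Longrightarrow> g \<in> carrier G"
  using gs_carrier by auto

lemma pow_P: "g \<in> carrier G \<Longrightarrow> g [^] (p ^ n) \<in> P n"
proof (induction n)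
  case (Suc n)
  then have "(g [^] (p ^ n)) [^] p \<in> P (Suc n)" by (intro P_pow) auto
  then show ?case using Suc by (simp add: nat_pow_pow mult.commute)
qed (simp add: P_0)

lemma pow_P_mult: "g \<in> carrier G \<Longrightarrow> g [^] (p ^ n * a) \<in> P n"
proof -
  assume g: "g \<in> carrier G"
  have "g [^] (p ^ n * a) = (g [^] (p ^ n)) [^] a" using g by (simp add: nat_pow_pow)
  moreover have "(x [^] a) \<in> P n" if "x \<in> P n" for x
    using that P_sub[of n] by (induction a) (auto simp: subgroup.one_closed subgroup.m_closed)
  ultimately show ?thesis using pow_P[OF g] by simp
qed

lemma cs_pow_mod:
  assumes "g \<in> carrier G" "a mod p ^ n = b mod p ^ n"
  shows "P n #> (g [^] a) = P n #> (g [^] b)"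
proof -
  have "P n #> (g [^] a) = P n #> (g [^] (a mod p ^ n))" for a
  proof -
    have "g [^] a = g [^] (p ^ n * (a div p ^ n) + a mod p ^ n)" by simp
    also have "\<dots> = g [^] (p ^ n * (a div p ^ n)) \<otimes> g [^] (a mod p ^ n)"
      using assms by (simp only: nat_pow_mult)
    finally show ?thesis using cs_absorb[OF pow_P_mult[OF assms(1), of n "a div p ^ n"]] assms by simp
  qed
  then show ?thesis using assms(2) by metis
qed

lemma cs_mprod_mod:
  assumes "length a = d" "length b = d" "\<And>i. i < d \<Longrightarrow> a ! i mod p ^ n = b ! i mod p ^ n"
  shows "P n #> mprod G gs a = P n #> mprod G gs b"
  using assms gs_carrier by (intro cs_mprod_cong cs_pow_mod) auto

lemma mprod_scaled_P:
  assumes "length a = length gs'" "set gs' \<subseteq> carrier G"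
  shows "mprod G gs' (map ((*) (p ^ n)) a) \<in> P n"
  using assms by (intro mprod_mem P_sub) (auto intro!: pow_P_mult)

text \<open>Head and tail of the word lie in \<open>P n\<close>, so \<open>pow_mult_mod\<close>
  splits its p-th power into the p-th powers of the factors.\<close>

lemma cs_mprod_pow:
  assumes "length a = length gs'" "set gs' \<subseteq> carrier G"
  shows "P (Suc (Suc n)) #> (mprod G gs' (map ((*) (p ^ n)) a) [^] p) =
    P (Suc (Suc n)) #> mprod G gs' (map ((*) (p ^ Suc n)) a)"
  using assms
proof (induction gs' arbitrary: a)
  case (Cons g gs')
  obtain c a' where a: "a = c # a'" using Cons.prems by (metis length_Suc_conv)
  let ?m = "mprod G gs' (map ((*) (p ^ n)) a')" and ?N = "P (Suc (Suc n))"
  have g: "g \<in> carrier G" using Cons.prems by simp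
  have m: "?m \<in> P n" using Cons.prems a by (intro mprod_scaled_P) auto
  have gP: "g [^] (p ^ n * c) \<in> P n" using Cons.prems by (intro pow_P_mult) simp
  have "?N #> ((g [^] (p ^ n * c) \<otimes> ?m) [^] p) = ?N #> ((g [^] (p ^ n * c)) [^] p \<otimes> ?m [^] p)"
    by (rule pow_mult_mod[OF gP m])
  also have "(g [^] (p ^ n * c)) [^] p = g [^] (p ^ Suc n * c)"
    using g by (simp add: nat_pow_pow mult_ac)
  also have "?N #> (g [^] (p ^ Suc n * c) \<otimes> ?m [^] p) =
      ?N #> (g [^] (p ^ Suc n * c) \<otimes> mprod G gs' (map ((*) (p ^ Suc n)) a'))"
    by (rule cs_mult_cong; use Cons a m g in auto)
  finally show ?case using a by simp
qed simp

lemma gs_span_P1: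
  assumes "x \<in> carrier G" shows "\<exists>a. length a = d \<and> P 1 #> x = P 1 #> mprod G gs a"
proof -
  obtain s where s: "s \<in> generate G (set gs)" "P 1 #> x = P 1 #> s" using gs_gen[OF assms] by blast
  have "\<exists>a\<in>ibox d p. P 1 #> s = P 1 #> mprod G gs a"
  proof (rule elementary_abelian_span[OF P_normal gs_carrier _ _ _ s(1)])
    show "p > 0" using p_gt1 by simp
    show "commutator G x y \<in> P 1" if "x \<in> carrier G" "y \<in> carrier G" for x y
      using P_comm[of x 0 y] that by (simp add: P_0)
    show "x [^] p \<in> P 1" if "x \<in> carrier G" for x
      using P_pow[of x 0] that by (simp add: P_0)
  qed
  then show ?thesis using s(2) by (auto simp: ibox_def)
qed

text \<open>By \<open>P_Suc_root\<close> an element of the next layer is a p-th power. Expanding the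
  root modulo \<open>P (Suc n)\<close> leaves an error in \<open>P (Suc n)\<close>, whose p-th power
  disappears one layer deeper.\<close>

lemma gs_span_layer:
  "y \<in> P n \<Longrightarrow> \<exists>a. length a = d \<and> P (Suc n) #> y = P (Suc n) #> mprod G gs (map ((*) (p ^ n)) a)"
proof (induction n arbitrary: y)
  case 0
  then show ?case using gs_span_P1[of y] by simp
next
  case (Suc n)
  let ?N = "P (Suc (Suc n))"
  obtain x where x: "x \<in> P n" "?N #> y = ?N #> (x [^] p)" using P_Suc_root[OF Suc.prems] by blast
  obtain a where a: "length a = d" "P (Suc n) #> x = P (Suc n) #> mprod G gs (map ((*) (p ^ n)) a)"
    using Suc.IH[OF x(1)] by blast
  define m where "m = mprod G gs (map ((*) (p ^ n)) a)"
  have m: "m \<in> P n" unfolding m_def using a gs_carrier by (intro mprod_scaled_P) auto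
  define u where "u = x \<otimes> inv m"
  have u: "u \<in> P (Suc n)" "u \<in> P n" "x = u \<otimes> m"
    using a x m P_dec[of n] unfolding u_def by (auto simp: cs_iff m_def[symmetric] m_assoc)
  have "?N #> (x [^] p) = ?N #> (u [^] p \<otimes> m [^] p)" unfolding u(3) by (rule pow_mult_mod[OF u(2) m])
  also have "\<dots> = ?N #> (m [^] p)" using P_pow[OF u(1)] m by (intro cs_absorb) auto
  also have "\<dots> = ?N #> mprod G gs (map ((*) (p ^ Suc n)) a)"
    unfolding m_def using a gs_carrier by (intro cs_mprod_pow) auto
  finally show ?case using x a by auto
qed

lemma cs_mprod_split:
  assumes "length a = d" "length b = d"
  shows "P (Suc n) #> mprod G gs (map2 (+) a (map ((*) (p ^ n)) b)) =
    P (Suc n) #> (mprod G gs a \<otimes> mprod G gs (map ((*) (p ^ n)) b))"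
  using assms gs_carrier
  by (intro cs_mprod_add) (auto intro!: cs_central[symmetric] pow_P_mult)

text \<open>The exponents are corrected by one power of \<open>p\<close> at a time: the error
  \<open>u\<close> lies in \<open>P n\<close>, is a word with exponents divisible by p^n modulo
  \<open>P (Suc n)\<close>, and such powers are central there, so they merge into the word.\<close>

lemma gs_span:
  "x \<in> carrier G \<Longrightarrow> \<exists>a. length a = d \<and> P n #> x = P n #> mprod G gs a"
proof (induction n)
  case 0
  have "P 0 #> x = P 0 #> mprod G gs (replicate d 0)" by (subst cs_iff) (use 0 gs_carrier in \<open>auto simp: P_0\<close>)
  then show ?case by (intro exI[of _ "replicate d 0"] conjI) simp_all
next
  case (Suc n)
  then obtain a where a: "length a = d" "P n #> x = P n #> mprod G gs a" by auto
  define m where "m = mprod G gs a"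
  have m: "m \<in> carrier G" unfolding m_def using gs_carrier by simp
  define u where "u = inv m \<otimes> x"
  have "P n #> (inv m \<otimes> x) = P n #> (inv m \<otimes> m)"
    by (rule cs_mult_cong; use a m Suc m_def in auto)
  then have u: "u \<in> P n" unfolding u_def using m Suc by (simp add: cs_one_iff)
  obtain b where b: "length b = d" "P (Suc n) #> u = P (Suc n) #> mprod G gs (map ((*) (p ^ n)) b)"
    using gs_span_layer[OF u] by blast
  have "P (Suc n) #> x = P (Suc n) #> (m \<otimes> u)" unfolding u_def using m Suc by simp
  also have "\<dots> = P (Suc n) #> (m \<otimes> mprod G gs (map ((*) (p ^ n)) b))"
    by (rule cs_mult_cong; use b m u gs_carrier in auto)
  also have "\<dots> = P (Suc n) #> mprod G gs (map2 (+) a (map ((*) (p ^ n)) b))"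
    unfolding m_def using a b by (intro cs_mprod_split[symmetric]) auto
  finally show ?case using a b by (intro exI[of _ "map2 (+) a (map ((*) (p ^ n)) b)"]) simp
qed

lemma cs_scaled_mod:
  assumes "length a = d"
  shows "P (Suc n) #> mprod G gs (map ((*) (p ^ n)) a) =
    P (Suc n) #> mprod G gs (map ((*) (p ^ n)) (map (\<lambda>x. x mod p) a))"
  using assms by (intro cs_mprod_mod) (auto simp: mult_mod_right[symmetric] mult.commute)

end

locale pbasis = pspan +
  assumes P_card: "card {P (Suc n) #> x | x. x \<in> P n} = p ^ length gs"
begin

text \<open>The words cover the layer, and by \<open>P_card\<close> it has exactly as many cosets as
  there are exponent vectors.\<close>

lemma layer_inj: "inj_on (\<lambda>a. P (Suc n) #> mprod G gs (map ((*) (p ^ n)) a)) (ibox d p)"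
proof (rule eq_card_imp_inj_on)
  let ?f = "\<lambda>a. P (Suc n) #> mprod G gs (map ((*) (p ^ n)) a)"
  have "?f ` ibox d p = {P (Suc n) #> x | x. x \<in> P n}"
  proof (intro equalityI subsetI)
    fix Y assume "Y \<in> ?f ` ibox d p"
    then obtain a where "a \<in> ibox d p" "Y = ?f a" by auto
    then show "Y \<in> {P (Suc n) #> x | x. x \<in> P n}"
      using mprod_scaled_P[of a gs n] gs_carrier by (auto simp: ibox_def)
  next
    fix Y assume "Y \<in> {P (Suc n) #> x | x. x \<in> P n}"
    then obtain x where x: "x \<in> P n" "Y = P (Suc n) #> x" by auto
    obtain a where a: "length a = d" "Y = ?f a" using gs_span_layer[OF x(1)] x by auto
    then have "Y = ?f (map (\<lambda>x. x mod p) a)" using cs_scaled_mod by metis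
    then show "Y \<in> ?f ` ibox d p" by (rule image_eqI) (use map_mod_in_ibox[of p a d] a p_gt1 in auto)
  qed
  then show "card (?f ` ibox d p) = card (ibox d p)" using P_card[of n] by (simp add: card_ibox)
qed simp

text \<open>Both exponent vectors are a common remainder \<open>r\<close> modulo p^n plus p^n times
  a quotient. Cancelling the word of \<open>r\<close> leaves an equation in the n-th layer, where
  \<open>layer_inj\<close> gives the next digit.\<close>

lemma cs_mprod_eq_imp_mod:
  "length a = d \<Longrightarrow> length b = d \<Longrightarrow> P n #> mprod G gs a = P n #> mprod G gs b \<Longrightarrow> i < d \<Longrightarrow>
    a ! i mod p ^ n = b ! i mod p ^ n"
proof (induction n arbitrary: i)
  case (Suc n)
  define q where "q = p ^ n"
  have mc: "mprod G gs x \<in> carrier G" for x using gs_carrier by simp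
  have "P n #> mprod G gs a = P n #> mprod G gs b"
    using cs_mono[of n "Suc n"] Suc.prems mc by simp
  then have md: "a ! i mod q = b ! i mod q" if "i < d" for i using Suc that q_def by blast
  define r where "r = map (\<lambda>x. x mod q) a"
  define a' where "a' = map (\<lambda>x. x div q) a"
  define b' where "b' = map (\<lambda>x. x div q) b"
  have len: "length r = d" "length a' = d" "length b' = d" using Suc.prems by (simp_all add: r_def a'_def b'_def)
  have ea: "a = map2 (+) r (map ((*) q) a')"
    by (rule nth_equalityI) (auto simp: r_def a'_def Suc.prems)
  have eb: "b = map2 (+) r (map ((*) q) b')"
    by (rule nth_equalityI) (auto simp: r_def b'_def Suc.prems md)
  have "P (Suc n) #> (mprod G gs r \<otimes> mprod G gs (map ((*) q) a')) = P (Suc n) #> (mprod G gs r \<otimes> mprod G gs (map ((*) q) b'))"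
    using Suc.prems(3) cs_mprod_split[of r a' n] cs_mprod_split[of r b' n] ea eb len unfolding q_def by simp
  then have "P (Suc n) #> (inv mprod G gs r \<otimes> (mprod G gs r \<otimes> mprod G gs (map ((*) q) a'))) =
    P (Suc n) #> (inv mprod G gs r \<otimes> (mprod G gs r \<otimes> mprod G gs (map ((*) q) b')))"
    by (rule cs_mult_cong[OF refl]) (use mc in auto)
  then have "P (Suc n) #> mprod G gs (map ((*) q) a') = P (Suc n) #> mprod G gs (map ((*) q) b')"
    using mc by simp
  then have "map (\<lambda>x. x mod p) a' = map (\<lambda>x. x mod p) b'"
    using layer_inj[of n] cs_scaled_mod[of a' n] cs_scaled_mod[of b' n] len p_gt1 unfolding q_def[symmetric]
    by (intro inj_onD[OF layer_inj[of n, folded q_def]]) (auto intro: map_mod_in_ibox)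
  then have "a' ! i mod p = b' ! i mod p" using len Suc.prems(4) by (metis nth_map)
  then have "(a ! i div q) mod p = (b ! i div q) mod p"
    using Suc.prems by (simp add: a'_def b'_def)
  then show ?case using md[OF Suc.prems(4)] unfolding power_Suc2 q_def[symmetric]
    by (simp add: mod_mult2_eq)
qed simp

lemma cs_mprod_bij: "bij_betw (\<lambda>a. P n #> mprod G gs a) (ibox d (p ^ n)) (rcosets (P n))"
  unfolding bij_betw_def
proof
  show "inj_on (\<lambda>a. P n #> mprod G gs a) (ibox d (p ^ n))"
  proof (rule inj_onI)
    fix a b assume a: "a \<in> ibox d (p ^ n)" and b: "b \<in> ibox d (p ^ n)"
      and e: "P n #> mprod G gs a = P n #> mprod G gs b"
    have "a ! i = b ! i" if "i < d" for i
      using cs_mprod_eq_imp_mod[OF _ _ e that] a b that by (auto simp: ibox_def subset_iff)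
    then show "a = b" using a b by (intro nth_equalityI) (auto simp: ibox_def)
  qed
  show "(\<lambda>a. P n #> mprod G gs a) ` ibox d (p ^ n) = rcosets (P n)"
  proof (intro equalityI subsetI)
    fix Y assume "Y \<in> rcosets (P n)"
    then obtain x where x: "x \<in> carrier G" "Y = P n #> x" by (auto simp: RCOSETS_def)
    then obtain a where a: "length a = d" "Y = P n #> mprod G gs a" using gs_span by metis
    then have "Y = P n #> mprod G gs (map (\<lambda>x. x mod p ^ n) a)"
      using cs_mprod_mod[of a "map (\<lambda>x. x mod p ^ n) a" n] by simp
    then show "Y \<in> (\<lambda>a. P n #> mprod G gs a) ` ibox d (p ^ n)"
      by (rule image_eqI) (use map_mod_in_ibox[of "p ^ n" a d] a p_gt1 in auto)
  qed (use gs_carrier in \<open>auto simp: RCOSETS_def\<close>)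
qed

end

subsection \<open>Uniform groups\<close>

lemma (in group) subgroup_nat_pow: "subgroup H G \<Longrightarrow> x \<in> H \<Longrightarrow> x [^] (k::nat) \<in> H"
  by (induction k) (auto simp: subgroup.one_closed subgroup.m_closed)

locale pro_p_group_loc = profinite_group_loc G T for G :: "'g monoid" (structure) and T +
  fixes p :: nat
  assumes p_prime: "Factorial_Ring.prime p"
    and index_pow: "open_normal G T N \<Longrightarrow> \<exists>k. idx G (carrier G) N = p ^ k"
begin

sublocale mgroup G by unfold_locales

lemma open_normalD:
  assumes "open_normal G T N"
  shows "N \<lhd> G" "subgroup N G" "openin T N"
  using assms normal_imp_subgroup by (auto simp: open_normal_def)

lemma finite_rcosets: "open_normal G T N \<Longrightarrow> finite (rcosets N)"
  using finite_rcosets_open open_normalD by blast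

text \<open>The induction runs up a chain of open normal subgroups with central factors of order
  \<open>p\<close>; the factors come from the nontrivial centre of the finite \<open>p\<close>-group \<open>G/N\<close>.\<close>
lemma open_normal_central_induct [consumes 1, case_names carrier step]:
  assumes "open_normal G T N"
    and base: "Q (carrier G)"
    and step: "\<And>N M z. open_normal G T N \<Longrightarrow> open_normal G T M \<Longrightarrow> z \<in> carrier G \<Longrightarrow> z [^] p \<in> N \<Longrightarrow>
      (\<And>x. x \<in> carrier G \<Longrightarrow> N #> (x \<otimes> z) = N #> (z \<otimes> x)) \<Longrightarrow>
      M = {x \<in> carrier G. \<exists>j::nat. N #> x = N #> (z [^] j)} \<Longrightarrow> Q M \<Longrightarrow> Q N"
  shows "Q N"
  using assms(1)
proof (induction "card (rcosets N)" arbitrary: N rule: less_induct)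
  case less
  note N = open_normalD[OF less.prems]
  interpret N: normal N G by (rule N(1))
  define h where "h = (\<lambda>x. N #> x)"
  define Q' where "Q' = G Mod N"
  interpret h: group_hom G Q' h unfolding h_def Q'_def by (rule N.quotient_hom)
  interpret Q': mgroup Q' by (rule mgroup.intro) (rule h.H.is_group)
  show ?case
  proof (cases "N = carrier G")
    case False
    obtain k where k: "idx G (carrier G) N = p ^ k" using index_pow[OF less.prems] by blast
    have "{N #> x | x. x \<in> carrier G} = rcosets N" by (auto simp: RCOSETS_def)
    then have o: "order Q' = p ^ k" using k unfolding Q'_def order_def idx_def
      by (simp add: FactGroup_def)
    have "k > 0"
    proof (rule ccontr)
      assume "\<not> k > 0"
      then have "order Q' = 1" using o by simp
      then have "carrier Q' = {\<one>\<^bsub>Q'\<^esub>}" using h.H.order_one_triv_iff by blast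
      then have "h x = \<one>\<^bsub>Q'\<^esub>" if "x \<in> carrier G" for x using h.hom_closed[OF that] by simp
      then have "carrier G \<subseteq> N" by (auto simp: h_def Q'_def N.coset_eq_self_iff)
      then show False using False N.subset by blast
    qed
    from Q'.p_group_central_element[OF p_prime o this]
    obtain Z where Z: "Z \<in> carrier Q'" "Z \<noteq> \<one>\<^bsub>Q'\<^esub>" "Z [^]\<^bsub>Q'\<^esub> p = \<one>\<^bsub>Q'\<^esub>"
      "\<And>A. A \<in> carrier Q' \<Longrightarrow> A \<otimes>\<^bsub>Q'\<^esub> Z = Z \<otimes>\<^bsub>Q'\<^esub> A" by blast
    then obtain z where z: "z \<in> carrier G" "Z = h z" by (auto simp: Q'_def carrier_FactGroup h_def)
    have h1: "h x = h \<one> \<longleftrightarrow> x \<in> N" if "x \<in> carrier G" for x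
      using N.coset_eq_iff[of x \<one>] that by (simp add: h_def)
    have zN: "z \<notin> N" using Z(2) z h1[of z] by simp
    have zp: "z [^] p \<in> N" using Z(3) z h1[of "z [^] p"] by (simp add: h.hom_nat_pow)
    have cen: "h (x \<otimes> z) = h (z \<otimes> x)" if "x \<in> carrier G" for x using Z(4)[of "h x"] z that by simp
    have cenj: "h (x \<otimes> z [^] j) = h (z [^] j \<otimes> x)" if "x \<in> carrier G" for x and j :: nat
      using cen[OF that] z that h.H.group_commutes_pow[of "h z" "h x" j] by (simp add: h.hom_nat_pow)
    define M where "M = {x \<in> carrier G. \<exists>j::nat. h x = h (z [^] j)}"
    have NM: "N \<subseteq> M"
    proof
      fix x assume "x \<in> N"
      then have "x \<in> carrier G" "h x = h (z [^] (0::nat))" using h1[of x] N.mem_carrier by auto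
      then show "x \<in> M" unfolding M_def by blast
    qed
    have zM: "z \<in> M" unfolding M_def using z by (auto intro!: exI[of _ 1])
    have subM: "subgroup M G"
    proof (rule subgroupI)
      fix a assume a: "a \<in> M"
      then obtain j :: nat where j: "a \<in> carrier G" "h a = h (z [^] j)" by (auto simp: M_def)
      have "p \<ge> 1" using prime_gt_0_nat[OF p_prime] by simp
      then have "j + j * (p - 1) = p * j" by (simp add: algebra_simps)
      then have "h a \<otimes>\<^bsub>Q'\<^esub> h (z [^] (j * (p - 1))) = h ((z [^] p) [^] j)"
        using j z by (simp add: h.hom_nat_pow h.H.nat_pow_mult h.H.nat_pow_pow)
      also have "\<dots> = \<one>\<^bsub>Q'\<^esub>" using Z(3) z by (simp add: h.hom_nat_pow)
      finally have "h (z [^] (j * (p - 1))) = h (inv a)"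
        using j z by (metis h.H.inv_equality h.H.inv_inv h.hom_closed h.hom_inv nat_pow_closed)
      then show "inv a \<in> M" using j unfolding M_def by auto
    next
      fix a b assume a: "a \<in> M" and b: "b \<in> M"
      then obtain i j :: nat where ij: "a \<in> carrier G" "h a = h (z [^] i)" "b \<in> carrier G" "h b = h (z [^] j)"
        by (auto simp: M_def)
      have "h (a \<otimes> b) = h (z [^] i \<otimes> z [^] j)" using ij z by simp
      also have "z [^] i \<otimes> z [^] j = z [^] (i + j)" using z by (simp add: nat_pow_mult)
      finally show "a \<otimes> b \<in> M" using ij unfolding M_def by blast
    qed (use zM in \<open>auto simp: M_def\<close>)
    have norM: "M \<lhd> G" unfolding normal_inv_iff
    proof (intro conjI ballI subM)
      fix x a assume x: "x \<in> carrier G" and "a \<in> M"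
      then obtain j :: nat where j: "a \<in> carrier G" "h a = h (z [^] j)" by (auto simp: M_def)
      have "h (x \<otimes> a \<otimes> inv x) = h (x \<otimes> z [^] j) \<otimes>\<^bsub>Q'\<^esub> h (inv x)" using j x z by simp
      also have "\<dots> = h (z [^] j)" unfolding cenj[OF x] using x z by (simp add: h.H.m_assoc)
      finally show "x \<otimes> a \<otimes> inv x \<in> M" using x j unfolding M_def by blast
    qed
    have opM: "openin T M" using openin_subgroup_if_nbhd[OF subM N(3) _ NM] N.one_closed by simp
    have onM: "open_normal G T M" using norM opM by (simp add: open_normal_def)
    interpret M: normal M G by (rule norM)
    have hM: "M #> x = M #> y" if "h x = h y" "x \<in> carrier G" "y \<in> carrier G" for x y
      using that NM by (auto simp: h_def M.coset_eq_iff N.coset_eq_iff)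
    define r where "r C = (SOME x. x \<in> carrier G \<and> C = h x)" for C
    have r: "r (h x) \<in> carrier G" "h (r (h x)) = h x" if "x \<in> carrier G" for x
    proof -
      have "\<exists>y. y \<in> carrier G \<and> h x = h y" using that by blast
      from someI_ex[OF this] show "r (h x) \<in> carrier G" "h (r (h x)) = h x" unfolding r_def by auto
    qed
    have "rcosets M \<subseteq> (\<lambda>C. M #> r C) ` (rcosets N - {h z})"
    proof
      fix C assume "C \<in> rcosets M"
      then obtain x where x: "x \<in> carrier G" "C = M #> x" by (auto simp: RCOSETS_def)
      show "C \<in> (\<lambda>C. M #> r C) ` (rcosets N - {h z})"
      proof (cases "h x = h z")
        case True
        have "C = M #> z" using hM[OF True] x z by simp
        also have "\<dots> = M #> \<one>" using zM z by (simp add: M.coset_eq_iff)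
        also have "\<dots> = M #> r (h \<one>)" using r[of \<one>] by (intro hM) auto
        finally have "C = M #> r (h \<one>)" .
        moreover have "h \<one> \<noteq> h z" using zN h1[OF z(1)] by metis
        ultimately show ?thesis by (auto simp: h_def RCOSETS_def)
      next
        case False
        have "C = M #> r (h x)" using r[OF x(1)] hM[of "r (h x)" x] x by simp
        then show ?thesis using False x by (auto simp: h_def RCOSETS_def)
      qed
    qed
    then have "card (rcosets M) \<le> card (rcosets N - {h z})"
      using finite_rcosets[OF less.prems] by (meson card_image_le card_mono finite_Diff finite_imageI order_trans)
    also have "\<dots> < card (rcosets N)"
      using finite_rcosets[OF less.prems] z by (intro psubset_card_mono) (auto simp: h_def RCOSETS_def)
    finally have "Q M" using less.hyps onM by blast
    then show ?thesis
      using step[OF less.prems onM z(1) zp] cen M_def unfolding h_def by blast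
  qed (use base in simp)
qed

end

section \<open>Openness and cofinality of the lower p-series; independence of the generators\<close>

declare lower_p_series.simps(2) [simp del]

locale uniform_group_loc = pro_p_group_loc +
  fixes gs :: "'a list"
  assumes uniform: "uniform_pro_p p G T" and min_gs: "minimal_top_gens G T gs"
begin

abbreviation "P \<equiv> lower_p_series p G T"
abbreviation "d \<equiv> length gs"

lemma gs_carrier: "set gs \<subseteq> carrier G"
  using min_gs by (auto simp: minimal_top_gens_def top_generates_def)

lemma conj_pow: "g \<in> carrier G \<Longrightarrow> x \<in> carrier G \<Longrightarrow> g \<otimes> x [^] (k::nat) \<otimes> inv g = (g \<otimes> x \<otimes> inv g) [^] k"
proof (induction k)
  case (Suc k)
  have "g \<otimes> x [^] Suc k \<otimes> inv g = (g \<otimes> x [^] k \<otimes> inv g) \<otimes> (g \<otimes> x \<otimes> inv g)"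
    using Suc.prems by (simp add: m_assoc)
  then show ?case using Suc by simp
qed simp

lemma conj_commutator: "g \<in> carrier G \<Longrightarrow> x \<in> carrier G \<Longrightarrow> y \<in> carrier G \<Longrightarrow>
  g \<otimes> commutator G x y \<otimes> inv g = commutator G (g \<otimes> x \<otimes> inv g) (g \<otimes> y \<otimes> inv g)"
  by (simp add: commutator_def m_assoc inv_mult_group)

definition lgens :: "nat \<Rightarrow> 'a set" where
  "lgens n = {x [^] p | x. x \<in> P n} \<union> {commutator G x y | x y. x \<in> P n \<and> y \<in> carrier G}"

lemma P_Suc: "P (Suc n) = T closure_of (generate G (lgens n))"
  by (simp add: lgens_def lower_p_series.simps(2))

lemma P_normal: "P n \<lhd> G"
proof (induction n)
  case 0 then show ?case by (simp add: normal_self)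
next
  case (Suc n)
  have sub: "P n \<subseteq> carrier G" using Suc normal_imp_subgroup subgroup.subset by blast
  have "generate G (lgens n) \<lhd> G"
  proof (rule normal_generateI)
    show "lgens n \<subseteq> carrier G" using sub by (auto simp: lgens_def)
    fix h g assume h: "h \<in> lgens n" and g: "g \<in> carrier G"
    have c: "g \<otimes> x \<otimes> inv g \<in> P n" if "x \<in> P n" for x
      using Suc that g by (simp add: normal.inv_op_closed2)
    from h consider x where "x \<in> P n" "h = x [^] p"
      | x y where "x \<in> P n" "y \<in> carrier G" "h = commutator G x y" by (auto simp: lgens_def)
    then show "g \<otimes> h \<otimes> inv g \<in> lgens n"
    proof cases
      case 1
      then have "g \<otimes> h \<otimes> inv g = (g \<otimes> x \<otimes> inv g) [^] p" using g sub by (simp add: conj_pow subset_iff)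
      then show ?thesis using c[OF 1(1)] unfolding lgens_def by blast
    next
      case 2
      then have "g \<otimes> h \<otimes> inv g = commutator G (g \<otimes> x \<otimes> inv g) (g \<otimes> y \<otimes> inv g)"
        using g sub by (simp add: conj_commutator subset_iff)
      then show ?thesis using c[OF 2(1)] g 2(2) unfolding lgens_def by blast
    qed
  qed
  then show ?case unfolding P_Suc by (rule normal_closure)
qed

lemma P_sub: "subgroup (P n) G" using P_normal by (rule normal_imp_subgroup)

lemma P_mem: "x \<in> P n \<Longrightarrow> x \<in> carrier G" using P_sub subgroup.mem_carrier by metis

lemma lgens_carrier: "lgens n \<subseteq> carrier G" using P_mem by (auto simp: lgens_def)

lemma P_closed: "closedin T (P n)"
  using closedin_topspace[of T] by (cases n) (auto simp: topspace_eq P_Suc)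

lemma lgens_P: "lgens n \<subseteq> P (Suc n)"
proof -
  have "lgens n \<subseteq> generate G (lgens n)" by (auto intro: generate.incl)
  also have "\<dots> \<subseteq> P (Suc n)" unfolding P_Suc
    using generate_in_carrier[OF lgens_carrier] by (intro closure_of_subset) (auto simp: topspace_eq)
  finally show ?thesis .
qed

lemma P_dec: "P (Suc n) \<subseteq> P n"
proof -
  have "lgens n \<subseteq> P n"
  proof
    fix h assume "h \<in> lgens n"
    then consider x where "x \<in> P n" "h = x [^] p"
      | x y where "x \<in> P n" "y \<in> carrier G" "h = commutator G x y" by (auto simp: lgens_def)
    then show "h \<in> P n"
    proof cases
      case 1
      have "x [^] k \<in> P n" for k :: nat
        using P_sub[of n] 1(1) by (induction k) (auto simp: subgroup.one_closed subgroup.m_closed)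
      then show ?thesis using 1 by simp
    next
      case 2
      have "inv x \<in> P n" using 2 P_sub subgroup.m_inv_closed by metis
      then have "y \<otimes> inv x \<otimes> inv y \<in> P n" using P_normal 2 by (simp add: normal.inv_op_closed2)
      then have "x \<otimes> (y \<otimes> inv x \<otimes> inv y) \<in> P n" using 2 P_sub subgroup.m_closed by metis
      then show ?thesis using 2 P_mem[OF 2(1)] by (simp add: commutator_def m_assoc)
    qed
  qed
  then have "generate G (lgens n) \<subseteq> P n" using P_sub by (rule generate_subgroup_incl)
  then show ?thesis unfolding P_Suc using P_closed by (rule closure_of_minimal)
qed

lemma P_pow: "x \<in> P n \<Longrightarrow> x [^] p \<in> P (Suc n)"
  using lgens_P[of n] unfolding lgens_def by blast

lemma P_comm: "x \<in> P n \<Longrightarrow> y \<in> carrier G \<Longrightarrow> commutator G x y \<in> P (Suc n)"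
  using lgens_P[of n] unfolding lgens_def by blast

lemma gs_dense: "T closure_of (generate G (set gs)) = carrier G"
  using min_gs by (auto simp: minimal_top_gens_def top_generates_def)

lemma P_1_comm: "x \<in> carrier G \<Longrightarrow> y \<in> carrier G \<Longrightarrow> commutator G x y \<in> P 1"
  using P_comm[of x 0 y] by simp

lemma P_1_pow: "x \<in> carrier G \<Longrightarrow> x [^] p \<in> P 1"
  using P_pow[of x 0] by simp

lemma p_pos: "p > 0" using p_prime by (simp add: prime_gt_0_nat)

text \<open>At this stage \<open>P 1\<close> is known to be closed but not to be open. Finitely many
  of its cosets form a closed set containing the dense subgroup generated by \<open>gs\<close>,
  hence cover \<open>G\<close>.\<close>

lemma rcosets_P_1: "rcosets (P 1) = (\<lambda>a. P 1 #> mprod G gs a) ` ibox d p"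
proof -
  interpret N: normal "P 1" G by (rule P_normal)
  let ?K = "\<Union>((\<lambda>a. P 1 #> mprod G gs a) ` ibox d p)"
  have "closedin T ?K"
    using gs_carrier by (intro closedin_Union) (auto intro!: closedin_rcos P_closed)
  moreover have "generate G (set gs) \<subseteq> ?K"
  proof
    fix s assume s: "s \<in> generate G (set gs)"
    then have "\<exists>a\<in>ibox d p. P 1 #> s = P 1 #> mprod G gs a"
      by (intro elementary_abelian_span[OF P_normal gs_carrier p_pos P_1_comm P_1_pow])
    moreover have "s \<in> P 1 #> s" using s generate_in_carrier[OF gs_carrier] by (simp add: rcos_self P_sub)
    ultimately show "s \<in> ?K" by blast
  qed
  ultimately have K: "carrier G \<subseteq> ?K" using closure_of_minimal gs_dense by metis
  show ?thesis
  proof (intro equalityI subsetI)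
    fix C assume "C \<in> rcosets (P 1)"
    then obtain x where x: "x \<in> carrier G" "C = P 1 #> x" unfolding RCOSETS_def by blast
    then obtain a where a: "a \<in> ibox d p" "x \<in> P 1 #> mprod G gs a" using K by blast
    then have "P 1 #> mprod G gs a = P 1 #> x" using gs_carrier by (intro repr_independence P_sub) auto
    then show "C \<in> (\<lambda>a. P 1 #> mprod G gs a) ` ibox d p" using a x by blast
  next
    fix C assume "C \<in> (\<lambda>a. P 1 #> mprod G gs a) ` ibox d p"
    then show "C \<in> rcosets (P 1)" unfolding RCOSETS_def using gs_carrier by auto
  qed
qed

lemma layer_card: "card {P (Suc n) #> x | x. x \<in> P n} = card (rcosets (P 1))"
proof -
  have "idx G (P n) (P (Suc n)) = idx G (P 0) (P 1)"
    using uniform unfolding uniform_pro_p_def by blast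
  moreover have "rcosets (P 1) = {P 1 #> x | x. x \<in> P 0}" by (auto simp: RCOSETS_def)
  ultimately show ?thesis by (simp only: idx_def)
qed

text \<open>Uniformity compares values of \<open>card\<close>, which is 0 on infinite sets. The
  index of \<open>P 1\<close> is positive, so every layer has positive, hence finite, cardinality
  and \<open>openin_finite_index\<close> applies.\<close>

lemma P_open: "openin T (P n)"
proof (induction n)
  case 0 then show ?case using openin_topspace[of T] by (simp add: topspace_eq)
next
  case (Suc n)
  have "card (rcosets (P 1)) > 0"
  proof -
    have "finite (rcosets (P 1))" unfolding rcosets_P_1 by simp
    moreover have "P 1 #> \<one> \<in> rcosets (P 1)" unfolding RCOSETS_def by blast
    ultimately show ?thesis by (metis card_gt_0_iff empty_iff)
  qed
  then have "card {P (Suc n) #> x | x. x \<in> P n} > 0" by (simp only: layer_card)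
  then have "finite {P (Suc n) #> x | x. x \<in> P n}" by (rule card_ge_0_finite)
  then show ?case using openin_finite_index[OF P_sub P_sub P_dec Suc P_closed] by blast
qed

lemma P_open_normal: "open_normal G T (P n)"
  using P_open P_normal by (simp add: open_normal_def)

lemma power_gen: "{x [^] p | x. x \<in> carrier G} \<subseteq> carrier G" by auto

lemma power4_gen: "p = 2 \<Longrightarrow> x \<in> carrier G \<Longrightarrow> x [^] (4::nat) = (x [^] p) [^] p"
  by (simp add: nat_pow_pow)

lemma commutator_closed_power:
  "x \<in> carrier G \<Longrightarrow> y \<in> carrier G \<Longrightarrow> commutator G x y \<in> closed_power_subgroup G T (if p = 2 then 4 else p)"
  using uniform by (auto simp: uniform_pro_p_def powerful_def)

text \<open>Powerfulness puts all commutators into a closed subgroup generated by powers; for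
  \<open>p = 2\<close> these are fourth powers, which are squares of squares.\<close>

lemma P_1_powers: "P 1 \<subseteq> T closure_of (generate G {x [^] p | x. x \<in> carrier G})"
proof -
  let ?A = "{x [^] p | x. x \<in> carrier G}"
  let ?C = "T closure_of (generate G ?A)"
  have sC: "subgroup ?C G" by (rule subgroup_closure[OF generate_is_subgroup[OF power_gen]])
  have gC: "generate G ?A \<subseteq> ?C" 
    using generate_in_carrier[OF power_gen] by (intro closure_of_subset) (auto simp: topspace_eq)
  have "closed_power_subgroup G T (if p = 2 then 4 else p) \<subseteq> ?C"
  proof (cases "p = 2")
    case True
    have "{x [^] (4::nat) | x. x \<in> carrier G} \<subseteq> generate G ?A"
    proof
      fix y assume "y \<in> {x [^] (4::nat) | x. x \<in> carrier G}"
      then obtain x where "x \<in> carrier G" "y = (x [^] p) [^] p" using power4_gen[OF True] by blast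
      then have "y \<in> ?A" by (intro CollectI exI[of _ "x [^] p"]) simp
      then show "y \<in> generate G ?A" by (rule generate.incl)
    qed
    then have "generate G {x [^] (4::nat) | x. x \<in> carrier G} \<subseteq> generate G ?A"
      by (rule generate_subgroup_incl[OF _ generate_is_subgroup[OF power_gen]])
    then show ?thesis using True unfolding closed_power_subgroup_def by (simp add: closure_of_mono)
  next
    case False
    then show ?thesis unfolding closed_power_subgroup_def by simp
  qed
  moreover have "?A \<subseteq> ?C" using gC generate.incl[of _ ?A G] by (meson subset_iff)
  ultimately have "lgens 0 \<subseteq> ?C"
    using commutator_closed_power unfolding lgens_def lower_p_series.simps(1)
    by (simp only: Un_subset_iff) fast
  then have "generate G (lgens 0) \<subseteq> ?C" by (rule generate_subgroup_incl[OF _ sC])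
  then have "T closure_of (generate G (lgens 0)) \<subseteq> ?C" by (intro closure_of_minimal) auto
  then show ?thesis unfolding One_nat_def P_Suc .
qed

lemma P_2_commutator:
  assumes p2: "p = 2" and xy: "x \<in> carrier G" "y \<in> carrier G" shows "commutator G x y \<in> P 2"
proof -
  have "{x [^] (4::nat) | x. x \<in> carrier G} \<subseteq> P 2"
  proof
    fix w assume "w \<in> {x [^] (4::nat) | x. x \<in> carrier G}"
    then obtain x where x: "x \<in> carrier G" "w = (x [^] p) [^] p" using power4_gen[OF p2] by blast
    have "(x [^] p) [^] p \<in> P (Suc 1)" by (intro P_pow P_1_pow x)
    then show "w \<in> P 2" using x by (simp add: numeral_2_eq_2)
  qed
  then have "generate G {x [^] (4::nat) | x. x \<in> carrier G} \<subseteq> P 2" using P_sub by (rule generate_subgroup_incl)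
  then have "closed_power_subgroup G T 4 \<subseteq> P 2"
    unfolding closed_power_subgroup_def using P_closed by (rule closure_of_minimal)
  then show ?thesis using commutator_closed_power[OF xy] p2 by auto
qed

sublocale S: pseries G p P
proof (intro pseries.intro pseries_axioms.intro mgroup_axioms)
  show "Factorial_Ring.prime p" by (rule p_prime)
  show "P 0 = carrier G" by simp
  show "P n \<lhd> G" "P (Suc n) \<subseteq> P n" for n by (rule P_normal P_dec)+
  show "x [^] p \<in> P (Suc n)" if "x \<in> P n" for x n using that by (rule P_pow)
  show "commutator G x y \<in> P (Suc n)" if "x \<in> P n" "y \<in> carrier G" for x y n using that by (rule P_comm)
  show "\<exists>s\<in>generate G ({x [^] p | x. x \<in> P n} \<union> {commutator G x y | x y. x \<in> P n \<and> y \<in> carrier G}).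
      \<exists>u\<in>P (Suc (Suc n)). x = u \<otimes> s" if "x \<in> P (Suc n)" for x n
    using closure_mem_cong[OF that[unfolded P_Suc[of n]] P_sub[of "Suc (Suc n)"] P_open] unfolding lgens_def .
  show "\<exists>s\<in>generate G {x [^] p | x. x \<in> carrier G}. \<exists>u\<in>P m. x = u \<otimes> s" if "x \<in> P 1" for x m
    using closure_mem_cong[OF subsetD[OF P_1_powers that] P_sub[of m] P_open] .
  show "commutator G x y \<in> P 2" if "p = 2" "x \<in> carrier G" "y \<in> carrier G" for x y
    using that by (rule P_2_commutator)
qed

text \<open>If \<open>P n\<close> lies in \<open>M\<close> and \<open>M\<close> is central of
  exponent \<open>p\<close> modulo \<open>N\<close>, then the p-th powers and commutators that
  generate the next term lie in \<open>N\<close>, which is closed.\<close>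

lemma P_cofinal: "open_normal G T N \<Longrightarrow> \<exists>n. P n \<subseteq> N"
proof (induction rule: open_normal_central_induct)
  case carrier
  show ?case by (rule exI[of _ 0]) simp
next
  case (step N M z)
  note N = open_normalD[OF step(1)]
  interpret N: normal N G by (rule N(1))
  obtain n where n: "P n \<subseteq> M" using step by blast
  have "lgens n \<subseteq> N"
  proof
    fix g assume g: "g \<in> lgens n"
    define h where "h = (\<lambda>x. N #> x)"
    define Q where "Q = G Mod N"
    interpret h: group_hom G Q h unfolding h_def Q_def by (rule N.quotient_hom)
    have h1: "h x = \<one>\<^bsub>Q\<^esub> \<longleftrightarrow> x \<in> N" if "x \<in> carrier G" for x
      using N.coset_eq_self_iff[OF that] by (simp add: h_def Q_def)
    have M: "x \<in> carrier G \<and> (\<exists>j::nat. h x = h z [^]\<^bsub>Q\<^esub> j)" if "x \<in> P n" for x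
      using that n step(3) unfolding step(6) by (auto simp: h_def[symmetric] h.hom_nat_pow)
    have zp: "h z [^]\<^bsub>Q\<^esub> p = \<one>\<^bsub>Q\<^esub>" using step(3,4) h1[of "z [^] p"] by (simp add: h.hom_nat_pow)
    have cz: "h z \<otimes>\<^bsub>Q\<^esub> h y = h y \<otimes>\<^bsub>Q\<^esub> h z" if "y \<in> carrier G" for y
      using step(5)[OF that] step(3) that h.hom_mult unfolding h_def[symmetric] by metis
    from g consider x where "x \<in> P n" "g = x [^] p"
      | x y where "x \<in> P n" "y \<in> carrier G" "g = commutator G x y" by (auto simp: lgens_def)
    then show "g \<in> N"
    proof cases
      case 1
      obtain j :: nat where j: "x \<in> carrier G" "h x = h z [^]\<^bsub>Q\<^esub> j" using M[OF 1(1)] by blast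
      have "h g = (h z [^]\<^bsub>Q\<^esub> p) [^]\<^bsub>Q\<^esub> j"
        using j 1 step(3) by (simp add: h.hom_nat_pow h.H.nat_pow_pow mult.commute)
      then show ?thesis using h1[of g] j 1 zp by simp
    next
      case 2
      obtain j :: nat where j: "x \<in> carrier G" "h x = h z [^]\<^bsub>Q\<^esub> j" using M[OF 2(1)] by blast
      have "h x \<otimes>\<^bsub>Q\<^esub> h y = h y \<otimes>\<^bsub>Q\<^esub> h x"
        unfolding j(2) using cz[OF 2(2)] 2 step(3) by (intro h.H.group_commutes_pow) auto
      then have "h (x \<otimes> y) = h (y \<otimes> x)" using j 2 by simp
      then have "h (commutator G x y) = h \<one>"
        using hom_commutator_eq_one_iff[OF h.group_hom_axioms j(1) 2(2)] by simp
      then show ?thesis using h1[of g] j 2 by simp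
    qed
  qed
  then have "generate G (lgens n) \<subseteq> N" using N(2) by (rule generate_subgroup_incl)
  then have "P (Suc n) \<subseteq> N" unfolding P_Suc
    using closedin_open_subgroup[OF N(2,3)] by (rule closure_of_minimal)
  then show ?case by blast
qed

text \<open>\<open>P 1\<close> acts as the Frattini subgroup: by \<open>gs_span\<close> words in
  \<open>L\<close> reach every class modulo every \<open>P n\<close>, and the \<open>P n\<close> are
  cofinal among the open normal subgroups.\<close>

lemma frattini:
  assumes L: "set L \<subseteq> carrier G"
    and gen: "\<And>x. x \<in> carrier G \<Longrightarrow> \<exists>s\<in>generate G (set L). P 1 #> x = P 1 #> s"
  shows "top_generates G T (set L)"
proof -
  interpret L: pspan G p P L using L gen by unfold_locales
  have mp: "mprod G L a \<in> generate G (set L)" if "length a = length L" for a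
  proof (rule mprod_mem[OF generate_is_subgroup[OF L] L that])
    fix i assume "i < length L"
    then have "L ! i \<in> generate G (set L)" by (auto intro: generate.incl)
    then show "L ! i [^] a ! i \<in> generate G (set L)"
      by (rule subgroup_nat_pow[OF generate_is_subgroup[OF L]])
  qed
  have "T closure_of (generate G (set L)) = carrier G"
  proof (rule dense_if_all_quotients)
    show "generate G (set L) \<subseteq> carrier G" using generate_in_carrier[OF L] by blast
    fix N x assume N: "open_normal G T N" and x: "x \<in> carrier G"
    obtain n where n: "P n \<subseteq> N" using P_cofinal[OF N] by blast
    obtain a where a: "length a = length L" "P n #> x = P n #> mprod G L a" using L.gs_span[OF x] by blast
    then have "x \<otimes> inv (mprod G L a) \<in> P n" using x L by (simp add: S.cs_iff)
    then have "x \<otimes> inv (mprod G L a) \<in> N" using n by blast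
    moreover have "x = (x \<otimes> inv (mprod G L a)) \<otimes> mprod G L a" using x L by (simp add: m_assoc)
    ultimately show "\<exists>s\<in>generate G (set L). \<exists>n\<in>N. x = n \<otimes> s" using mp[OF a(1)] by blast
  qed
  then show ?thesis using L by (simp add: top_generates_def)
qed

lemma gs_gen: "x \<in> carrier G \<Longrightarrow> \<exists>s\<in>generate G (set gs). P 1 #> x = P 1 #> s"
proof -
  assume x: "x \<in> carrier G"
  then have "x \<in> T closure_of (generate G (set gs))" using gs_dense by simp
  then obtain s n where s: "s \<in> generate G (set gs)" "n \<in> P 1" "x = n \<otimes> s"
    using closure_mem_cong[OF _ P_sub[of 1] P_open] by blast
  then show ?thesis using S.cs_absorb[OF s(2)] generate_in_carrier[OF gs_carrier s(1)] by blast
qed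

text \<open>A coincidence between two standard words modulo the Frattini subgroup \<open>P 1\<close> makes one
  generator redundant, contradicting minimality.\<close>
lemma gs_inj_P1: "inj_on (\<lambda>a. P 1 #> mprod G gs a) (ibox d p)"
proof (rule inj_onI, rule ccontr)
  fix a b assume a: "a \<in> ibox d p" and b: "b \<in> ibox d p"
    and e: "P 1 #> mprod G gs a = P 1 #> mprod G gs b" and ne: "a \<noteq> b"
  have len: "length a = d" "length b = d" using a b by (auto simp: ibox_def)
  define h where "h = (\<lambda>x. P 1 #> x)"
  define Q where "Q = G Mod P 1"
  interpret h: group_hom G Q h unfolding h_def Q_def by (rule S.hom)
  interpret Q: comm_group Q
    unfolding Q_def by (rule elementary_abelian_quotient(1)[OF P_normal P_1_comm P_1_pow])
  have Qp: "A [^]\<^bsub>Q\<^esub> p = \<one>\<^bsub>Q\<^esub>" if "A \<in> carrier Q" for A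
    using that unfolding Q_def by (intro elementary_abelian_quotient(2)[OF P_normal P_1_comm P_1_pow])
  obtain i where i: "i < d" "a ! i \<noteq> b ! i" using ne len by (metis nth_equalityI)
  define L where "L = take i gs @ drop (Suc i) gs"
  have Lc: "set L \<subseteq> carrier G"
    using gs_carrier set_take_subset[of i gs] set_drop_subset[of "Suc i" gs] unfolding L_def by auto
  have Lj: "gs ! j \<in> set L" if "j < d" "j \<noteq> i" for j
  proof (cases "j < i")
    case True
    then have "gs ! j = take i gs ! j" "j < length (take i gs)" using that by auto
    then have "gs ! j \<in> set (take i gs)" using nth_mem by metis
    then show ?thesis by (simp add: L_def)
  next
    case False
    then have "gs ! j = drop (Suc i) gs ! (j - Suc i)" "j - Suc i < length (drop (Suc i) gs)"
      using that by auto
    then have "gs ! j \<in> set (drop (Suc i) gs)" using nth_mem by metis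
    then show ?thesis by (simp add: L_def)
  qed
  define W where "W = generate Q (h ` set L)"
  have hLc: "h ` set L \<subseteq> carrier Q" using Lc by auto
  have Wsub: "subgroup W Q" unfolding W_def using hLc by (rule h.H.generate_is_subgroup)
  have gsi: "gs ! j \<in> carrier G" if "j < d" for j using gs_carrier that by auto
  have Wpow: "A [^]\<^bsub>Q\<^esub> (k::nat) \<in> W" if "A \<in> W" for A k
    using that Wsub by (induction k) (auto simp: subgroup.one_closed subgroup.m_closed)
  have rest: "mprod Q (map h gs) (c[i := 0]) \<in> W" if c: "length c = d" for c
  proof (rule h.H.mprod_mem[OF Wsub])
    fix j assume j: "j < length (map h gs)"
    show "map h gs ! j [^]\<^bsub>Q\<^esub> c[i := 0] ! j \<in> W"
    proof (cases "j = i")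
      case True
      then show ?thesis using c j subgroup.one_closed[OF Wsub] by simp
    next
      case False
      then have "h (gs ! j) \<in> W" unfolding W_def using Lj j by (intro generate.incl) auto
      then show ?thesis using False j Wpow by simp
    qed
  qed (use gs_carrier c in auto)
  have eq: "mprod Q (map h gs) a = mprod Q (map h gs) b"
    using e h.hom_mprod[OF gs_carrier] by (simp add: h_def)
  have hc: "set (map h gs) \<subseteq> carrier Q" using gs_carrier by auto
  have split: "mprod Q (map h gs) c = h (gs ! i) [^]\<^bsub>Q\<^esub> (c ! i) \<otimes>\<^bsub>Q\<^esub> mprod Q (map h gs) (c[i := 0])"
    if "length c = d" for c
    using Q.mprod_update_zero[OF hc, of c i] that i by simp
  have key: "h (gs ! i) \<in> W"
    if ab: "length a = d" "length b = d" "a ! i < b ! i" "b ! i < p"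
      "mprod Q (map h gs) a = mprod Q (map h gs) b" for a b
  proof -
    let ?g = "h (gs ! i)" and ?s = "mprod Q (map h gs) (a[i := 0])" and ?t = "mprod Q (map h gs) (b[i := 0])"
    define k where "k = b ! i - a ! i"
    have k: "0 < k" "k < p" "b ! i = a ! i + k" using ab by (auto simp: k_def)
    have g: "?g \<in> carrier Q" using gsi i by simp
    have st: "?s \<in> W" "?t \<in> W" using rest ab by auto
    then have stc: "?s \<in> carrier Q" "?t \<in> carrier Q" using Wsub subgroup.mem_carrier by metis+
    have "?g [^]\<^bsub>Q\<^esub> (a ! i) \<otimes>\<^bsub>Q\<^esub> ?s = ?g [^]\<^bsub>Q\<^esub> (a ! i) \<otimes>\<^bsub>Q\<^esub> (?g [^]\<^bsub>Q\<^esub> k \<otimes>\<^bsub>Q\<^esub> ?t)"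
      using ab(5) split[OF ab(1)] split[OF ab(2)] k(3) g stc by (simp add: h.H.nat_pow_mult[symmetric] h.H.m_assoc)
    then have "?s = ?g [^]\<^bsub>Q\<^esub> k \<otimes>\<^bsub>Q\<^esub> ?t" using g stc by simp
    then have "?g [^]\<^bsub>Q\<^esub> k = ?s \<otimes>\<^bsub>Q\<^esub> inv\<^bsub>Q\<^esub> ?t" using g stc by (simp add: h.H.m_assoc)
    then have gk: "?g [^]\<^bsub>Q\<^esub> k \<in> W" using st Wsub by (simp add: subgroup.m_closed subgroup.m_inv_closed)
    \<comment> \<open>Since \<open>k\<close> is invertible modulo \<open>p\<close> and
      \<open>Q\<close> has exponent \<open>p\<close>, the image of \<open>gs ! i\<close> is a power
      of its \<open>k\<close>-th power.\<close>
    have "coprime k p" using k p_prime by (metis coprime_commute nat_dvd_not_less prime_imp_coprime)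
    then obtain u v where uv: "k * u = p * v + 1"
      using bezout_nat[of k p] k by (metis coprime_imp_gcd_eq_1 less_numeral_extra(3) mult.commute)
    have "?g = ?g [^]\<^bsub>Q\<^esub> (p * v + 1)"
      using g Qp[OF g] by (simp add: h.H.nat_pow_pow[symmetric])
    also have "\<dots> = (?g [^]\<^bsub>Q\<^esub> k) [^]\<^bsub>Q\<^esub> u" using g uv by (simp add: h.H.nat_pow_pow)
    finally show ?thesis using Wpow[OF gk, of u] by simp
  qed
  have lt: "a ! i < p" "b ! i < p" using a b i by (auto simp: ibox_def subset_iff)
  have gi: "h (gs ! i) \<in> W"
    using key[of a b] key[of b a] len lt eq i(2) by (metis linorder_neqE_nat)
  have "h ` set gs \<subseteq> W"
  proof (intro image_subsetI)
    fix g assume "g \<in> set gs"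
    then obtain j where "j < d" "g = gs ! j" by (auto simp: in_set_conv_nth)
    then show "h g \<in> W" using gi Lj[of j] unfolding W_def by (cases "j = i") (auto intro: generate.incl)
  qed
  then have "generate Q (h ` set gs) \<subseteq> generate Q (h ` set L)"
    using h.H.generate_subgroup_incl[OF _ Wsub] W_def by simp
  then have incl: "h ` generate G (set gs) \<subseteq> h ` generate G (set L)"
    using h.generate_img[OF gs_carrier] h.generate_img[OF Lc] by simp
  have "top_generates G T (set L)"
  proof (rule frattini[OF Lc])
    fix x assume "x \<in> carrier G"
    then obtain s where "s \<in> generate G (set gs)" "h x = h s" using gs_gen h_def by auto
    then show "\<exists>s\<in>generate G (set L). P 1 #> x = P 1 #> s" using incl unfolding h_def by fastforce
  qed
  then have "d \<le> length L" using min_gs unfolding minimal_top_gens_def by blast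
  then show False using i unfolding L_def by simp
qed

sublocale B: pbasis G p P gs
proof unfold_locales
  show "card {P (Suc n) #> x | x. x \<in> P n} = p ^ d" for n
    unfolding layer_card rcosets_P_1 card_image[OF gs_inj_P1] card_ibox ..
qed (use gs_carrier gs_gen in auto)

end

subsection \<open>Representations of \<open>G/P\<^sub>n\<close> and nilpotence of the augmentation ideal\<close>

text \<open>The additive subgroup generated by \<open>S\<close>, reached by adding or subtracting
  one generator at a time. Integer coefficients suffice because sorting words in the b_i produces
  only integers.\<close>

inductive_set aspan :: "'b::ab_group_add set \<Rightarrow> 'b set" for S where
  zero: "0 \<in> aspan S"
| plus: "x \<in> S \<Longrightarrow> y \<in> aspan S \<Longrightarrow> y + x \<in> aspan S"
| minus: "x \<in> S \<Longrightarrow> y \<in> aspan S \<Longrightarrow> y - x \<in> aspan S"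

lemma aspan_base: "x \<in> S \<Longrightarrow> x \<in> aspan S"
  using aspan.plus[OF _ aspan.zero] by fastforce

lemma aspan_add: "y \<in> aspan S \<Longrightarrow> x \<in> aspan S \<Longrightarrow> x + y \<in> aspan S"
  by (induction rule: aspan.induct)
     (auto simp: add.assoc[symmetric] add_diff_eq intro: aspan.intros)

lemma aspan_minus: "y \<in> aspan S \<Longrightarrow> x \<in> aspan S \<Longrightarrow> x - y \<in> aspan S"
  by (induction rule: aspan.induct)
     (auto simp: diff_diff_add[symmetric] diff_diff_eq2 add_diff_eq diff_add_eq[symmetric] intro: aspan.intros)

lemma aspan_sum: "(\<And>i. i \<in> I \<Longrightarrow> f i \<in> aspan S) \<Longrightarrow> sum f I \<in> aspan S"
  by (induction I rule: infinite_finite_induct) (auto intro: aspan.zero aspan_add)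

lemma aspan_minimal: "x \<in> aspan S \<Longrightarrow> S \<subseteq> aspan S' \<Longrightarrow> x \<in> aspan S'"
  by (induction rule: aspan.induct) (auto intro: aspan.zero aspan_add aspan_minus)

lemma aspan_mono: "S \<subseteq> S' \<Longrightarrow> aspan S \<subseteq> aspan S'"
  using aspan_minimal aspan_base by blast

lemma aspan_mult_left:
  "y \<in> aspan S \<Longrightarrow> (\<And>x. x \<in> S \<Longrightarrow> c * x \<in> aspan S') \<Longrightarrow> c * y \<in> aspan S'" for c :: "'b::ring"
  by (induction rule: aspan.induct)
     (auto simp: distrib_left right_diff_distrib intro: aspan.zero aspan_add aspan_minus)

lemma aspan_mult_right:
  "y \<in> aspan S \<Longrightarrow> (\<And>x. x \<in> S \<Longrightarrow> x * c \<in> aspan S') \<Longrightarrow> y * c \<in> aspan S'" for c :: "'b::ring"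
  by (induction rule: aspan.induct)
     (auto simp: distrib_right left_diff_distrib intro: aspan.zero aspan_add aspan_minus)

lemma aspan_mult:
  fixes x :: "'b::ring"
  assumes "x \<in> aspan S" "y \<in> aspan S'" "\<And>a b. a \<in> S \<Longrightarrow> b \<in> S' \<Longrightarrow> a * b \<in> aspan S''"
  shows "x * y \<in> aspan S''"
  using assms by (meson aspan_mult_left aspan_mult_right)

lemma of_nat_commutes: "of_nat n * x = x * (of_nat n :: 'b::ring_1)"
  by (rule mult_of_nat_commute)

lemma of_nat_pow_commutes: "of_nat n ^ k * x = x * (of_nat n ^ k :: 'b::ring_1)"
  using mult_of_nat_commute[of "n ^ k" x] by simp

text \<open>The library's binomial theorem needs a commutative ring.\<close>
lemma one_plus_power:
  fixes b :: "'b::ring_1"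
  assumes "n < m" shows "(1 + b) ^ n = (\<Sum>k<m. of_nat (n choose k) * b ^ k)"
  using assms
proof (induction n arbitrary: m)
  case 0
  then obtain m' where m: "m = Suc m'" by (cases m) auto
  show ?case unfolding m by (subst sum.lessThan_Suc_shift) simp
next
  case (Suc n)
  then obtain m' where m: "m = Suc m'" "n < m'" by (cases m) auto
  have e: "(\<Sum>k<m'. of_nat (n choose Suc k) * b ^ Suc k) + 1 = (1 + b) ^ n"
    unfolding Suc.IH[of m, OF less_trans[OF m(2)], unfolded m(1), OF lessI]
    by (subst sum.lessThan_Suc_shift) simp
  have "(\<Sum>k<m. of_nat (Suc n choose k) * b ^ k) =
      1 + (\<Sum>k<m'. of_nat (n choose k) * b ^ Suc k + of_nat (n choose Suc k) * b ^ Suc k)"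
    unfolding m by (subst sum.lessThan_Suc_shift) (simp add: distrib_right)
  also have "\<dots> = (\<Sum>k<m'. of_nat (n choose k) * b ^ k) * b +
      ((\<Sum>k<m'. of_nat (n choose Suc k) * b ^ Suc k) + 1)"
    by (simp add: sum.distrib sum_distrib_right mult.assoc power_commutes)
  also have "\<dots> = (1 + b) ^ n * b + (1 + b) ^ n"
    unfolding e Suc.IH[OF m(2), symmetric] ..
  also have "\<dots> = (1 + b) ^ Suc n" by (simp add: power_Suc2 distrib_left del: power_Suc)
  finally show ?case by simp
qed

lemma one_plus_prime_power:
  fixes b :: "'b::ring_1"
  assumes p: "Factorial_Ring.prime (p::nat)"
  shows "(1 + b) ^ p = 1 + b ^ p + of_nat p * (\<Sum>k=1..<p. of_nat ((p choose k) div p) * b ^ k)"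
proof -
  have p0: "p > 0" using p by (simp add: prime_gt_0_nat)
  have "(1 + b) ^ p = (\<Sum>k<Suc p. of_nat (p choose k) * b ^ k)" by (rule one_plus_power) simp
  also have "\<dots> = (\<Sum>k<p. of_nat (p choose k) * b ^ k) + b ^ p" by simp
  also have "{..<p} = insert 0 {1..<p}" using p0 by auto
  also have "(\<Sum>k\<in>insert 0 {1..<p}. of_nat (p choose k) * b ^ k) = 1 + (\<Sum>k=1..<p. of_nat (p choose k) * b ^ k)"
    by (subst sum.insert) auto
  also have "(\<Sum>k=1..<p. of_nat (p choose k) * b ^ k) = (\<Sum>k=1..<p. of_nat p * (of_nat ((p choose k) div p) * b ^ k))"
  proof (rule sum.cong[OF refl])
    fix k assume "k \<in> {1..<p}"
    then have "p dvd p choose k" using p by (intro dvd_choose_prime) auto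
    then have "p choose k = p * ((p choose k) div p)" by simp
    then have "(of_nat (p choose k) :: 'b) = of_nat p * of_nat ((p choose k) div p)"
      by (metis of_nat_mult)
    then show "of_nat (p choose k) * b ^ k = of_nat p * (of_nat ((p choose k) div p) * b ^ k)"
      by (simp add: mult.assoc)
  qed
  finally show ?thesis by (simp add: sum_distrib_left add_ac)
qed

section \<open>Ordered monomials, sorted words and products of binomial coefficients\<close>

fun bprod :: "'b::monoid_mult list \<Rightarrow> nat list \<Rightarrow> 'b" where
  "bprod (x # xs) (a # as) = x ^ a * bprod xs as"
| "bprod _ _ = 1"

text \<open>The sorted word of an exponent vector, with letters counted from \<open>k\<close>. Words
  allow the factors in every order, exponent vectors describe the sorted order only.\<close>

fun wd :: "nat \<Rightarrow> nat list \<Rightarrow> nat list" where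
  "wd k [] = []"
| "wd k (a # as) = replicate a k @ wd (Suc k) as"

lemma prod_list_wd: "prod_list (map f (wd k as)) = bprod (map f [k..<k + length as]) as"
proof (induction as arbitrary: k)
  case (Cons a as)
  have "[k..<k + length (a # as)] = k # [Suc k..<Suc k + length as]" by (simp add: upt_rec)
  then show ?case using Cons[of "Suc k"] by (simp add: prod_list_replicate)
qed simp

lemma length_wd: "length (wd k as) = sum_list as"
  by (induction as arbitrary: k) auto

lemma set_wd: "set (wd k as) \<subseteq> {k..<k + length as}"
proof (induction as arbitrary: k)
  case (Cons a as)
  have "set (wd (Suc k) as) \<subseteq> {Suc k..<Suc k + length as}" by (rule Cons)
  then show ?case by fastforce
qed simp

lemma count_wd: "count (mset (wd k as)) i = (if k \<le> i \<and> i < k + length as then as ! (i - k) else 0)"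
proof (induction as arbitrary: k)
  case (Cons a as)
  show ?case using Cons[of "Suc k"]
    by (cases "i = k") (auto simp: nth_Cons' Suc_le_eq)
qed simp

lemma mset_wd_add:
  "length as = length bs \<Longrightarrow> mset (wd k (map2 (+) as bs)) = mset (wd k as) + mset (wd k bs)"
  by (rule multiset_eqI) (auto simp: count_wd)

lemma mset_wd_count:
  assumes "set xs \<subseteq> {..<n}"
  shows "mset (wd 0 (map (count (mset xs)) [0..<n])) = mset xs"
proof (rule multiset_eqI)
  fix i show "count (mset (wd 0 (map (count (mset xs)) [0..<n]))) i = count (mset xs) i"
    using assms by (auto simp: count_wd not_in_iff[symmetric] subset_iff count_eq_zero_iff)
qed

definition mbinom :: "nat list \<Rightarrow> nat list \<Rightarrow> nat" where
  "mbinom a c = prod_list (map2 (choose) a c)"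

lemma ibox_Suc: "ibox (Suc d) m = (\<lambda>(x, xs). x # xs) ` ({..<m} \<times> ibox d m)"
proof (intro equalityI subsetI)
  fix a assume "a \<in> ibox (Suc d) m"
  then show "a \<in> (\<lambda>(x, xs). x # xs) ` ({..<m} \<times> ibox d m)" by (cases a) (auto simp: ibox_def)
qed (auto simp: ibox_def)

lemma bprod_binomial:
  fixes bs :: "'b::ring_1 list"
  assumes "a \<in> ibox (length bs) m"
  shows "bprod (map (\<lambda>b. 1 + b) bs) a = (\<Sum>c\<in>ibox (length bs) m. of_nat (mbinom a c) * bprod bs c)"
  using assms
proof (induction bs arbitrary: a)
  case Nil
  then have "ibox (length []) m = {[]}" "a = []" by (auto simp: ibox_def)
  then show ?case by (simp add: mbinom_def)
next
  case (Cons b bs)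
  then obtain x a' where a: "a = x # a'" "x < m" "a' \<in> ibox (length bs) m"
    by (cases a) (auto simp: ibox_def)
  have inj: "inj_on (\<lambda>(x, xs). x # xs) ({..<m} \<times> ibox (length bs) m)" by (auto simp: inj_on_def)
  have "bprod (map (\<lambda>b. 1 + b) (b # bs)) a =
      (\<Sum>k<m. of_nat (x choose k) * b ^ k) * (\<Sum>c\<in>ibox (length bs) m. of_nat (mbinom a' c) * bprod bs c)"
    unfolding a by (simp add: one_plus_power[OF a(2)] Cons.IH[OF a(3)])
  also have "\<dots> = (\<Sum>k<m. \<Sum>c\<in>ibox (length bs) m.
      (of_nat (x choose k) * b ^ k) * (of_nat (mbinom a' c) * bprod bs c))"
    by (rule sum_product)
  also have "\<dots> = (\<Sum>k<m. \<Sum>c\<in>ibox (length bs) m. of_nat (mbinom a (k # c)) * bprod (b # bs) (k # c))"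
  proof (intro sum.cong refl)
    fix k c
    have "(of_nat (x choose k) * b ^ k) * (of_nat (mbinom a' c) * bprod bs c) =
      of_nat (x choose k) * (b ^ k * of_nat (mbinom a' c)) * bprod bs c" by (simp add: mult.assoc)
    also have "b ^ k * of_nat (mbinom a' c) = of_nat (mbinom a' c) * b ^ k"
      by (rule of_nat_commutes[symmetric])
    finally show "(of_nat (x choose k) * b ^ k) * (of_nat (mbinom a' c) * bprod bs c) =
      of_nat (mbinom a (k # c)) * bprod (b # bs) (k # c)" unfolding a by (simp add: mbinom_def mult.assoc)
  qed
  also have "\<dots> = (\<Sum>c\<in>ibox (length (b # bs)) m. of_nat (mbinom a c) * bprod (b # bs) c)"
    unfolding ibox_Suc length_Cons sum.reindex[OF inj] sum.cartesian_product
    by (simp only: o_def case_prod_unfold)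
  finally show ?case .
qed

text \<open>Nilpotence and sorting are computations with the images of group elements in a ring. An
  abstract target keeps cosets out of them; the translation operators \<open>opP n\<close> are the
  instance used later.\<close>

locale group_rep = uniform_group_loc +
  fixes u :: "'a \<Rightarrow> 'b::ring_1" and n :: nat
  assumes u_mult: "x \<in> carrier G \<Longrightarrow> y \<in> carrier G \<Longrightarrow> u (x \<otimes> y) = u x * u y"
    and u_one: "u \<one> = 1"
    and u_kill: "x \<in> P n \<Longrightarrow> u x = 1"
begin

lemma u_pow: "x \<in> carrier G \<Longrightarrow> u (x [^] (k::nat)) = u x ^ k"
proof (induction k)
  case (Suc k)
  have "u (x [^] Suc k) = u x ^ k * u x" using Suc by (simp add: u_mult)
  then show ?case by (simp add: power_commutes)
qed (simp add: u_one)

lemma u_cong: "x \<in> carrier G \<Longrightarrow> y \<in> carrier G \<Longrightarrow> P n #> x = P n #> y \<Longrightarrow> u x = u y"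
proof -
  assume x: "x \<in> carrier G" and y: "y \<in> carrier G" and e: "P n #> x = P n #> y"
  then have "u (x \<otimes> inv y) = 1" using S.cs_iff u_kill by simp
  then have "u ((x \<otimes> inv y) \<otimes> y) = u y" using x y by (subst u_mult) auto
  then show "u x = u y" using x y by (simp add: m_assoc)
qed

text \<open>The image of the integral group ring.\<close>

definition R0 :: "'b set" where "R0 = aspan (u ` carrier G)"

lemma R0_u: "x \<in> carrier G \<Longrightarrow> u x \<in> R0" unfolding R0_def by (auto intro: aspan_base)

lemma R0_add: "x \<in> R0 \<Longrightarrow> y \<in> R0 \<Longrightarrow> x + y \<in> R0" unfolding R0_def by (rule aspan_add)
lemma R0_minus: "x \<in> R0 \<Longrightarrow> y \<in> R0 \<Longrightarrow> x - y \<in> R0" unfolding R0_def by (rule aspan_minus)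
lemma R0_one: "1 \<in> R0" using R0_u[of \<one>] by (simp add: u_one)

lemma R0_mult: "x \<in> R0 \<Longrightarrow> y \<in> R0 \<Longrightarrow> x * y \<in> R0" unfolding R0_def
proof (rule aspan_mult)
  fix a b assume "a \<in> u ` carrier G" "b \<in> u ` carrier G"
  then obtain x y where "x \<in> carrier G" "y \<in> carrier G" "a = u x" "b = u y" by auto
  then have "a * b = u (x \<otimes> y)" "x \<otimes> y \<in> carrier G" by (auto simp: u_mult)
  then show "a * b \<in> aspan (u ` carrier G)" by (auto intro: aspan_base)
qed

lemma R0_pow: "x \<in> R0 \<Longrightarrow> x ^ k \<in> R0"
  by (induction k) (auto simp: R0_one R0_mult)

lemma R0_of_nat: "of_nat k \<in> R0"
proof (induction k)
  case 0 show ?case unfolding R0_def by (simp add: aspan.zero)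
next
  case (Suc k) then show ?case by (simp add: R0_one R0_add)
qed

text \<open>The ideal of \<open>R0\<close> generated by \<open>p\<close> and the augmentation ideal of \<open>N\<close>.\<close>
definition Kid :: "'a set \<Rightarrow> 'b set" where
  "Kid N = aspan ({u x * (u y - 1) | x y. x \<in> carrier G \<and> y \<in> N} \<union> {of_nat p * u x | x. x \<in> carrier G})"

lemma Kid_add: "x \<in> Kid N \<Longrightarrow> y \<in> Kid N \<Longrightarrow> x + y \<in> Kid N" unfolding Kid_def by (rule aspan_add)
lemma Kid_minus: "x \<in> Kid N \<Longrightarrow> y \<in> Kid N \<Longrightarrow> x - y \<in> Kid N" unfolding Kid_def by (rule aspan_minus)
lemma Kid_gen: "x \<in> carrier G \<Longrightarrow> y \<in> N \<Longrightarrow> u x * (u y - 1) \<in> Kid N"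
  unfolding Kid_def by (intro aspan_base) blast

lemma Kid_p: "x \<in> carrier G \<Longrightarrow> of_nat p * u x \<in> Kid N"
  unfolding Kid_def by (intro aspan_base) blast

lemma Kid_lmult:
  assumes r: "r \<in> R0" and k: "k \<in> Kid N" shows "r * k \<in> Kid N"
  using r[unfolded R0_def] k[unfolded Kid_def] unfolding Kid_def
proof (rule aspan_mult, fold Kid_def)
  fix a b assume "a \<in> u ` carrier G" and b: "b \<in> {u x * (u y - 1) | x y. x \<in> carrier G \<and> y \<in> N} \<union> {of_nat p * u x | x. x \<in> carrier G}"
  then obtain w where w: "w \<in> carrier G" "a = u w" by auto
  from b consider x y where "x \<in> carrier G" "y \<in> N" "b = u x * (u y - 1)" | x where "x \<in> carrier G" "b = of_nat p * u x"
    by blast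
  then show "a * b \<in> Kid N"
  proof cases
    case 1
    then have "a * b = u (w \<otimes> x) * (u y - 1)" using w by (simp add: u_mult mult.assoc)
    then show ?thesis using 1 w by (simp add: Kid_gen)
  next
    case 2
    then have "a * b = of_nat p * u (w \<otimes> x)"
      using w by (simp add: u_mult mult.assoc[symmetric] of_nat_commutes[of p "u w"])
    then show ?thesis using 2 w by (simp add: Kid_p)
  qed
qed

lemma Kid_rmult:
  assumes N: "N \<lhd> G" and r: "r \<in> R0" and k: "k \<in> Kid N" shows "k * r \<in> Kid N"
  using k[unfolded Kid_def] r[unfolded R0_def] unfolding Kid_def
proof (rule aspan_mult, fold Kid_def)
  fix a b assume "a \<in> u ` carrier G" and b: "b \<in> {u x * (u y - 1) | x y. x \<in> carrier G \<and> y \<in> N} \<union> {of_nat p * u x | x. x \<in> carrier G}"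
  then obtain w where w: "w \<in> carrier G" "a = u w" by auto
  from b consider x y where "x \<in> carrier G" "y \<in> N" "b = u x * (u y - 1)" | x where "x \<in> carrier G" "b = of_nat p * u x"
    by blast
  then show "b * a \<in> Kid N"
  proof cases
    case 1
    have y: "y \<in> carrier G" using 1 N normal_imp_subgroup subgroup.mem_carrier by metis
    have yw: "inv w \<otimes> y \<otimes> w \<in> N" using N 1 w by (simp add: normal.inv_op_closed1)
    have "u (x \<otimes> w) * (u (inv w \<otimes> y \<otimes> w) - 1) = u ((x \<otimes> w) \<otimes> (inv w \<otimes> y \<otimes> w)) - u (x \<otimes> w)"
      using 1 w y by (simp add: u_mult right_diff_distrib)
    also have "(x \<otimes> w) \<otimes> (inv w \<otimes> y \<otimes> w) = x \<otimes> y \<otimes> w" using 1 w y by (simp add: m_assoc)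
    also have "u (x \<otimes> y \<otimes> w) - u (x \<otimes> w) = b * a"
      using 1 w y by (simp add: u_mult left_diff_distrib right_diff_distrib)
    finally show ?thesis using 1 w yw by (metis Kid_gen m_closed)
  next
    case 2
    then have "b * a = of_nat p * u (x \<otimes> w)" using w by (simp add: u_mult mult.assoc)
    then show ?thesis using 2 w by (simp add: Kid_p)
  qed
qed

lemma Kid_R0:
  assumes "N \<subseteq> carrier G" "k \<in> Kid N" shows "k \<in> R0"
  using assms(2) unfolding Kid_def R0_def
proof (rule aspan_minimal, fold R0_def)
  show "{u x * (u y - 1) | x y. x \<in> carrier G \<and> y \<in> N} \<union> {of_nat p * u x | x. x \<in> carrier G} \<subseteq> R0"
    using assms(1) by (auto intro!: R0_mult R0_minus R0_u R0_one R0_of_nat)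
qed

text \<open>Put \<open>t = u z - 1\<close>. Modulo \<open>Kid N\<close> it commutes with
  \<open>R0\<close>, and \<open>Kid M\<close> is contained in \<open>Kid N\<close> +
  \<open>R0\<close> t, so a product of \<open>p\<close> elements of \<open>Kid M\<close> lies in
  \<open>Kid N\<close> + \<open>R0\<close> t^p. Modulo \<open>p\<close>, t^p is the image of
  \<open>z [^] p\<close> minus 1, and \<open>z [^] p\<close> lies in \<open>N\<close>.\<close>

lemma Kid_central_step:
  assumes N: "N \<lhd> G" and z: "z \<in> carrier G" "z [^] p \<in> N"
    and cen: "\<And>x. x \<in> carrier G \<Longrightarrow> N #> (x \<otimes> z) = N #> (z \<otimes> x)"
    and M: "M = {x \<in> carrier G. \<exists>j::nat. N #> x = N #> (z [^] j)}"
    and xs: "length xs = p" "set xs \<subseteq> Kid M"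
  shows "prod_list xs \<in> Kid N"
proof -
  interpret N: normal N G by (rule N)
  define t where "t = u z - 1"
  have tR: "t \<in> R0" unfolding t_def using z by (intro R0_minus R0_u R0_one)
  have lm: "r * k \<in> Kid N" if "r \<in> R0" "k \<in> Kid N" for r k using that by (rule Kid_lmult)
  have rm: "k * r \<in> Kid N" if "r \<in> R0" "k \<in> Kid N" for r k using N that by (rule Kid_rmult)
  have KR: "k \<in> R0" if "k \<in> Kid N" for k using Kid_R0[OF N.subset that] .
  have uN: "u y * u w - u w \<in> Kid N" if "y \<in> N" "w \<in> carrier G" for y w
  proof -
    have "u \<one> * (u y - 1) * u w \<in> Kid N" using that by (intro rm Kid_gen R0_u) auto
    then show ?thesis by (simp add: u_one left_diff_distrib)
  qed
  have com: "t * r - r * t \<in> Kid N" if "r \<in> R0" for r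
    using that unfolding R0_def
  proof (induction rule: aspan.induct)
    case zero then show ?case unfolding Kid_def by (auto intro: aspan.zero)
  next
    have *: "t * x - x * t \<in> Kid N" if x: "x \<in> u ` carrier G" for x
    proof -
      obtain w where w: "w \<in> carrier G" "x = u w" using x by auto
      define y where "y = (z \<otimes> w) \<otimes> inv (w \<otimes> z)"
      have "y \<in> N" using cen[OF w(1)] w z N.coset_eq_iff[of "z \<otimes> w" "w \<otimes> z"] by (simp add: y_def)
      have "t * x - x * t = u z * u w - u w * u z" by (simp add: t_def w algebra_simps)
      also have "\<dots> = u (z \<otimes> w) - u (w \<otimes> z)" using z w by (simp add: u_mult)
      also have "z \<otimes> w = y \<otimes> (w \<otimes> z)" using z w by (simp add: y_def m_assoc)
      also have "u (y \<otimes> (w \<otimes> z)) - u (w \<otimes> z) = u y * u (w \<otimes> z) - u (w \<otimes> z)"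
        using z w \<open>y \<in> N\<close> N.mem_carrier by (simp add: u_mult)
      finally show ?thesis using uN[OF \<open>y \<in> N\<close>, of "w \<otimes> z"] z w by simp
    qed
    { case (plus x y)
      have "t * (y + x) - (y + x) * t = (t * y - y * t) + (t * x - x * t)" by (simp add: algebra_simps)
      then show ?case using plus *[OF plus(1)] by (simp add: Kid_add) }
    { case (minus x y)
      have "t * (y - x) - (y - x) * t = (t * y - y * t) - (t * x - x * t)" by (simp add: algebra_simps)
      then show ?case using minus *[OF minus(1)] by (simp add: Kid_minus) }
  qed
  have Mdec: "\<exists>k\<in>Kid N. \<exists>r\<in>R0. v = k + r * t" if "v \<in> Kid M" for v
    using that unfolding Kid_def[of M]
  proof (induction rule: aspan.induct)
    case zero
    show ?case by (rule bexI[of _ 0], rule bexI[of _ 0]) (auto simp: Kid_def R0_def intro: aspan.zero)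
  next
    have *: "\<exists>k\<in>Kid N. \<exists>r\<in>R0. v = k + r * t"
      if "v \<in> {u x * (u y - 1) | x y. x \<in> carrier G \<and> y \<in> M} \<union> {of_nat p * u x | x. x \<in> carrier G}" for v
    proof -
      from that consider x y where "x \<in> carrier G" "y \<in> M" "v = u x * (u y - 1)" | x where "x \<in> carrier G" "v = of_nat p * u x"
        by blast
      then show ?thesis
      proof cases
        case 1
        then obtain j :: nat where j: "y \<in> carrier G" "N #> y = N #> (z [^] j)" using M by auto
        define w where "w = y \<otimes> inv (z [^] j)"
        have w: "w \<in> N" using j z N.coset_eq_iff by (simp add: w_def)
        have y: "u y = u w * u (z [^] j)"
          using j z w N.mem_carrier by (subst u_mult[symmetric]) (auto simp: w_def m_assoc)
        have "\<exists>r\<in>R0. u z ^ j - 1 = r * t"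
        proof (induction j)
          case 0 show ?case by (rule bexI[of _ 0]) (auto simp: R0_def intro: aspan.zero)
        next
          case (Suc j)
          then obtain r where r: "r \<in> R0" "u z ^ j - 1 = r * t" by blast
          have "u z ^ Suc j - 1 = u z * (u z ^ j - 1) + t" by (simp add: t_def algebra_simps)
          also have "\<dots> = (u z * r + 1) * t" using r by (simp add: algebra_simps)
          finally show ?case using r z by (intro bexI[of _ "u z * r + 1"]) (auto intro!: R0_add R0_mult R0_u R0_one)
        qed
        then obtain r where r: "r \<in> R0" "u z ^ j - 1 = r * t" by blast
        have "v = u x * (u w * u (z [^] j) - u (z [^] j)) + (u x * r) * t"
          using r(2) 1 y z by (simp add: u_pow algebra_simps)
        moreover have "u x * (u w * u (z [^] j) - u (z [^] j)) \<in> Kid N"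
          using w z 1 by (intro lm uN R0_u) auto
        ultimately show ?thesis using 1 r by (blast intro: R0_mult R0_u)
      next
        case 2
        then show ?thesis using Kid_p[of x N]
          by (intro bexI[of _ v] bexI[of _ 0]) (auto simp: R0_def intro: aspan.zero)
      qed
    qed
    { case (plus x y)
      then obtain k r k' r' where "k \<in> Kid N" "r \<in> R0" "y = k + r * t" "k' \<in> Kid N" "r' \<in> R0" "x = k' + r' * t"
        using *[OF plus(1)] by blast
      then show ?case by (intro bexI[of _ "k + k'"] bexI[of _ "r + r'"]) (auto simp: algebra_simps Kid_add R0_add) }
    { case (minus x y)
      then obtain k r k' r' where "k \<in> Kid N" "r \<in> R0" "y = k + r * t" "k' \<in> Kid N" "r' \<in> R0" "x = k' + r' * t"
        using *[OF minus(1)] by blast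
      then show ?case by (intro bexI[of _ "k - k'"] bexI[of _ "r - r'"]) (auto simp: algebra_simps Kid_minus R0_minus) }
  qed
  have prd: "\<exists>k\<in>Kid N. \<exists>r\<in>R0. prod_list ys = k + r * t ^ length ys" if "set ys \<subseteq> Kid M" for ys
    using that
  proof (induction ys)
    case Nil
    show ?case by (rule bexI[of _ 0], rule bexI[of _ 1]) (auto simp: Kid_def R0_one intro: aspan.zero)
  next
    case (Cons y ys)
    then obtain k' r' where kr': "k' \<in> Kid N" "r' \<in> R0" "prod_list ys = k' + r' * t ^ length ys" by auto
    obtain k r where kr: "k \<in> Kid N" "r \<in> R0" "y = k + r * t" using Mdec[of y] Cons.prems by auto
    let ?l = "length ys"
    have "prod_list (y # ys) = (k + r * t) * (k' + r' * t ^ ?l)" using kr kr' by simp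
    also have "\<dots> = (k * (k' + r' * t ^ ?l) + r * (t * k') + r * ((t * r' - r' * t) * t ^ ?l)) + (r * r') * t ^ Suc ?l"
      by (simp add: algebra_simps)
    finally have "prod_list (y # ys) = (k * (k' + r' * t ^ ?l) + r * (t * k') + r * ((t * r' - r' * t) * t ^ ?l)) + (r * r') * t ^ Suc ?l" .
    moreover have "k * (k' + r' * t ^ ?l) + r * (t * k') + r * ((t * r' - r' * t) * t ^ ?l) \<in> Kid N"
    proof (intro Kid_add)
      have "k' + r' * t ^ ?l \<in> R0" using kr' tR by (intro R0_add R0_mult R0_pow KR[OF kr'(1)])
      then show "k * (k' + r' * t ^ ?l) \<in> Kid N" using kr(1) by (rule rm)
      show "r * (t * k') \<in> Kid N" by (rule lm[OF kr(2) lm[OF tR kr'(1)]])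
      show "r * ((t * r' - r' * t) * t ^ ?l) \<in> Kid N"
        by (rule lm[OF kr(2) rm[OF R0_pow[OF tR] com[OF kr'(2)]]])
    qed
    moreover have "r * r' \<in> R0" using kr kr' by (intro R0_mult)
    ultimately show ?case by (metis length_Cons)
  qed
  have tp: "t ^ p \<in> Kid N"
  proof -
    define s where "s = (\<Sum>k=1..<p. of_nat ((p choose k) div p) * t ^ k)"
    have "s \<in> R0" unfolding s_def R0_def
      by (rule aspan_sum, fold R0_def) (intro R0_mult R0_of_nat R0_pow tR)
    have "u (z [^] p) = 1 + t ^ p + of_nat p * s"
      using one_plus_prime_power[OF p_prime, of t] z by (simp add: u_pow t_def s_def)
    then have "t ^ p = u \<one> * (u (z [^] p) - 1) - (of_nat p * u \<one>) * s" by (simp add: u_one)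
    moreover have "u \<one> * (u (z [^] p) - 1) - (of_nat p * u \<one>) * s \<in> Kid N"
      using z \<open>s \<in> R0\<close> by (intro Kid_minus Kid_gen rm Kid_p) auto
    ultimately show ?thesis by simp
  qed
  obtain k r where "k \<in> Kid N" "r \<in> R0" "prod_list xs = k + r * t ^ p" using prd[OF xs(2)] xs(1) by auto
  then show ?thesis using tp lm by (simp add: Kid_add)
qed

lemma prod_list_concat_blocks:
  assumes "\<And>ys. length ys = m \<Longrightarrow> set ys \<subseteq> A \<Longrightarrow> prod_list ys \<in> (B :: 'b set)"
    and "length xs = k * m" "set xs \<subseteq> A"
  shows "\<exists>zs. length zs = k \<and> set zs \<subseteq> B \<and> prod_list xs = prod_list zs"
  using assms(2,3)
proof (induction k arbitrary: xs)
  case (Suc k)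
  have sub: "set (take m xs) \<subseteq> A" "set (drop m xs) \<subseteq> A"
    using Suc.prems set_take_subset[of m xs] set_drop_subset[of m xs] by auto
  obtain zs where zs: "length zs = k" "set zs \<subseteq> B" "prod_list (drop m xs) = prod_list zs"
    using Suc.IH[of "drop m xs"] Suc.prems sub by auto
  have "prod_list (take m xs) \<in> B" using assms(1)[of "take m xs"] Suc.prems sub by simp
  moreover have "prod_list xs = prod_list (take m xs) * prod_list (drop m xs)"
    by (metis append_take_drop_id prod_list.append)
  ultimately show ?case using zs by (intro exI[of _ "prod_list (take m xs) # zs"]) auto
qed auto

definition Aug :: "'b set" where "Aug = {u x - 1 | x. x \<in> carrier G}"

text \<open>Grouping the factors into \<open>p\<close> blocks, each central step multiplies the
  required length by \<open>p\<close>.\<close>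

lemma augmentation_power_Kid:
  "open_normal G T N \<Longrightarrow> \<exists>m. \<forall>xs. length xs = m \<longrightarrow> set xs \<subseteq> Aug \<longrightarrow> prod_list xs \<in> Kid N"
proof (induction rule: open_normal_central_induct)
  case carrier
  have "prod_list xs \<in> Kid (carrier G)" if xs: "length xs = 1" "set xs \<subseteq> Aug" for xs
  proof -
    obtain x where x: "xs = [x]" using xs(1) by (metis One_nat_def length_0_conv length_Suc_conv)
    then obtain w where "w \<in> carrier G" "x = u w - 1" using xs(2) by (auto simp: Aug_def)
    then show ?thesis using x Kid_gen[of \<one> w "carrier G"] by (simp add: u_one)
  qed
  then show ?case by blast
next
  case (step N M z)
  then obtain m where m: "\<And>ys. length ys = m \<Longrightarrow> set ys \<subseteq> Aug \<Longrightarrow> prod_list ys \<in> Kid M" by blast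
  have "prod_list xs \<in> Kid N" if xs: "length xs = p * m" "set xs \<subseteq> Aug" for xs
  proof -
    obtain zs where zs: "length zs = p" "set zs \<subseteq> Kid M" "prod_list xs = prod_list zs"
      using prod_list_concat_blocks[of m Aug "Kid M", OF m xs] by auto
    show ?thesis unfolding zs(3)
      using open_normalD(1)[OF step(1)] step(3-6) zs(1,2) by (rule Kid_central_step)
  qed
  then show ?case by blast
qed

text \<open>For \<open>N = P n\<close> the augmentation part of \<open>Kid N\<close> is zero because
  \<open>u\<close> is trivial on \<open>P n\<close>; only multiples of \<open>p\<close>
  remain.\<close>

lemma augmentation_nilpotent:
  "\<exists>m. \<forall>xs. length xs = m \<longrightarrow> set xs \<subseteq> Aug \<longrightarrow> (\<exists>y. prod_list xs = of_nat p * y)"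
proof -
  have "\<exists>y. k = of_nat p * y" if "k \<in> Kid (P n)" for k
    using that unfolding Kid_def
  proof (induction rule: aspan.induct)
    case zero show ?case by (rule exI[of _ 0]) simp
  next
    have *: "\<exists>y. v = of_nat p * y"
      if "v \<in> {u x * (u y - 1) | x y. x \<in> carrier G \<and> y \<in> P n} \<union> {of_nat p * u x | x. x \<in> carrier G}" for v
      using that u_kill by (auto intro: exI[of _ 0])
    { case (plus x y)
      then obtain a b where "y = of_nat p * a" "x = of_nat p * b" using *[OF plus(1)] by blast
      then show ?case by (intro exI[of _ "a + b"]) (simp add: distrib_left) }
    { case (minus x y)
      then obtain a b where "y = of_nat p * a" "x = of_nat p * b" using *[OF minus(1)] by blast
      then show ?case by (intro exI[of _ "a - b"]) (simp add: right_diff_distrib) }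
  qed
  then show ?thesis using augmentation_power_Kid[OF P_open_normal[of n]] by blast
qed

lemma augmentation_power_p_power:
  "\<exists>m. \<forall>k xs. m * k \<le> length xs \<longrightarrow> set xs \<subseteq> Aug \<longrightarrow> (\<exists>y. prod_list xs = of_nat p ^ k * y)"
proof -
  obtain m where m: "\<And>xs. length xs = m \<Longrightarrow> set xs \<subseteq> Aug \<Longrightarrow> \<exists>y. prod_list xs = of_nat p * y"
    using augmentation_nilpotent by blast
  have "\<exists>y. prod_list xs = of_nat p ^ k * y" if "m * k \<le> length xs" "set xs \<subseteq> Aug" for k xs
    using that
  proof (induction k arbitrary: xs)
    case (Suc k)
    have sub: "set (take m xs) \<subseteq> Aug" "set (drop m xs) \<subseteq> Aug"
      using Suc.prems set_take_subset[of m xs] set_drop_subset[of m xs] by auto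
    obtain y where y: "prod_list (take m xs) = of_nat p * y" using m[of "take m xs"] Suc.prems sub by auto
    obtain y' where y': "prod_list (drop m xs) = of_nat p ^ k * y'" using Suc.IH[of "drop m xs"] Suc.prems sub by fastforce
    have "prod_list xs = prod_list (take m xs) * prod_list (drop m xs)"
      by (metis append_take_drop_id prod_list.append)
    also have "\<dots> = of_nat p * (y * of_nat p ^ k) * y'" unfolding y y' by (simp add: mult.assoc)
    also have "y * of_nat p ^ k = of_nat p ^ k * y" by (rule of_nat_pow_commutes[symmetric])
    finally show ?case by (intro exI[of _ "y * y'"]) (simp add: mult.assoc)
  qed simp
  then show ?thesis by blast
qed

end

subsection \<open>Sorting words in the \<open>b\<^sub>i\<close>\<close>

context group_rep begin

definition bvars :: "'b list" where "bvars = map (\<lambda>g. u g - 1) gs"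
definition W :: "nat list \<Rightarrow> 'b" where "W xs = prod_list (map (\<lambda>i. u (gs ! i) - 1) xs)"

text \<open>\<open>U D\<close> is the part of weighted degree at least \<open>D\<close> of the subring generated by the
  \<open>b\<^sub>i\<close>, with \<open>b\<^sub>i\<close> in degree 1 and \<open>p\<close> in degree 2; \<open>F D\<close> is spanned by the ordered monomials only.\<close>
definition U :: "nat \<Rightarrow> 'b set" where
  "U D = aspan {of_nat p ^ a * W xs | a xs. set xs \<subseteq> {..<d} \<and> D \<le> 2 * a + length xs}"
definition F :: "nat \<Rightarrow> 'b set" where
  "F D = aspan {of_nat p ^ a * bprod bvars c | a c. length c = d \<and> D \<le> 2 * a + sum_list c}"

lemma W_simps [simp]: "W [] = 1" "W (x # xs) = (u (gs ! x) - 1) * W xs" "W (xs @ ys) = W xs * W ys"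
  by (simp_all add: W_def)

lemma W_wd: "length c = d \<Longrightarrow> W (wd 0 c) = bprod bvars c"
proof -
  assume "length c = d"
  moreover have "map (\<lambda>i. u (gs ! i) - 1) [0..<d] = bvars"
    unfolding bvars_def by (rule nth_equalityI) auto
  ultimately show ?thesis unfolding W_def by (simp add: prod_list_wd)
qed

lemma length_bvars [simp]: "length bvars = d" by (simp add: bvars_def)

lemma U_gen: "set xs \<subseteq> {..<d} \<Longrightarrow> D \<le> 2 * a + length xs \<Longrightarrow> of_nat p ^ a * W xs \<in> U D"
  unfolding U_def by (intro aspan_base) blast

lemma U_W: "set xs \<subseteq> {..<d} \<Longrightarrow> D \<le> length xs \<Longrightarrow> W xs \<in> U D"
  using U_gen[of xs D 0] by simp

lemma U_mono: "D \<le> E \<Longrightarrow> U E \<subseteq> U D" unfolding U_def by (rule aspan_mono) (blast intro: le_trans)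
lemma F_mono: "D \<le> E \<Longrightarrow> F E \<subseteq> F D" unfolding F_def by (rule aspan_mono) (blast intro: le_trans)

lemma U_add: "x \<in> U D \<Longrightarrow> y \<in> U D \<Longrightarrow> x + y \<in> U D" unfolding U_def by (rule aspan_add)
lemma U_minus: "x \<in> U D \<Longrightarrow> y \<in> U D \<Longrightarrow> x - y \<in> U D" unfolding U_def by (rule aspan_minus)
lemma U_zero: "0 \<in> U D" unfolding U_def by (rule aspan.zero)
lemma U_sum: "(\<And>i. i \<in> I \<Longrightarrow> f i \<in> U D) \<Longrightarrow> sum f I \<in> U D" unfolding U_def by (rule aspan_sum)

lemma U_mult:
  assumes "x \<in> U D" "y \<in> U E" shows "x * y \<in> U (D + E)"
  using assms unfolding U_def
proof (rule aspan_mult, fold U_def)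
  fix v w assume "v \<in> {of_nat p ^ a * W xs | a xs. set xs \<subseteq> {..<d} \<and> D \<le> 2 * a + length xs}"
    and "w \<in> {of_nat p ^ a * W xs | a xs. set xs \<subseteq> {..<d} \<and> E \<le> 2 * a + length xs}"
  then obtain a xs b ys where *: "set xs \<subseteq> {..<d}" "D \<le> 2 * a + length xs" "v = of_nat p ^ a * W xs"
    "set ys \<subseteq> {..<d}" "E \<le> 2 * b + length ys" "w = of_nat p ^ b * W ys" by blast
  have "v * w = of_nat p ^ a * (W xs * of_nat p ^ b) * W ys" using * by (simp add: mult.assoc)
  also have "W xs * of_nat p ^ b = of_nat p ^ b * W xs" by (rule of_nat_pow_commutes[symmetric])
  finally have "v * w = of_nat p ^ (a + b) * W (xs @ ys)" by (simp add: mult.assoc power_add)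
  moreover have "of_nat p ^ (a + b) * W (xs @ ys) \<in> U (D + E)" using * by (intro U_gen) auto
  ultimately show "v * w \<in> U (D + E)" by (simp only:)
qed

lemma U_mult_mono: "x \<in> U D \<Longrightarrow> y \<in> U E \<Longrightarrow> K \<le> D + E \<Longrightarrow> x * y \<in> U K"
  using U_mult U_mono by blast

lemma U_one: "1 \<in> U 0" using U_W[of "[]" 0] by simp

lemma U_p: "of_nat p \<in> U 2" using U_gen[of "[]" 2 1] by simp

lemma U_of_nat: "of_nat k \<in> U 0" by (induction k) (auto simp: U_zero U_one U_add)

lemma U_b: "i < d \<Longrightarrow> u (gs ! i) - 1 \<in> U 1" using U_W[of "[i]" 1] by simp

lemma U_pow: "x \<in> U D \<Longrightarrow> x ^ k \<in> U (D * k)"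
proof (induction k)
  case (Suc k) then show ?case using U_mult[of x D "x ^ k" "D * k"] by simp
qed (simp add: U_one)

lemma U_g: "i < d \<Longrightarrow> u (gs ! i) \<in> U 0"
  using U_add[of "u (gs ! i) - 1" 0 1] U_b[of i] U_mono[of 0 1] U_one by auto

lemma U_g_pow: "i < d \<Longrightarrow> u (gs ! i) ^ k \<in> U 0"
  using U_pow[OF U_g, of i k] by simp

text \<open>Chosen so that \<open>P tw\<close> contains all commutators of \<open>G\<close>.\<close>

definition tw :: nat where "tw = (if p = 2 then 2 else 1)"

text \<open>This is where \<open>G/\<close>closure\<open>(G\<^sup>4)\<close> being abelian is needed for \<open>p = 2\<close>: the square of \<open>1 + b\<close>
  only agrees with 1 up to degree 2.\<close>
lemma U_g_p_pow: "i < d \<Longrightarrow> u (gs ! i) ^ (p ^ tw) - 1 \<in> U 3"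
proof -
  assume i: "i < d"
  define b where "b = u (gs ! i) - 1"
  have b: "b \<in> U 1" unfolding b_def by (rule U_b[OF i])
  have ub: "u (gs ! i) = 1 + b" by (simp add: b_def)
  have bk: "b ^ k \<in> U k" for k using U_pow[OF b, of k] by simp
  show ?thesis
  proof (cases "p = 2")
    case True
    have tw2: "tw = 2" unfolding tw_def using True by simp
    have "u (gs ! i) ^ (p ^ tw) - 1 = (1 + b) ^ 4 - 1" unfolding tw2 ub unfolding True by simp
    also have "\<dots> = b ^ 4 + (of_nat p * of_nat 2) * b ^ 3 + (of_nat p * of_nat 3) * b ^ 2 + (of_nat p * of_nat 2) * b ^ 1"
    proof -
      have n4: "(4::'b) * x = x + x + x + x" for x
      proof -
        have "(4::'b) = 1 + 1 + 1 + 1" by simp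
        then show ?thesis by (simp only: distrib_right mult_1_left)
      qed
      have n6: "(6::'b) * x = x + x + x + x + x + x" for x
      proof -
        have "(6::'b) = 1 + 1 + 1 + 1 + 1 + 1" by simp
        then show ?thesis by (simp only: distrib_right mult_1_left)
      qed
      show ?thesis by (simp add: True power_numeral_reduce algebra_simps numeral_eq_Suc) (simp add: n4 n6 algebra_simps)
    qed
    finally have e: "u (gs ! i) ^ (p ^ tw) - 1 =
        b ^ 4 + (of_nat p * of_nat 2) * b ^ 3 + (of_nat p * of_nat 3) * b ^ 2 + (of_nat p * of_nat 2) * b ^ 1" .
    have pb: "of_nat p * of_nat m * b ^ k \<in> U 3" if "k \<ge> 1" for m k
      using that by (intro U_mult_mono[OF U_mult[OF U_p U_of_nat] bk]) auto
    have "b ^ 4 \<in> U 3" using bk[of 4] U_mono[of 3 4] by auto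
    then show ?thesis unfolding e by (intro U_add pb) auto
  next
    case False
    then have p3: "p \<ge> 3" using prime_ge_2_nat[OF p_prime] by simp
    let ?s = "\<Sum>k=1..<p. of_nat ((p choose k) div p) * b ^ k"
    have "?s \<in> U 1"
      by (intro U_sum U_mult_mono[OF U_of_nat bk]) auto
    then have "of_nat p * ?s \<in> U 3" by (rule U_mult_mono[OF U_p]) simp
    moreover have "b ^ p \<in> U 3" using bk[of p] U_mono[OF p3] by blast
    ultimately have "b ^ p + of_nat p * ?s \<in> U 3" by (intro U_add)
    moreover have "u (gs ! i) ^ (p ^ tw) - 1 = b ^ p + of_nat p * ?s"
      using False one_plus_prime_power[OF p_prime, of b] by (simp add: tw_def ub)
    ultimately show ?thesis by simp
  qed
qed

lemma U_one_plus_pow: "x \<in> U 0 \<Longrightarrow> x - 1 \<in> U D \<Longrightarrow> x ^ k - 1 \<in> U D"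
proof (induction k)
  case (Suc k)
  have e: "x ^ Suc k - 1 = (x - 1) * x ^ k + (x ^ k - 1)" by (simp add: algebra_simps)
  have m: "(x - 1) * x ^ k \<in> U D"
    using Suc.prems(2) U_pow[OF Suc.prems(1), of k] by (rule U_mult_mono) simp
  show ?case unfolding e by (rule U_add[OF m Suc.IH[OF Suc.prems]])
qed (simp add: U_zero)

lemma u_mprod: "set hs \<subseteq> carrier G \<Longrightarrow> u (mprod G hs a) = bprod (map u hs) a"
proof (induction hs arbitrary: a)
  case (Cons h hs)
  then show ?case by (cases a) (auto simp: u_mult u_pow u_one)
qed (simp add: u_one)

lemma U_bprod_minus_one:
  assumes "\<And>i. i < length hs \<Longrightarrow> hs ! i ^ (a ! i) \<in> U 0 \<and> hs ! i ^ (a ! i) - 1 \<in> U D" "length a = length hs"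
  shows "bprod hs a \<in> U 0 \<and> bprod hs a - 1 \<in> U D"
  using assms
proof (induction hs arbitrary: a)
  case Nil then show ?case by (simp add: U_one U_zero)
next
  case (Cons h hs)
  obtain c a' where a: "a = c # a'" using Cons.prems by (metis length_Suc_conv)
  have h: "h ^ c \<in> U 0" "h ^ c - 1 \<in> U D" using Cons.prems(1)[of 0] a by auto
  have IH: "bprod hs a' \<in> U 0 \<and> bprod hs a' - 1 \<in> U D"
    using Cons.prems(1)[of "Suc _"] Cons.prems(2) a by (intro Cons.IH) auto
  have e: "bprod (h # hs) a - 1 = (h ^ c - 1) * bprod hs a' + (bprod hs a' - 1)"
    unfolding a by (simp add: algebra_simps)
  have "bprod (h # hs) a - 1 \<in> U D" unfolding e
    using h IH by (intro U_add U_mult_mono[of "h ^ c - 1" D "bprod hs a'" 0 D]) auto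
  moreover have "bprod (h # hs) a \<in> U 0" unfolding a
    using h IH U_mult_mono[of "h ^ c" 0 "bprod hs a'" 0 0] by simp
  ultimately show ?case by simp
qed

text \<open>Modulo \<open>P n\<close> every element is a word in the g_i with nonnegative exponents,
  and g_i = 1 + b_i.\<close>

lemma U_u: "x \<in> carrier G \<Longrightarrow> u x \<in> U 0"
proof -
  assume x: "x \<in> carrier G"
  obtain a where a: "length a = d" "P n #> x = P n #> mprod G gs a" using B.gs_span[OF x] by blast
  have "u x = bprod (map u gs) a"
    using u_cong[OF x _ a(2)] gs_carrier by (simp add: u_mprod)
  moreover have "bprod (map u gs) a \<in> U 0"
    using U_bprod_minus_one[of "map u gs" a 0] a U_g_pow
    by (simp add: U_minus U_one)
  ultimately show ?thesis by simp
qed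

text \<open>The coordinates of an element of \<open>P tw\<close> are divisible by
  \<open>p ^ tw\<close>, so its image is a product of powers of the g_i^(p^tw), each congruent to 1
  up to degree 3.\<close>

lemma U_Frattini: "c \<in> P tw \<Longrightarrow> u c - 1 \<in> U 3"
proof -
  assume c: "c \<in> P tw"
  then have cc: "c \<in> carrier G" by (rule P_mem)
  show ?thesis
  proof (cases "n \<le> tw")
    \<comment> \<open>Here coordinates modulo \<open>P n\<close> would not detect divisibility by
      \<open>p ^ tw\<close>, but \<open>u\<close> is already trivial on \<open>P tw\<close>.\<close>
    case True
    then have "u c = 1" using u_kill S.P_anti c by blast
    then show ?thesis by (simp add: U_zero)
  next
    case False
    then have le: "tw \<le> n" by simp
    obtain a where a: "length a = d" "P n #> c = P n #> mprod G gs a" using B.gs_span[OF cc] by blast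
    have mc: "mprod G gs a' \<in> carrier G" for a' using gs_carrier by simp
    have "P tw #> mprod G gs a = P tw #> c" using S.cs_mono[OF le cc mc a(2)] by simp
    also have "\<dots> = P tw #> \<one>" using c cc by (simp add: S.cs_one_iff)
    also have "\<dots> = P tw #> mprod G gs (replicate d 0)" using mprod_replicate_zero[OF gs_carrier] by simp
    finally have "a ! i mod p ^ tw = replicate d 0 ! i mod p ^ tw" if "i < d" for i
      using B.cs_mprod_eq_imp_mod[OF a(1) _ _ that, of "replicate d 0" tw] by simp
    then have dv: "p ^ tw dvd a ! i" if "i < d" for i using that by (simp add: mod_eq_0_iff_dvd)
    have "bprod (map u gs) a \<in> U 0 \<and> bprod (map u gs) a - 1 \<in> U 3"
    proof (rule U_bprod_minus_one)
      fix i assume i: "i < length (map u gs)"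
      then obtain k where k: "a ! i = p ^ tw * k" using dv[of i] by (auto elim: dvdE)
      have "(u (gs ! i) ^ (p ^ tw)) ^ k - 1 \<in> U 3"
        using i by (intro U_one_plus_pow U_g_pow U_g_p_pow) auto
      then show "map u gs ! i ^ (a ! i) \<in> U 0 \<and> map u gs ! i ^ (a ! i) - 1 \<in> U 3"
        using i U_g_pow[of i "p ^ tw * k"] by (simp add: k power_mult)
    qed (use a in simp)
    moreover have "u c = bprod (map u gs) a"
      using u_cong[OF cc mc a(2)] gs_carrier by (simp add: u_mprod)
    ultimately show ?thesis by simp
  qed
qed

text \<open>With c = [x, y] one has x y - y x = (c - 1) y x, and subtracting 1 from \<open>x\<close>
  and \<open>y\<close> does not change the left side.\<close>

lemma U_commutator:
  assumes "i < d" "j < d"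
  shows "(u (gs ! i) - 1) * (u (gs ! j) - 1) - (u (gs ! j) - 1) * (u (gs ! i) - 1) \<in> U 3"
proof -
  let ?x = "gs ! i" and ?y = "gs ! j" and ?c = "commutator G (gs ! i) (gs ! j)"
  have c: "?x \<in> carrier G" "?y \<in> carrier G" using assms by auto
  have "?c \<in> P tw" using P_1_comm[OF c] P_2_commutator[OF _ c] by (simp add: tw_def)
  then have "u ?c - 1 \<in> U 3" by (rule U_Frattini)
  then have "(u ?c - 1) * u (?y \<otimes> ?x) \<in> U 3" using c by (intro U_mult_mono[OF _ U_u]) auto
  moreover have "(u ?c - 1) * u (?y \<otimes> ?x) = u (?c \<otimes> (?y \<otimes> ?x)) - u (?y \<otimes> ?x)"
    using c by (simp add: u_mult left_diff_distrib)
  moreover have "\<dots> = (u ?x - 1) * (u ?y - 1) - (u ?y - 1) * (u ?x - 1)"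
    using c by (simp add: commutator_swap u_mult algebra_simps)
  ultimately show ?thesis by simp
qed

text \<open>Exchanging two neighbours replaces two letters by an element of degree 3, so each
  exchange costs a term of degree one more than the word.\<close>

lemma W_move:
  assumes "set (xs @ x # ys) \<subseteq> {..<d}"
  shows "W (xs @ x # ys) - W (x # xs @ ys) \<in> U (Suc (length (xs @ x # ys)))"
  using assms
proof (induction xs)
  case (Cons y xs)
  let ?b = "\<lambda>i. u (gs ! i) - 1"
  have y: "y < d" and x: "x < d" using Cons.prems by auto
  have "W ((y # xs) @ x # ys) - W (x # (y # xs) @ ys) =
      ?b y * (W (xs @ x # ys) - W (x # xs @ ys)) + (?b y * ?b x - ?b x * ?b y) * W (xs @ ys)"
    by (simp add: algebra_simps)
  moreover have "?b y * (W (xs @ x # ys) - W (x # xs @ ys)) \<in> U (Suc (length ((y # xs) @ x # ys)))"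
    using Cons by (intro U_mult_mono[OF U_b[OF y] Cons.IH]) auto
  moreover have "(?b y * ?b x - ?b x * ?b y) * W (xs @ ys) \<in> U (Suc (length ((y # xs) @ x # ys)))"
    using Cons.prems by (intro U_mult_mono[OF U_commutator[OF y x] U_W[OF _ order_refl]]) auto
  ultimately show ?case by (simp only: U_add)
qed (simp add: U_zero)

lemma W_perm:
  assumes "mset xs = mset ys" "set xs \<subseteq> {..<d}"
  shows "W xs - W ys \<in> U (Suc (length xs))"
  using assms
proof (induction xs arbitrary: ys)
  case (Cons x xs)
  have "x \<in> set ys" using Cons.prems(1) by (metis list.set_intros(1) mset_eq_setD)
  then obtain l r where ys: "ys = l @ x # r" by (meson split_list)
  have ms: "mset xs = mset (l @ r)" using Cons.prems(1) ys by simp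
  have x: "x < d" using Cons.prems by simp
  have sy: "set ys \<subseteq> {..<d}" using Cons.prems by (metis mset_eq_setD)
  have len: "length ys = Suc (length xs)" using Cons.prems(1) by (metis length_Cons mset_eq_length)
  have "W (x # xs) - W ys = (u (gs ! x) - 1) * (W xs - W (l @ r)) - (W ys - W (x # l @ r))"
    by (simp add: algebra_simps)
  moreover have "(u (gs ! x) - 1) * (W xs - W (l @ r)) \<in> U (Suc (length (x # xs)))"
    using Cons.prems ms by (intro U_mult_mono[OF U_b[OF x] Cons.IH]) auto
  moreover have "W ys - W (x # l @ r) \<in> U (Suc (length (x # xs)))"
    using W_move[of l x r] sy len unfolding ys by simp
  ultimately show ?case by (simp only: U_minus)
qed (simp add: U_zero)

lemma U_decompose_step: "x \<in> U D \<Longrightarrow> \<exists>f\<in>F D. \<exists>y\<in>U (Suc D). x = f + y"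
  unfolding U_def[of D]
proof (induction rule: aspan.induct)
  case zero
  show ?case by (rule bexI[of _ 0], rule bexI[of _ 0]) (auto simp: F_def U_zero intro: aspan.zero)
next
  have *: "\<exists>f\<in>F D. \<exists>y\<in>U (Suc D). x = f + y"
    if g: "x \<in> {of_nat p ^ a * W xs | a xs. set xs \<subseteq> {..<d} \<and> D \<le> 2 * a + length xs}" for x
  proof -
    obtain a xs where x: "x = of_nat p ^ a * W xs" "set xs \<subseteq> {..<d}" "D \<le> 2 * a + length xs" using g by blast
    define c where "c = map (count (mset xs)) [0..<d]"
    have c: "length c = d" by (simp add: c_def)
    have ms: "mset xs = mset (wd 0 c)" unfolding c_def using mset_wd_count[OF x(2)] by simp
    have sc: "sum_list c = length xs" using ms length_wd[of 0 c] by (metis size_mset)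
    have "of_nat p ^ a * bprod bvars c \<in> F D"
      unfolding F_def using c sc x(3)
      by (intro aspan_base) (rule CollectI, rule exI[of _ a], rule exI[of _ c], simp)
    moreover have "of_nat p ^ a * (W xs - bprod bvars c) \<in> U (Suc D)"
    proof -
      have "W xs - bprod bvars c \<in> U (Suc (length xs))" using W_perm[OF ms x(2)] W_wd[OF c] by simp
      moreover have "of_nat p ^ a \<in> U (2 * a)" using U_gen[of "[]" "2 * a" a] by simp
      ultimately show ?thesis using x(3) by (intro U_mult_mono[of "of_nat p ^ a" "2 * a"]) auto
    qed
    moreover have "x = of_nat p ^ a * bprod bvars c + of_nat p ^ a * (W xs - bprod bvars c)"
      by (simp add: x right_diff_distrib)
    ultimately show ?thesis by blast
  qed
  { case (plus x y)
    then obtain f w f' w' where "f \<in> F D" "w \<in> U (Suc D)" "y = f + w" "f' \<in> F D" "w' \<in> U (Suc D)" "x = f' + w'"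
      using *[OF plus(1)] by blast
    then show ?case by (intro bexI[of _ "f + f'"] bexI[of _ "w + w'"]) (auto simp: U_add F_def aspan_add) }
  { case (minus x y)
    then obtain f w f' w' where "f \<in> F D" "w \<in> U (Suc D)" "y = f + w" "f' \<in> F D" "w' \<in> U (Suc D)" "x = f' + w'"
      using *[OF minus(1)] by blast
    then show ?case by (intro bexI[of _ "f - f'"] bexI[of _ "w - w'"]) (auto simp: U_minus F_def aspan_minus) }
qed

text \<open>Corrections produce new unsorted words, so sorting need not end; it is stopped after
  \<open>t\<close> rounds with a remainder of high degree.\<close>

lemma U_decompose: "x \<in> U D \<Longrightarrow> \<exists>f\<in>F D. \<exists>y\<in>U (D + t). x = f + y"
proof (induction t)
  case 0
  then show ?case by (intro bexI[of _ 0] bexI[of _ x]) (auto simp: F_def intro: aspan.zero)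
next
  case (Suc t)
  then obtain f y where fy: "f \<in> F D" "y \<in> U (D + t)" "x = f + y" by blast
  then obtain f' y' where fy': "f' \<in> F (D + t)" "y' \<in> U (Suc (D + t))" "y = f' + y'"
    using U_decompose_step by blast
  have "f' \<in> F D" using fy' F_mono[of D "D + t"] by auto
  then have "f + f' \<in> F D" using fy by (simp add: F_def aspan_add)
  then show ?case using fy fy' by (intro bexI[of _ "f + f'"] bexI[of _ y']) (auto simp: add.assoc)
qed

text \<open>In a generator \<open>of_nat p ^ a * W xs\<close> of degree at least
  \<open>2 * k + m * k\<close>, either \<open>a\<close> is at least \<open>k\<close>, or at least
  \<open>m * k\<close> letters are left and \<open>augmentation_power_p_power\<close> supplies the
  factor p^k.\<close>

lemma U_p_power: "\<exists>M. \<forall>x\<in>U M. \<exists>y. x = of_nat p ^ k * y"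
proof -
  obtain m where m: "\<And>k xs. m * k \<le> length xs \<Longrightarrow> set xs \<subseteq> Aug \<Longrightarrow> \<exists>y. prod_list xs = of_nat p ^ k * y"
    using augmentation_power_p_power by blast
  have "\<exists>y. x = of_nat p ^ k * y" if "x \<in> U (2 * k + m * k)" for x
    using that unfolding U_def
  proof (induction rule: aspan.induct)
    case zero show ?case by (rule exI[of _ 0]) simp
  next
    have *: "\<exists>y. x = of_nat p ^ k * y"
      if g: "x \<in> {of_nat p ^ a * W xs | a xs. set xs \<subseteq> {..<d} \<and> 2 * k + m * k \<le> 2 * a + length xs}" for x
    proof -
      obtain a xs where x: "x = of_nat p ^ a * W xs" "set xs \<subseteq> {..<d}" "2 * k + m * k \<le> 2 * a + length xs"
        using g by blast
      show ?thesis
      proof (cases "k \<le> a")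
        case True
        then have "(of_nat p :: 'b) ^ a = of_nat p ^ k * of_nat p ^ (a - k)" by (simp flip: power_add)
        then show ?thesis using x by (intro exI[of _ "of_nat p ^ (a - k) * W xs"]) (simp add: mult.assoc)
      next
        case False
        then have "m * k \<le> length (map (\<lambda>i. u (gs ! i) - 1) xs)" using x by simp
        moreover have "set (map (\<lambda>i. u (gs ! i) - 1) xs) \<subseteq> Aug"
          using x(2) unfolding Aug_def by (auto simp: subset_iff)
        ultimately obtain y where y: "W xs = of_nat p ^ k * y" unfolding W_def using m by blast
        have "x = (of_nat p ^ a * of_nat p ^ k) * y" by (simp add: x y mult.assoc)
        also have "of_nat p ^ a * of_nat p ^ k = (of_nat p ^ k * of_nat p ^ a :: 'b)"
          by (simp flip: power_add add: add.commute)
        finally show ?thesis by (intro exI[of _ "of_nat p ^ a * y"]) (simp add: mult.assoc)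
      qed
    qed
    { case (plus x y)
      then obtain v w where "x = of_nat p ^ k * v" "y = of_nat p ^ k * w" using *[OF plus(1)] by blast
      then show ?case by (intro exI[of _ "w + v"]) (simp add: distrib_left) }
    { case (minus x y)
      then obtain v w where "x = of_nat p ^ k * v" "y = of_nat p ^ k * w" using *[OF minus(1)] by blast
      then show ?case by (intro exI[of _ "w - v"]) (simp add: right_diff_distrib) }
  qed
  then show ?thesis by blast
qed

text \<open>The remainder of sorting is pushed to a degree in which \<open>U_p_power\<close> makes
  it a multiple of p^k, so only ordered monomials are left besides it.\<close>

theorem bprod_mult:
  assumes "length a = d" "length c = d"
  shows "\<exists>f\<in>F (Suc (sum_list a + sum_list c)). \<exists>y.
    bprod bvars a * bprod bvars c = bprod bvars (map2 (+) a c) + f + of_nat p ^ k * y"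
proof -
  let ?D = "Suc (sum_list a + sum_list c)"
  have ms: "mset (wd 0 a @ wd 0 c) = mset (wd 0 (map2 (+) a c))"
    using assms by (simp add: mset_wd_add)
  have "set (wd 0 a @ wd 0 c) \<subseteq> {..<d}" using set_wd[of 0 a] set_wd[of 0 c] assms by auto
  from W_perm[OF ms this]
  have "bprod bvars a * bprod bvars c - bprod bvars (map2 (+) a c) \<in> U ?D"
    using assms by (simp add: W_wd length_wd)
  moreover obtain M where M: "\<And>x. x \<in> U M \<Longrightarrow> \<exists>y. x = of_nat p ^ k * y" using U_p_power by blast
  ultimately obtain f y where fy: "f \<in> F ?D" "y \<in> U (?D + M)"
    "bprod bvars a * bprod bvars c - bprod bvars (map2 (+) a c) = f + y" using U_decompose by blast
  then obtain w where w: "y = of_nat p ^ k * w" using M U_mono[of M "?D + M"] by auto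
  show ?thesis using fy w by (intro bexI[of _ f] exI[of _ w]) (auto simp: algebra_simps)
qed

text \<open>Modulo \<open>p\<close>, Frobenius gives 1 + b^(p^n) = (1 + b)^(p^n), the image of
  \<open>g [^] (p ^ n)\<close>, which is 1 since this power lies in \<open>P n\<close>.\<close>

lemma bvars_pow_p: "b \<in> set bvars \<Longrightarrow> \<exists>y. b ^ (p ^ n) = of_nat p * y"
proof -
  assume "b \<in> set bvars"
  then obtain g where g: "g \<in> carrier G" "b = u g - 1" using gs_carrier by (auto simp: bvars_def)
  have "\<exists>y. (1 + b) ^ (p ^ m) = 1 + b ^ (p ^ m) + of_nat p * y" for m
  proof (induction m)
    case 0 show ?case by (rule exI[of _ 0]) simp
  next
    case (Suc m)
    then obtain y where y: "(1 + b) ^ (p ^ m) = 1 + b ^ (p ^ m) + of_nat p * y" by blast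
    let ?c = "b ^ (p ^ m) + of_nat p * y" and ?b = "b ^ (p ^ m)"
    \<comment> \<open>Congruences modulo \<open>p\<close> survive powers in the noncommutative ring
      because \<open>p\<close> is central.\<close>
    have pw: "\<exists>z. (x + of_nat p * w) ^ k = x ^ k + of_nat p * z" for x w :: 'b and k
    proof (induction k)
      case 0 show ?case by (rule exI[of _ 0]) simp
    next
      case (Suc k)
      then obtain z where z: "(x + of_nat p * w) ^ k = x ^ k + of_nat p * z" by blast
      have "(x + of_nat p * w) ^ Suc k = x * x ^ k + (x * of_nat p) * z + of_nat p * (w * (x ^ k + of_nat p * z))"
        by (simp add: z algebra_simps)
      also have "x * of_nat p = of_nat p * x" by (rule of_nat_commutes[symmetric])
      finally show ?case by (intro exI[of _ "x * z + w * (x ^ k + of_nat p * z)"]) (simp add: algebra_simps)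
    qed
    have "(1 + b) ^ (p ^ Suc m) = ((1 + b) ^ (p ^ m)) ^ p" by (simp add: power_mult[symmetric] mult.commute)
    also have "\<dots> = (1 + ?b + of_nat p * y) ^ p" by (simp only: y)
    finally have 1: "(1 + b) ^ (p ^ Suc m) = (1 + ?b + of_nat p * y) ^ p" .
    obtain z where z: "(1 + ?b + of_nat p * y) ^ p = (1 + ?b) ^ p + of_nat p * z" using pw by blast
    obtain z' where z': "(1 + ?b) ^ p = 1 + ?b ^ p + of_nat p * z'"
      using one_plus_prime_power[OF p_prime, of ?b] by blast
    have "?b ^ p = b ^ (p ^ Suc m)" by (simp add: power_mult[symmetric] mult.commute)
    then show ?case unfolding 1 z z' by (intro exI[of _ "z' + z"]) (simp add: algebra_simps)
  qed
  then obtain y where y: "(1 + b) ^ (p ^ n) = 1 + b ^ (p ^ n) + of_nat p * y" by blast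
  have "(1 + b) ^ (p ^ n) = u (g [^] (p ^ n))" using g by (simp add: u_pow)
  also have "\<dots> = 1" using B.pow_P[OF g(1)] by (rule u_kill)
  finally have "b ^ (p ^ n) = of_nat p * (- y)" using y by (simp add: algebra_simps eq_neg_iff_add_eq_0)
  then show ?thesis by blast
qed

text \<open>Pigeonhole on the exponents: some \<open>c\<^sub>i \<ge> p\<^sup>n k\<close>.\<close>
lemma bprod_p_power:
  assumes "length c = d" "d * (p ^ n * k) < sum_list c"
  shows "\<exists>y. bprod bvars c = of_nat p ^ k * y"
proof -
  have gen: "\<exists>y. bprod bs c = of_nat p ^ k * y"
    if "length c = length bs" "length bs * (p ^ n * k) < sum_list c" "set bs \<subseteq> set bvars" for bs c
    using that
  proof (induction bs arbitrary: c)
    case (Cons b bs)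
    obtain a c' where c: "c = a # c'" using Cons.prems by (metis length_Suc_conv)
    show ?case
    proof (cases "p ^ n * k \<le> a")
      case True
      obtain y where y: "b ^ (p ^ n) = of_nat p * y" using bvars_pow_p Cons.prems by auto
      have py: "(of_nat p * y) ^ k = of_nat p ^ k * y ^ k" for k
      proof (induction k)
        case (Suc k)
        have "(of_nat p * y) ^ Suc k = of_nat p * (y * of_nat p ^ k) * y ^ k" by (simp add: Suc mult.assoc)
        also have "y * of_nat p ^ k = of_nat p ^ k * y" by (rule of_nat_pow_commutes[symmetric])
        finally show ?case by (simp add: mult.assoc)
      qed simp
      have "b ^ a = (b ^ (p ^ n)) ^ k * b ^ (a - p ^ n * k)"
        using True by (simp add: power_mult[symmetric] power_add[symmetric])
      also have "\<dots> = of_nat p ^ k * (y ^ k * b ^ (a - p ^ n * k))" unfolding y py by (simp add: mult.assoc)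
      finally show ?thesis using c by (intro exI[of _ "y ^ k * b ^ (a - p ^ n * k) * bprod bs c'"]) (simp add: mult.assoc)
    next
      case False
      then obtain y where y: "bprod bs c' = of_nat p ^ k * y" using Cons.IH[of c'] Cons.prems c by auto
      have "bprod (b # bs) c = (b ^ a * of_nat p ^ k) * y" using c y by (simp add: mult.assoc)
      also have "b ^ a * of_nat p ^ k = of_nat p ^ k * b ^ a" by (rule of_nat_pow_commutes[symmetric])
      finally show ?thesis by (intro exI[of _ "b ^ a * y"]) (simp add: mult.assoc)
    qed
  qed simp
  show ?thesis using assms by (intro gen) auto
qed

lemma u_mprod_expand:
  assumes "a \<in> ibox d m"
  shows "u (mprod G gs a) = (\<Sum>c\<in>ibox d m. of_nat (mbinom a c) * bprod bvars c)"
proof -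
  have "map (\<lambda>b. 1 + b) bvars = map u gs" by (simp add: bvars_def)
  then show ?thesis using bprod_binomial[of a bvars m] assms gs_carrier by (simp add: u_mprod)
qed

end

subsection \<open>The levels \<open>R[G/P\<^sub>n]\<close>\<close>

text \<open>The finite levels \<open>R[G/N]\<close> act faithfully on functions on \<open>G/N\<close>; realising them as additive
  endomorphisms puts them into the type class \<open>ring_1\<close>, uniformly in \<open>N\<close>.\<close>
typedef (overloaded) ('c, 'r) endo =
  "{f :: ('c \<Rightarrow> 'r::comm_ring_1) \<Rightarrow> 'c \<Rightarrow> 'r. \<forall>x y. f (\<lambda>c. x c + y c) = (\<lambda>c. f x c + f y c)}"
  morphisms app Endo
  by (rule exI[of _ "\<lambda>x. x"]) simp

lemma app_additive: "app A (\<lambda>c. x c + y c) = (\<lambda>c. app A x c + app A y c)"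
  using app[of A] by simp

lemma endo_eqI: "(\<And>f c. app A f c = app B f c) \<Longrightarrow> A = B"
  by (metis app_inject ext)

instantiation endo :: (type, comm_ring_1) ring_1
begin

definition "0 = Endo (\<lambda>f c. 0)"
definition "1 = Endo (\<lambda>f. f)"
definition "A + B = Endo (\<lambda>f c. app A f c + app B f c)"
definition "A - B = Endo (\<lambda>f c. app A f c - app B f c)"
definition "- A = Endo (\<lambda>f c. - app A f c)"
definition "A * B = Endo (\<lambda>f. app A (app B f))"

lemma app_simps:
  "app 0 f = (\<lambda>c. 0)" "app 1 f = f"
  "app (A + B) f = (\<lambda>c. app A f c + app B f c)"
  "app (A - B) f = (\<lambda>c. app A f c - app B f c)"
  "app (- A) f = (\<lambda>c. - app A f c)"
  "app (A * B) f = app A (app B f)"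
  unfolding zero_endo_def one_endo_def plus_endo_def minus_endo_def uminus_endo_def times_endo_def
  by (subst Endo_inverse; simp add: app_additive algebra_simps)+

instance
proof
  show "(0 :: ('a, 'b) endo) \<noteq> 1"
  proof
    assume "(0 :: ('a, 'b) endo) = 1"
    then have "app (0 :: ('a, 'b) endo) (\<lambda>_. 1) undefined = app 1 (\<lambda>_. 1) undefined" by simp
    then show False by (simp add: app_simps)
  qed
qed (rule endo_eqI, simp add: app_simps app_additive algebra_simps)+

end

lemma app_of_nat: "app (of_nat m) f = (\<lambda>c. of_nat m * f c)"
  by (induction m) (auto simp: app_simps algebra_simps)

lemma app_of_nat_mult: "app (of_nat m * A) f c = of_nat m * app A f c"
  by (simp add: app_simps app_of_nat)

lemma app_of_nat_pow_mult: "app (of_nat m ^ k * A) f c = of_nat m ^ k * app A f c"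
  using app_of_nat_mult[of "m ^ k" A f c] by simp

lemma app_sum: "app (sum A I) f c = (\<Sum>i\<in>I. app (A i) f c)"
  by (induction I rule: infinite_finite_induct) (auto simp: app_simps)

text \<open>The case \<open>Suc j\<close> follows from (j + 1) C(a, j + 1) = (a - j) C(a, j) on
  division by j + 1 = p^e q. This loses a factor p^e, so the induction hypothesis is taken at
  precision \<open>k + e\<close>.\<close>

lemma binomial_p_continuous:
  assumes p: "Factorial_Ring.prime (p::nat)"
  shows "\<exists>n. \<forall>a b. a mod p ^ n = b mod p ^ n \<longrightarrow> int p ^ k dvd int (a choose j) - int (b choose j)"
proof (induction j arbitrary: k)
  case (Suc j)
  obtain e q where eq: "Suc j = p ^ e * q" "\<not> p dvd q"
    using multiplicity_decompose'[of "Suc j" p] p by (metis Suc_not_Zero not_prime_unit mult.commute)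
  obtain n0 where n0: "\<And>a b. a mod p ^ n0 = b mod p ^ n0 \<Longrightarrow> int p ^ (k + e) dvd int (a choose j) - int (b choose j)"
    using Suc[of "k + e"] by blast
  have "int p ^ k dvd int (a choose Suc j) - int (b choose Suc j)"
    if ab: "a mod p ^ (n0 + (k + e)) = b mod p ^ (n0 + (k + e))" for a b
  proof -
    have rec: "int (Suc j) * int (a choose Suc j) = (int a - int j) * int (a choose j)" for a
    proof (cases "j \<le> a")
      case True
      have "Suc j * (a choose Suc j) = (a - j) * (a choose j)"
        by (simp only: binomial_absorb_comp binomial_absorption)
      then have "int (Suc j * (a choose Suc j)) = int ((a - j) * (a choose j))" by simp
      then show ?thesis using True by (simp only: of_nat_mult of_nat_diff)
    qed (simp add: binomial_eq_0)
    have "a mod p ^ n0 = b mod p ^ n0"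
      using ab by (metis le_add1 le_imp_power_dvd mod_mod_cancel)
    then have 1: "int p ^ (k + e) dvd int (a choose j) - int (b choose j)" by (rule n0)
    have "a mod p ^ (k + e) = b mod p ^ (k + e)"
      using ab by (metis le_add2 le_imp_power_dvd mod_mod_cancel)
    then have 2: "int p ^ (k + e) dvd int a - int b"
      by (metis mod_eq_dvd_iff of_nat_mod of_nat_power)
    have "int (Suc j) * (int (a choose Suc j) - int (b choose Suc j)) =
       (int a - int j) * (int (a choose j) - int (b choose j)) + (int a - int b) * int (b choose j)"
      using rec[of a] rec[of b] by (simp add: algebra_simps)
    then have "int p ^ (k + e) dvd int (Suc j) * (int (a choose Suc j) - int (b choose Suc j))"
      using 1 2 by (simp add: dvd_add dvd_mult dvd_mult2)
    then have "int p ^ e * int p ^ k dvd int p ^ e * (int q * (int (a choose Suc j) - int (b choose Suc j)))"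
      unfolding eq(1) by (simp add: power_add mult_ac)
    then have "int p ^ k dvd int q * (int (a choose Suc j) - int (b choose Suc j))"
      using p by (simp add: prime_gt_0_nat)
    moreover have "coprime (int p ^ k) (int q)"
    proof -
      have "coprime p q" using p eq(2) by (simp add: prime_imp_coprime)
      then show ?thesis by simp
    qed
    ultimately show ?thesis by (simp add: coprime_dvd_mult_right_iff)
  qed
  then show ?case by blast
qed simp

lemma mbinom_p_continuous:
  assumes p: "Factorial_Ring.prime (p::nat)"
  shows "\<exists>n. \<forall>a b. length a = length c \<longrightarrow> length b = length c \<longrightarrow>
    (\<forall>i<length c. a ! i mod p ^ n = b ! i mod p ^ n) \<longrightarrow> int p ^ k dvd int (mbinom a c) - int (mbinom b c)"
proof (induction c)
  case (Cons j c)
  then obtain n where n: "\<And>a b. length a = length c \<Longrightarrow> length b = length c \<Longrightarrow>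
    (\<And>i. i < length c \<Longrightarrow> a ! i mod p ^ n = b ! i mod p ^ n) \<Longrightarrow> int p ^ k dvd int (mbinom a c) - int (mbinom b c)"
    by blast
  obtain m where m: "\<And>a b. a mod p ^ m = b mod p ^ m \<Longrightarrow> int p ^ k dvd int (a choose j) - int (b choose j)"
    using binomial_p_continuous[OF p] by blast
  have "int p ^ k dvd int (mbinom a (j # c)) - int (mbinom b (j # c))"
    if ab: "length a = length (j # c)" "length b = length (j # c)"
      "\<And>i. i < length (j # c) \<Longrightarrow> a ! i mod p ^ (m + n) = b ! i mod p ^ (m + n)" for a b
  proof -
    obtain x a' y b' where e: "a = x # a'" "b = y # b'" using ab by (metis length_Suc_conv length_Cons)
    have md: "v mod p ^ m = w mod p ^ m" "v mod p ^ n = w mod p ^ n" if "v mod p ^ (m + n) = w mod p ^ (m + n)" for v w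
      using that by (metis le_add1 le_add2 le_imp_power_dvd mod_mod_cancel)+
    have "x mod p ^ m = y mod p ^ m" using ab(3)[of 0] unfolding e by (intro md(1)) simp
    then have 1: "int p ^ k dvd int (x choose j) - int (y choose j)" by (rule m)
    have 2: "int p ^ k dvd int (mbinom a' c) - int (mbinom b' c)"
    proof (rule n)
      show "length a' = length c" "length b' = length c" using ab(1,2) e by auto
      fix i assume "i < length c"
      then show "a' ! i mod p ^ n = b' ! i mod p ^ n" using ab(3)[of "Suc i"] e by (intro md(2)) simp
    qed
    have "int (mbinom a (j # c)) - int (mbinom b (j # c)) =
      (int (x choose j) - int (y choose j)) * int (mbinom a' c) + int (y choose j) * (int (mbinom a' c) - int (mbinom b' c))"
      unfolding e by (simp add: mbinom_def algebra_simps)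
    then show ?thesis using 1 2 by (simp add: dvd_add dvd_mult dvd_mult2)
  qed
  then show ?case by blast
qed (simp add: mbinom_def)

lemma mbinom_self: "mbinom a a = 1"
  by (induction a) (auto simp: mbinom_def)

lemma mbinom_nonzero:
  assumes "mbinom a c \<noteq> 0" "length a = length c" "i < length c"
  shows "c ! i \<le> a ! i"
  using assms
proof (induction a c arbitrary: i rule: list_induct2')
  case (4 x a j c)
  then have "x choose j \<noteq> 0" "mbinom a c \<noteq> 0" by (auto simp: mbinom_def)
  then show ?case using 4 by (cases i) (auto simp: not_less[symmetric] dest: binomial_eq_0)
qed (auto simp: mbinom_def)

lemma sum_list_less_if_le:
  fixes a c :: "nat list"
  assumes "length a = length c" "\<And>i. i < length c \<Longrightarrow> c ! i \<le> a ! i" "c \<noteq> a"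
  shows "sum_list c < sum_list a"
  using assms
proof (induction a c rule: list_induct2')
  case (4 x a y c)
  have xy: "y \<le> x" using 4(3)[of 0] by simp
  have le: "c ! i \<le> a ! i" if "i < length c" for i using 4(3)[of "Suc i"] that by simp
  show ?case
  proof (cases "c = a")
    case False
    then have "sum_list c < sum_list a" using 4 le by auto
    then show ?thesis using xy by simp
  qed (use 4 xy in auto)
qed auto

lemma of_int_dvd: "a dvd b \<Longrightarrow> (of_int a :: 'r::comm_ring_1) dvd of_int b"
  by (metis dvd_def of_int_mult)

section \<open>The levels as convolution operators; approximate coefficients\<close>

locale expansion_loc = uniform_group_loc +
  fixes \<pi> :: "'r::idom"
  assumes dvr: "complete_dvr_unif \<pi>" and pi_p: "\<pi> = of_nat p"
begin

text \<open>Right translation of functions respects the order of products. Off the cosets it is the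
  identity, so the neutral element acts as exactly 1 on all functions.\<close>

definition opP :: "nat \<Rightarrow> 'a \<Rightarrow> ('a set, 'r) endo" where
  "opP n h = Endo (\<lambda>f C. if C \<in> rcosets (P n) then f (C #> h) else f C)"

lemma app_opP: "app (opP n h) f = (\<lambda>C. if C \<in> rcosets (P n) then f (C #> h) else f C)"
  unfolding opP_def by (subst Endo_inverse) auto

lemma rcos_P: "C \<in> rcosets (P n) \<Longrightarrow> \<exists>x\<in>carrier G. C = P n #> x"
  by (auto simp: RCOSETS_def)

lemma rcos_P_I: "x \<in> carrier G \<Longrightarrow> P n #> x \<in> rcosets (P n)"
  by (auto simp: RCOSETS_def)

lemma P_subset: "P n \<subseteq> carrier G" using P_mem by auto

lemma group_rep_opP: "group_rep G T p gs (opP n) n"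
proof
  show "opP n (x \<otimes> y) = opP n x * opP n y" if "x \<in> carrier G" "y \<in> carrier G" for x y
  proof (rule endo_eqI)
    fix f C show "app (opP n (x \<otimes> y)) f C = app (opP n x * opP n y) f C"
    proof (cases "C \<in> rcosets (P n)")
      case True
      then obtain z where z: "z \<in> carrier G" "C = P n #> z" using rcos_P by blast
      then show ?thesis using that True rcos_P_I
        by (simp add: app_simps app_opP coset_mult_assoc[OF P_subset] m_assoc)
    qed (simp add: app_simps app_opP)
  qed
  show "opP n \<one> = 1"
  proof (rule endo_eqI)
    fix f C show "app (opP n \<one>) f C = app 1 f C"
      using subgroup.rcosets_carrier[OF P_sub is_group, of C n] by (auto simp: app_simps app_opP)
  qed
  show "opP n x = 1" if "x \<in> P n" for x
  proof (rule endo_eqI)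
    fix f C show "app (opP n x) f C = app 1 f C"
    proof (cases "C \<in> rcosets (P n)")
      case True
      then obtain z where z: "z \<in> carrier G" "C = P n #> z" using rcos_P by blast
      have xc: "x \<in> carrier G" using that by (rule P_mem)
      have "C #> x = P n #> (z \<otimes> x)" using z xc by (simp add: coset_mult_assoc[OF P_subset])
      also have "\<dots> = C" unfolding z(2) using z xc that P_normal[of n]
        by (simp add: S.cs_iff normal.inv_op_closed2)
      finally show ?thesis using True by (simp add: app_simps app_opP)
    qed (simp add: app_simps app_opP)
  qed
qed

sublocale R: group_rep G T p gs "opP n" n for n by (rule group_rep_opP)

text \<open>\<open>A\<close> acts by convolution with the level-\<open>n\<close> component of
  \<open>x\<close>, so products of operators compute products in the group ring.\<close>

definition represents :: "nat \<Rightarrow> ('a set, 'r) endo \<Rightarrow> ('a, 'r) rg \<Rightarrow> bool" where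
  "represents n A x \<longleftrightarrow> (\<forall>f. \<forall>D\<in>rcosets (P n). app A f D = (\<Sum>C\<in>rcosets (P n). x (P n) C * f (D <#> C)))"

lemma finite_rc: "open_normal G T N \<Longrightarrow> finite (rcosets N)" by (rule finite_rcosets)

lemma finite_rcP [simp]: "finite (rcosets (P n))" by (rule finite_rcosets[OF P_open_normal])

lemma rcos_mult_closed:
  assumes "open_normal G T N" "C \<in> rcosets N" "D \<in> rcosets N" shows "C <#> D \<in> rcosets N"
  using normal.setmult_closed[OF open_normalD(1)[OF assms(1)]] assms by simp

lemma rcos_mult_assoc:
  assumes "open_normal G T N" "C \<in> rcosets N" "D \<in> rcosets N" "E \<in> rcosets N"
  shows "C <#> D <#> E = C <#> (D <#> E)"
  using normal.rcosets_assoc[OF open_normalD(1)[OF assms(1)]] assms by simp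

lemma rcos_one_mult:
  assumes "open_normal G T N" "C \<in> rcosets N" shows "N <#> C = C"
  using normal.rcosets_mult_eq[OF open_normalD(1)[OF assms(1)]] assms by simp

lemma N_rcos: "open_normal G T N \<Longrightarrow> N \<in> rcosets N"
  using subgroup.subgroup_in_rcosets[OF open_normalD(2) is_group] by blast

lemma P_rcos: "P n \<in> rcosets (P n)" by (rule N_rcos[OF P_open_normal])

text \<open>Tested against an arbitrary function, the fibre sums that define the product become a
  plain double sum over pairs of cosets.\<close>

lemma rg_mult_pairing:
  assumes N: "open_normal G T N"
  shows "(\<Sum>F\<in>rcosets N. rg_mult G T x y N F * f F) =
    (\<Sum>D\<in>rcosets N. \<Sum>E\<in>rcosets N. x N D * y N E * (f (D <#> E) :: 'r))"
proof -
  let ?H = "rcosets N"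
  have fin: "finite ?H" by (rule finite_rc[OF N])
  have "(\<Sum>F\<in>?H. rg_mult G T x y N F * f F) =
     (\<Sum>F\<in>?H. \<Sum>z\<in>{z \<in> ?H \<times> ?H. fst z <#> snd z = F}. x N (fst z) * y N (snd z) * f (fst z <#> snd z))"
  proof (rule sum.cong[OF refl])
    fix F
    have "rg_mult G T x y N F = (\<Sum>z\<in>{z \<in> ?H \<times> ?H. fst z <#> snd z = F}. x N (fst z) * y N (snd z))"
      using N by (auto simp: rg_mult_def case_prod_unfold intro!: sum.cong)
    then show "rg_mult G T x y N F * f F = (\<Sum>z\<in>{z \<in> ?H \<times> ?H. fst z <#> snd z = F}. x N (fst z) * y N (snd z) * f (fst z <#> snd z))"
      by (simp add: sum_distrib_right)
  qed
  also have "\<dots> = (\<Sum>z\<in>?H \<times> ?H. x N (fst z) * y N (snd z) * f (fst z <#> snd z))"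
    using fin rcos_mult_closed[OF N] by (intro sum.group) auto
  also have "\<dots> = (\<Sum>D\<in>?H. \<Sum>E\<in>?H. x N D * y N E * f (D <#> E))"
    by (simp add: sum.cartesian_product case_prod_unfold)
  finally show ?thesis .
qed

lemma represents_mult:
  assumes "represents n A x" "represents n B y"
  shows "represents n (A * B) (rg_mult G T x y)"
  unfolding represents_def
proof (intro allI ballI)
  fix f D assume D: "D \<in> rcosets (P n)"
  note N = P_open_normal[of n]
  have "app (A * B) f D = (\<Sum>C\<in>rcosets (P n). x (P n) C * app B f (D <#> C))"
    using assms(1) D by (simp add: represents_def app_simps)
  also have "\<dots> = (\<Sum>C\<in>rcosets (P n). \<Sum>E\<in>rcosets (P n). x (P n) C * y (P n) E * f (D <#> (C <#> E)))"
  proof (rule sum.cong[OF refl])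
    fix C assume C: "C \<in> rcosets (P n)"
    have "app B f (D <#> C) = (\<Sum>E\<in>rcosets (P n). y (P n) E * f (D <#> C <#> E))"
      using assms(2) rcos_mult_closed[OF N D C] by (simp add: represents_def)
    then show "x (P n) C * app B f (D <#> C) = (\<Sum>E\<in>rcosets (P n). x (P n) C * y (P n) E * f (D <#> (C <#> E)))"
      using rcos_mult_assoc[OF N D C] by (simp add: sum_distrib_left mult.assoc)
  qed
  also have "\<dots> = (\<Sum>C\<in>rcosets (P n). rg_mult G T x y (P n) C * f (D <#> C))"
    by (rule rg_mult_pairing[OF N, symmetric])
  finally show "app (A * B) f D = (\<Sum>C\<in>rcosets (P n). rg_mult G T x y (P n) C * f (D <#> C))" .
qed

lemma represents_of: "h \<in> carrier G \<Longrightarrow> represents n (opP n h) (rg_of G T h)"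
  unfolding represents_def
proof (intro allI ballI)
  fix f :: "'a set \<Rightarrow> 'r" and D assume h: "h \<in> carrier G" and D: "D \<in> rcosets (P n)"
  then obtain z where z: "z \<in> carrier G" "D = P n #> z" using rcos_P by blast
  have "D <#> (P n #> h) = D #> h"
    unfolding z(2) using z h by (simp add: normal.rcos_sum[OF P_normal] coset_mult_assoc[OF P_subset])
  then have "f (D #> h) = (\<Sum>C\<in>rcosets (P n). (if C = P n #> h then f (D <#> C) else 0))"
    using rcos_P_I[OF h, of n] by (simp add: sum.delta)
  also have "\<dots> = (\<Sum>C\<in>rcosets (P n). rg_of G T h (P n) C * f (D <#> C))"
    using P_open_normal by (intro sum.cong) (auto simp: rg_of_def)
  finally show "app (opP n h) f D = (\<Sum>C\<in>rcosets (P n). rg_of G T h (P n) C * f (D <#> C))"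
    using D by (simp add: app_opP)
qed

lemma rg_of_one: "rg_of G T \<one> = rg_one G T"
  unfolding rg_of_def rg_one_def
  by (intro ext) (auto simp: open_normal_def dest!: normal_imp_subgroup subgroup.subset)

lemma represents_one: "represents n 1 (rg_one G T)"
  using represents_of[of \<one> n] R.u_one by (simp add: rg_of_one)

lemma represents_bvar: "h \<in> carrier G \<Longrightarrow> represents n (opP n h - 1) (bvar G T h)"
  using represents_of[of h n] represents_one[of n]
  unfolding represents_def by (simp add: bvar_def app_simps left_diff_distrib sum_subtractf)

lemma represents_pow: "represents n A x \<Longrightarrow> represents n (A ^ k) (rg_pow G T x k)"
  by (induction k) (auto simp: rg_pow_def represents_one represents_mult)

lemma represents_bmono: "represents n (bprod (R.bvars n) c) (bmono G T gs c)"
proof -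
  have "represents n (bprod (map (\<lambda>g. opP n g - 1) hs) c) (bmono G T hs c)" if "set hs \<subseteq> carrier G" for hs
    using that
  proof (induction hs arbitrary: c)
    case Nil show ?case by (simp add: represents_one)
  next
    case (Cons h hs)
    then show ?case
      by (cases c) (auto simp: represents_one intro!: represents_mult represents_pow represents_bvar)
  qed
  then show ?thesis using gs_carrier by (simp add: R.bvars_def)
qed

lemma represents_eval:
  assumes "represents n A x" shows "app A f (P n) = (\<Sum>C\<in>rcosets (P n). x (P n) C * f C)"
proof -
  have "app A f (P n) = (\<Sum>C\<in>rcosets (P n). x (P n) C * f (P n <#> C))"
    using assms P_rcos by (simp add: represents_def)
  then show ?thesis using rcos_one_mult[OF P_open_normal[of n]] by simp
qed

lemma represents_coeff:
  assumes "represents n A x" "D \<in> rcosets (P n)"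
  shows "x (P n) D = app A (\<lambda>C. if C = D then 1 else 0) (P n)"
  unfolding represents_eval[OF assms(1)] using assms(2) by (simp add: if_distrib sum.delta cong: if_cong)

text \<open>The coordinates of the second kind of a coset, with exponents below
  \<open>p ^ n\<close>.\<close>

definition ex :: "nat \<Rightarrow> 'a set \<Rightarrow> nat list" where
  "ex n = the_inv_into (ibox d (p ^ n)) (\<lambda>a. P n #> mprod G gs a)"

lemma ex_cs:
  assumes "length a = d" shows "ex n (P n #> mprod G gs a) = map (\<lambda>x. x mod p ^ n) a"
proof -
  have "P n #> mprod G gs a = P n #> mprod G gs (map (\<lambda>x. x mod p ^ n) a)"
    using assms by (intro B.cs_mprod_mod) auto
  moreover have "map (\<lambda>x. x mod p ^ n) a \<in> ibox d (p ^ n)"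
    using assms p_pos by (intro map_mod_in_ibox) auto
  ultimately show ?thesis unfolding ex_def
    using the_inv_into_f_f[OF bij_betw_imp_inj_on[OF B.cs_mprod_bij[of n]]] by simp
qed

definition cfun :: "nat \<Rightarrow> nat list \<Rightarrow> 'a set \<Rightarrow> 'r" where
  "cfun n c C = of_nat (mbinom (ex n C) c)"

text \<open>The level-\<open>n\<close> approximation of the coefficient at \<open>c\<close>: the
  integral of the binomial function against the measure \<open>x (P n)\<close>.\<close>

definition clev :: "nat \<Rightarrow> nat list \<Rightarrow> ('a, 'r) rg \<Rightarrow> 'r" where
  "clev n c x = (\<Sum>C\<in>rcosets (P n). x (P n) C * cfun n c C)"

text \<open>The same number read from an operator by evaluation at the trivial coset; it is additive
  and so applies term by term to sums of monomials.\<close>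

definition cend :: "nat \<Rightarrow> nat list \<Rightarrow> ('a set, 'r) endo \<Rightarrow> 'r" where
  "cend n c A = app A (cfun n c) (P n)"

lemma cend_clev: "represents n A x \<Longrightarrow> clev n c x = cend n c A"
  by (simp add: clev_def cend_def represents_eval)

lemma cend_u:
  assumes "length a = d" shows "cend n c (opP n (mprod G gs a)) = of_nat (mbinom (map (\<lambda>x. x mod p ^ n) a) c)"
  using assms P_rcos[of n] by (simp add: cend_def app_opP cfun_def ex_cs)

end

subsection \<open>Compatible families and level coefficients\<close>

lemma mem_le_sum_list: "x \<in> set xs \<Longrightarrow> x \<le> sum_list xs" for xs :: "nat list"
  by (rule member_le_sum_list) simp_all

lemma multi_indices_ibox: "multi_indices d m \<subseteq> ibox d (Suc m)"
  by (auto simp: multi_indices_def ibox_def less_Suc_eq_le dest!: mem_le_sum_list)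

lemma finite_multi_indices [simp]: "finite (multi_indices d m)"
  using multi_indices_ibox finite_ibox by (rule finite_subset)

lemma multi_indices_mono: "m \<le> m' \<Longrightarrow> multi_indices d m \<subseteq> multi_indices d m'"
  by (auto simp: multi_indices_def)

context expansion_loc
begin

lemma pi_nz: "\<pi> \<noteq> 0" and pi_nonunit: "\<not> \<pi> dvd 1"
  using dvr by (auto simp: complete_dvr_unif_def)

lemma pi_power_form: "x \<noteq> 0 \<Longrightarrow> \<exists>v k. v dvd 1 \<and> x = v * \<pi> ^ k"
  using dvr by (auto simp: complete_dvr_unif_def)

lemma pi_pow_dvd_unit_mult:
  assumes "v dvd 1" shows "\<pi> ^ k dvd v * \<pi> ^ j \<longleftrightarrow> k \<le> j"
proof
  assume a: "\<pi> ^ k dvd v * \<pi> ^ j"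
  obtain w where w: "1 = v * w" using assms by (rule dvdE)
  have "\<pi> ^ j = v * w * \<pi> ^ j" unfolding w[symmetric] by simp
  also have "\<dots> = w * (v * \<pi> ^ j)" by (simp add: mult_ac)
  finally have kj: "\<pi> ^ k dvd \<pi> ^ j" using a by (metis dvd_mult)
  show "k \<le> j"
  proof (rule ccontr)
    assume "\<not> k \<le> j"
    then have "\<pi> ^ Suc j dvd \<pi> ^ k" by (intro le_imp_power_dvd) simp
    then have "\<pi> ^ Suc j dvd \<pi> ^ j" using kj by (rule dvd_trans)
    then have "\<pi> ^ j * \<pi> dvd \<pi> ^ j * 1" by (simp add: mult.commute)
    then show False using pi_nz pi_nonunit unfolding dvd_mult_cancel_left by simp
  qed
qed (simp add: le_imp_power_dvd dvd_mult)

lemma pi_separated: "(\<And>k. \<pi> ^ k dvd a) \<Longrightarrow> a = 0"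
proof (rule ccontr)
  assume all: "\<And>k. \<pi> ^ k dvd a" and "a \<noteq> 0"
  then obtain v j where vj: "v dvd 1" "a = v * \<pi> ^ j" using pi_power_form by blast
  have "Suc j \<le> j" using all[of "Suc j"] unfolding vj(2) pi_pow_dvd_unit_mult[OF vj(1)] .
  then show False by simp
qed

lemma pi_complete:
  fixes s :: "nat \<Rightarrow> 'r"
  assumes "\<And>k. \<exists>M. \<forall>m\<ge>M. \<forall>n\<ge>M. \<pi> ^ k dvd (s m - s n)"
  shows "\<exists>L. \<forall>k. \<exists>M. \<forall>n\<ge>M. \<pi> ^ k dvd (s n - L)"
proof -
  have "\<forall>s::nat \<Rightarrow> 'r. (\<forall>k. \<exists>M. \<forall>m\<ge>M. \<forall>n\<ge>M. \<pi> ^ k dvd (s m - s n)) \<longrightarrow>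
        (\<exists>L. \<forall>k. \<exists>M. \<forall>n\<ge>M. \<pi> ^ k dvd (s n - L))"
    using dvr unfolding complete_dvr_unif_def by (elim conjE)
  from this[rule_format, of s] assms show ?thesis by simp
qed

lemma pi_dvd_cong: "\<pi> ^ k dvd a - b \<Longrightarrow> \<pi> ^ k dvd b - c \<Longrightarrow> \<pi> ^ k dvd a - c"
  using dvd_add[of "\<pi> ^ k" "a - b" "b - c"] by simp

lemma pi_dvd_sym: "\<pi> ^ k dvd a - b \<Longrightarrow> \<pi> ^ k dvd b - a"
  using dvd_minus_iff[of "\<pi> ^ k" "a - b"] by simp

lemma pi_dvd_transfer: "\<pi> ^ k dvd a - b \<Longrightarrow> \<pi> ^ k dvd b \<Longrightarrow> \<pi> ^ k dvd a"
  using dvd_add[of "\<pi> ^ k" "a - b" b] by simp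

lemma dvd_sum_diff:
  assumes "\<And>i. i \<in> I \<Longrightarrow> (k :: 'r) dvd f i - g i" shows "k dvd sum f I - sum g I"
  unfolding sum_subtractf[symmetric] using assms by (intro dvd_sum) auto

lemma cend_add: "cend n c (A + B) = cend n c A + cend n c B" by (simp add: cend_def app_simps)
lemma cend_diff: "cend n c (A - B) = cend n c A - cend n c B" by (simp add: cend_def app_simps)
lemma cend_zero: "cend n c 0 = 0" by (simp add: cend_def app_simps)
lemma cend_sum: "cend n c (sum A I) = (\<Sum>i\<in>I. cend n c (A i))" by (simp add: cend_def app_sum)
lemma cend_of_nat: "cend n c (of_nat m * A) = of_nat m * cend n c A" by (simp add: cend_def app_of_nat_mult)
lemma cend_p_pow: "cend n c (of_nat p ^ k * A) = \<pi> ^ k * cend n c A"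
  by (simp add: cend_def app_of_nat_pow_mult pi_p)

text \<open>Modulo \<open>\<pi>\<^sup>k\<close> the functionals \<open>cend n c\<close> become dual to the ordered monomials as soon as the
  binomial function \<open>mbinom _ c\<close> is constant mod \<open>p\<^sup>k\<close> on residue classes mod \<open>p\<^sup>n\<close>. The
  values on monomials are recovered from those on group elements by inverting the unitriangular
  matrix of binomials.\<close>
lemma cend_bprod:
  assumes c: "length c = d"
  shows "\<exists>n0. \<forall>n\<ge>n0. \<forall>a. length a = d \<longrightarrow>
    \<pi> ^ k dvd cend n c (bprod (R.bvars n) a) - (if a = c then 1 else 0)"
proof -
  obtain n0 where n0: "\<And>a b. length a = length c \<Longrightarrow> length b = length c \<Longrightarrow>
    (\<And>i. i < length c \<Longrightarrow> a ! i mod p ^ n0 = b ! i mod p ^ n0) \<Longrightarrow> int p ^ k dvd int (mbinom a c) - int (mbinom b c)"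
    using mbinom_p_continuous[OF p_prime, of c k] by blast
  have "\<pi> ^ k dvd cend n c (bprod (R.bvars n) a) - (if a = c then 1 else 0)"
    if n: "n0 \<le> n" and a: "length a = d" for n a
    using a
  proof (induction "sum_list a" arbitrary: a rule: less_induct)
    case less
    define y where "y e = cend n c (bprod (R.bvars n) e) - (if e = c then 1 else 0)" for e
    define m where "m = Suc (sum_list a + sum_list c)"
    have am: "a \<in> ibox d m" "c \<in> ibox d m"
      using less.prems c by (auto simp: ibox_def m_def less_Suc_eq_le dest!: mem_le_sum_list)
    have "int p ^ k dvd int (mbinom (map (\<lambda>x. x mod p ^ n) a) c) - int (mbinom a c)"
    proof (rule n0)
      fix i assume "i < length c"
      then show "map (\<lambda>x. x mod p ^ n) a ! i mod p ^ n0 = a ! i mod p ^ n0"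
        using less.prems c n by (simp add: mod_mod_cancel le_imp_power_dvd)
    qed (use less.prems c in auto)
    then have "(of_int (int p ^ k) :: 'r) dvd of_int (int (mbinom (map (\<lambda>x. x mod p ^ n) a) c) - int (mbinom a c))"
      by (rule of_int_dvd)
    then have 1: "\<pi> ^ k dvd cend n c (opP n (mprod G gs a)) - of_nat (mbinom a c)"
      using less.prems by (simp add: cend_u pi_p)
    have 2: "cend n c (opP n (mprod G gs a)) = (\<Sum>e\<in>ibox d m. of_nat (mbinom a e) * cend n c (bprod (R.bvars n) e))"
      unfolding R.u_mprod_expand[OF am(1)] by (simp add: cend_sum cend_of_nat)
    have "(\<Sum>e\<in>ibox d m. of_nat (mbinom a e) * (if e = c then 1 else 0)) = (of_nat (mbinom a c) :: 'r)"
      using am(2) by (simp add: if_distrib sum.delta cong: if_cong)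
    then have "cend n c (opP n (mprod G gs a)) - of_nat (mbinom a c) = (\<Sum>e\<in>ibox d m. of_nat (mbinom a e) * y e)"
      unfolding 2 y_def by (simp add: right_diff_distrib sum_subtractf)
    also have "\<dots> = y a + (\<Sum>e\<in>ibox d m - {a}. of_nat (mbinom a e) * y e)"
      using am(1) by (subst sum.remove[of _ a]) (auto simp: mbinom_self)
    finally have 3: "y a = (cend n c (opP n (mprod G gs a)) - of_nat (mbinom a c)) -
        (\<Sum>e\<in>ibox d m - {a}. of_nat (mbinom a e) * y e)" by simp
    have "\<pi> ^ k dvd (\<Sum>e\<in>ibox d m - {a}. of_nat (mbinom a e) * y e)"
    proof (rule dvd_sum)
      fix e assume e: "e \<in> ibox d m - {a}"
      then have le: "length e = d" "e \<noteq> a" by (auto simp: ibox_def)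
      show "\<pi> ^ k dvd of_nat (mbinom a e) * y e"
      proof (cases "mbinom a e = 0")
        case False
        then have "sum_list e < sum_list a"
          using le less.prems by (intro sum_list_less_if_le mbinom_nonzero) auto
        then have "\<pi> ^ k dvd y e" unfolding y_def using less.hyps le by blast
        then show ?thesis by (rule dvd_mult)
      qed simp
    qed
    then have "\<pi> ^ k dvd y a" unfolding 3 using 1 by (rule dvd_diff[rotated])
    then show ?case unfolding y_def .
  qed
  then show ?thesis by blast
qed

section \<open>Compatibility between levels and the ring structure of RG\<close>

lemma refine_coset:
  assumes N: "open_normal G T N" and M: "open_normal G T M" and NM: "N \<subseteq> M" and x: "x \<in> carrier G"
  shows "M <#> (N #> x) = M #> x"
proof -
  note sN = open_normalD(2)[OF N] and sM = open_normalD(2)[OF M]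
  have "M <#> N = M"
  proof (intro equalityI subsetI)
    fix m assume "m \<in> M <#> N"
    then show "m \<in> M" using NM sM by (auto simp: set_mult_def intro: subgroup.m_closed)
  next
    fix m assume "m \<in> M"
    then have "m = m \<otimes> \<one>" using sM subgroup.mem_carrier by fastforce
    then show "m \<in> M <#> N" using \<open>m \<in> M\<close> subgroup.one_closed[OF sN] unfolding set_mult_def by blast
  qed
  then show ?thesis using setmult_rcos_assoc[of M N x] x sN sM subgroup.subset by metis
qed

lemma refine_subset_iff:
  assumes N: "open_normal G T N" and M: "open_normal G T M" and NM: "N \<subseteq> M"
    and D: "D \<in> rcosets N" and C: "C \<in> rcosets M"
  shows "D \<subseteq> C \<longleftrightarrow> M <#> D = C"
proof -
  note sN = open_normalD(2)[OF N] and sM = open_normalD(2)[OF M]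
  obtain x where x: "x \<in> carrier G" "D = N #> x" using D by (auto simp: RCOSETS_def)
  obtain y where y: "y \<in> carrier G" "C = M #> y" using C by (auto simp: RCOSETS_def)
  have e: "M <#> D = M #> x" using refine_coset[OF N M NM] x by simp
  show ?thesis
  proof
    assume "D \<subseteq> C"
    then have "x \<in> M #> y" using x y rcos_self[OF x(1) sN] by auto
    then show "M <#> D = C" using repr_independence[OF _ y(1) sM] y e by simp
  next
    assume "M <#> D = C"
    then have "C = M #> x" using e by simp
    then show "D \<subseteq> C" using NM x by (auto simp: r_coset_def)
  qed
qed

lemma refine_rcos:
  assumes N: "open_normal G T N" and M: "open_normal G T M" and NM: "N \<subseteq> M" and D: "D \<in> rcosets N"
  shows "M <#> D \<in> rcosets M"
proof -
  obtain x where x: "x \<in> carrier G" "D = N #> x" using D by (auto simp: RCOSETS_def)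
  then show ?thesis using refine_coset[OF N M NM] by (auto simp: RCOSETS_def)
qed

lemma refine_mult:
  assumes N: "open_normal G T N" and M: "open_normal G T M" and NM: "N \<subseteq> M"
    and D: "D \<in> rcosets N" and E: "E \<in> rcosets N"
  shows "M <#> (D <#> E) = (M <#> D) <#> (M <#> E)"
proof -
  obtain x where x: "x \<in> carrier G" "D = N #> x" using D by (auto simp: RCOSETS_def)
  obtain y where y: "y \<in> carrier G" "E = N #> y" using E by (auto simp: RCOSETS_def)
  show ?thesis unfolding x y using x y refine_coset[OF N M NM]
    by (simp add: normal.rcos_sum[OF open_normalD(1)[OF N]] normal.rcos_sum[OF open_normalD(1)[OF M]])
qed

text \<open>Compatibility in dual form: level \<open>M\<close> is the pushforward of level
  \<open>N\<close> along \<open>D \<mapsto> M <#> D\<close>. In this form it passes through sums and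
  products by rewriting.\<close>

lemma refine_pairing_iff:
  fixes x :: "('a, 'r) rg"
  assumes N: "open_normal G T N" and M: "open_normal G T M" and NM: "N \<subseteq> M"
  shows "(\<forall>C \<in> rcosets M. x M C = (\<Sum>D\<in>{D \<in> rcosets N. D \<subseteq> C}. x N D)) \<longleftrightarrow>
    (\<forall>f. (\<Sum>C\<in>rcosets M. x M C * f C) = (\<Sum>D\<in>rcosets N. x N D * f (M <#> D)))"
proof -
  have seteq: "{D \<in> rcosets N. D \<subseteq> C} = {D \<in> rcosets N. M <#> D = C}" if "C \<in> rcosets M" for C
    using refine_subset_iff[OF N M NM _ that] by blast
  show ?thesis
  proof (intro iffI allI ballI)
    fix f assume L: "\<forall>C \<in> rcosets M. x M C = (\<Sum>D\<in>{D \<in> rcosets N. D \<subseteq> C}. x N D)"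
    have "(\<Sum>C\<in>rcosets M. x M C * f C) = (\<Sum>C\<in>rcosets M. \<Sum>D\<in>{D \<in> rcosets N. M <#> D = C}. x N D * f (M <#> D))"
      using L by (intro sum.cong) (auto simp: seteq sum_distrib_right)
    also have "\<dots> = (\<Sum>D\<in>rcosets N. x N D * f (M <#> D))"
      using finite_rc[OF N] finite_rc[OF M] refine_rcos[OF N M NM] by (intro sum.group) auto
    finally show "(\<Sum>C\<in>rcosets M. x M C * f C) = (\<Sum>D\<in>rcosets N. x N D * f (M <#> D))" .
  next
    fix C assume R: "\<forall>f. (\<Sum>C\<in>rcosets M. x M C * f C) = (\<Sum>D\<in>rcosets N. x N D * f (M <#> D))"
      and C: "C \<in> rcosets M"
    have "x M C = (\<Sum>C'\<in>rcosets M. x M C' * (if C' = C then 1 else 0))"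
      using C finite_rc[OF M] by (simp add: if_distrib sum.delta cong: if_cong)
    also have "\<dots> = (\<Sum>D\<in>rcosets N. x N D * (if M <#> D = C then 1 else 0))"
      by (rule R[rule_format])
    also have "\<dots> = (\<Sum>D\<in>{D \<in> rcosets N. M <#> D = C}. x N D)"
      using finite_rc[OF N] by (simp add: sum.inter_filter if_distrib cong: if_cong)
    finally show "x M C = (\<Sum>D\<in>{D \<in> rcosets N. D \<subseteq> C}. x N D)" by (simp add: seteq[OF C])
  qed
qed

lemma RG_iff: "(x :: ('a, 'r) rg) \<in> RG G T \<longleftrightarrow>
    (\<forall>N. \<not> open_normal G T N \<longrightarrow> x N = (\<lambda>_. 0)) \<and>
    (\<forall>N C. open_normal G T N \<longrightarrow> C \<notin> rcosets N \<longrightarrow> x N C = 0) \<and>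
    (\<forall>N M f. open_normal G T N \<longrightarrow> open_normal G T M \<longrightarrow> N \<subseteq> M \<longrightarrow>
      (\<Sum>C\<in>rcosets M. x M C * f C) = (\<Sum>D\<in>rcosets N. x N D * f (M <#> D)))"
  unfolding RG_def using refine_pairing_iff by (simp add: Ball_def)

lemma RG_closed_part:
  assumes "(x :: ('a, 'r) rg) \<in> RG G T"
  shows "\<not> open_normal G T N \<Longrightarrow> x N C = 0"
    and "open_normal G T N \<Longrightarrow> C \<notin> rcosets N \<Longrightarrow> x N C = 0"
    and "open_normal G T N \<Longrightarrow> open_normal G T M \<Longrightarrow> N \<subseteq> M \<Longrightarrow>
      (\<Sum>C\<in>rcosets M. x M C * f C) = (\<Sum>D\<in>rcosets N. x N D * f (M <#> D))"
    and "open_normal G T N \<Longrightarrow> open_normal G T M \<Longrightarrow> N \<subseteq> M \<Longrightarrow> E \<in> rcosets M \<Longrightarrow>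
      x M E = (\<Sum>D\<in>{D \<in> rcosets N. D \<subseteq> E}. x N D)"
proof -
  note a = assms[unfolded RG_iff, THEN conjunct1] assms[unfolded RG_iff, THEN conjunct2, THEN conjunct1]
    assms[unfolded RG_iff, THEN conjunct2, THEN conjunct2]
  show "x N C = 0" if "\<not> open_normal G T N" using a(1)[rule_format, OF that] by (rule fun_cong)
  show "x N C = 0" if "open_normal G T N" "C \<notin> rcosets N" using a(2)[rule_format, OF that] .
  show "(\<Sum>C\<in>rcosets M. x M C * f C) = (\<Sum>D\<in>rcosets N. x N D * f (M <#> D))"
    if "open_normal G T N" "open_normal G T M" "N \<subseteq> M" using a(3)[rule_format, OF that] .
  show "open_normal G T N \<Longrightarrow> open_normal G T M \<Longrightarrow> N \<subseteq> M \<Longrightarrow> E \<in> rcosets M \<Longrightarrow>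
      x M E = (\<Sum>D\<in>{D \<in> rcosets N. D \<subseteq> E}. x N D)"
    using assms unfolding RG_def by blast
qed

lemma RG_I:
  assumes "\<And>N C. \<not> open_normal G T N \<Longrightarrow> x N C = (0 :: 'r)"
    and "\<And>N C. open_normal G T N \<Longrightarrow> C \<notin> rcosets N \<Longrightarrow> x N C = 0"
    and "\<And>N M f. open_normal G T N \<Longrightarrow> open_normal G T M \<Longrightarrow> N \<subseteq> M \<Longrightarrow>
      (\<Sum>C\<in>rcosets M. x M C * f C) = (\<Sum>D\<in>rcosets N. x N D * f (M <#> D))"
  shows "x \<in> RG G T"
  unfolding RG_iff using assms by (intro conjI allI impI ext) assumption+

lemma RG_add:
  assumes x: "(x :: ('a, 'r) rg) \<in> RG G T" and y: "y \<in> RG G T" shows "rg_add x y \<in> RG G T"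
proof (rule RG_I)
  fix N M f assume NM: "open_normal G T N" "open_normal G T M" "N \<subseteq> M"
  show "(\<Sum>C\<in>rcosets M. rg_add x y M C * f C) = (\<Sum>D\<in>rcosets N. rg_add x y N D * f (M <#> D))"
    unfolding rg_add_def distrib_right sum.distrib
      RG_closed_part(3)[OF x NM] RG_closed_part(3)[OF y NM] ..
qed (simp_all add: rg_add_def RG_closed_part(1,2)[OF x] RG_closed_part(1,2)[OF y])

lemma RG_smult:
  assumes x: "(x :: ('a, 'r) rg) \<in> RG G T" shows "rg_smult a x \<in> RG G T"
proof (rule RG_I)
  fix N M f assume NM: "open_normal G T N" "open_normal G T M" "N \<subseteq> M"
  show "(\<Sum>C\<in>rcosets M. rg_smult a x M C * f C) = (\<Sum>D\<in>rcosets N. rg_smult a x N D * f (M <#> D))"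
    unfolding rg_smult_def mult.assoc sum_distrib_left[symmetric] RG_closed_part(3)[OF x NM] ..
qed (simp_all add: rg_smult_def RG_closed_part(1,2)[OF x])

lemma RG_zero: "(\<lambda>N C. 0 :: 'r) \<in> RG G T"
  by (rule RG_I) simp_all

lemma RG_of: "h \<in> carrier G \<Longrightarrow> (rg_of G T h :: ('a, 'r) rg) \<in> RG G T"
  unfolding RG_iff
proof (intro conjI allI impI)
  fix N C assume "h \<in> carrier G" "open_normal G T N" "C \<notin> rcosets N"
  then show "(rg_of G T h N C :: 'r) = 0" by (auto simp: rg_of_def RCOSETS_def)
next
  fix N M and f :: "'a set \<Rightarrow> 'r"
  assume h: "h \<in> carrier G" and N: "open_normal G T N" and M: "open_normal G T M" and NM: "N \<subseteq> M"
  have f1: "(\<Sum>C\<in>rcosets K. rg_of G T h K C * g C) = g (K #> h)" if K: "open_normal G T K" for K and g :: "'a set \<Rightarrow> 'r"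
  proof -
    have "(\<Sum>C\<in>rcosets K. rg_of G T h K C * g C) = (\<Sum>C\<in>rcosets K. if C = K #> h then g C else 0)"
      using K by (intro sum.cong) (auto simp: rg_of_def)
    also have "\<dots> = g (K #> h)"
      using finite_rc[OF K] h by (subst sum.delta) (auto simp: RCOSETS_def)
    finally show ?thesis .
  qed
  show "(\<Sum>C\<in>rcosets M. rg_of G T h M C * f C) = (\<Sum>D\<in>rcosets N. rg_of G T h N D * f (M <#> D))"
    unfolding f1[OF M] f1[OF N] using refine_coset[OF N M NM h] by simp
qed (simp add: rg_of_def)

lemma RG_one: "(rg_one G T :: ('a, 'r) rg) \<in> RG G T"
  using RG_of[of \<one>] by (simp add: rg_of_one)

lemma RG_bvar: "h \<in> carrier G \<Longrightarrow> (bvar G T h :: ('a, 'r) rg) \<in> RG G T"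
proof -
  assume h: "h \<in> carrier G"
  have "(bvar G T h :: ('a, 'r) rg) = rg_add (rg_of G T h) (rg_smult (- 1) (rg_one G T))"
    by (simp add: bvar_def rg_add_def rg_smult_def)
  then show ?thesis using h by (simp add: RG_add RG_smult RG_of RG_one)
qed

lemma RG_mult:
  assumes x: "(x :: ('a, 'r) rg) \<in> RG G T" and y: "y \<in> RG G T"
  shows "rg_mult G T x y \<in> RG G T"
  unfolding RG_iff
proof (intro conjI allI impI)
  fix N assume "\<not> open_normal G T N"
  then show "rg_mult G T x y N = (\<lambda>_. 0)" by (simp add: rg_mult_def)
next
  fix N C assume N: "open_normal G T N" and "C \<notin> rcosets N"
  then have e: "{(D, E). D \<in> rcosets N \<and> E \<in> rcosets N \<and> D <#> E = C} = {}"
    using rcos_mult_closed[OF N] by auto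
  show "rg_mult G T x y N C = 0" unfolding rg_mult_def e by simp
next
  fix N M f assume N: "open_normal G T N" and M: "open_normal G T M" and NM: "N \<subseteq> M"
  have "(\<Sum>C\<in>rcosets M. rg_mult G T x y M C * f C) = (\<Sum>D\<in>rcosets M. x M D * (\<Sum>E\<in>rcosets M. y M E * f (D <#> E)))"
    by (simp add: rg_mult_pairing[OF M] sum_distrib_left mult.assoc)
  also have "\<dots> = (\<Sum>D\<in>rcosets N. x N D * (\<Sum>E\<in>rcosets M. y M E * f ((M <#> D) <#> E)))"
    by (rule RG_closed_part(3)[OF x N M NM])
  also have "\<dots> = (\<Sum>D\<in>rcosets N. x N D * (\<Sum>E\<in>rcosets N. y N E * f ((M <#> D) <#> (M <#> E))))"
    using RG_closed_part(3)[OF y N M NM] by simp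
  also have "\<dots> = (\<Sum>D\<in>rcosets N. \<Sum>E\<in>rcosets N. x N D * y N E * f (M <#> (D <#> E)))"
    by (simp add: refine_mult[OF N M NM] sum_distrib_left mult.assoc)
  also have "\<dots> = (\<Sum>D\<in>rcosets N. rg_mult G T x y N D * f (M <#> D))"
    by (rule rg_mult_pairing[OF N, symmetric])
  finally show "(\<Sum>C\<in>rcosets M. rg_mult G T x y M C * f C) = (\<Sum>D\<in>rcosets N. rg_mult G T x y N D * f (M <#> D))" .
qed

lemma RG_pow: "(x :: ('a, 'r) rg) \<in> RG G T \<Longrightarrow> rg_pow G T x k \<in> RG G T"
  by (induction k) (auto simp: rg_pow_def RG_one RG_mult)

lemma RG_bmono: "(bmono G T gs c :: ('a, 'r) rg) \<in> RG G T"
proof -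
  have "(bmono G T hs c :: ('a, 'r) rg) \<in> RG G T" if "set hs \<subseteq> carrier G" for hs
    using that
  proof (induction hs arbitrary: c)
    case (Cons h hs)
    then show ?case by (cases c) (auto simp: RG_one intro!: RG_mult RG_pow RG_bvar)
  qed (simp add: RG_one)
  then show ?thesis using gs_carrier by simp
qed

text \<open>At level \<open>P n\<close> this is the pigeonhole argument of
  \<open>bprod_p_power\<close>, and level \<open>N\<close> is a pushforward of a \<open>P n\<close>
  inside \<open>N\<close>. It makes every series in the monomials converge.\<close>

lemma bmono_divisible:
  assumes N: "open_normal G T N"
  shows "\<exists>M. \<forall>c C. length c = d \<longrightarrow> M < sum_list c \<longrightarrow> \<pi> ^ k dvd (bmono G T gs c :: ('a, 'r) rg) N C"
proof -
  obtain n where n: "P n \<subseteq> N" using P_cofinal[OF N] by blast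
  have 1: "\<pi> ^ k dvd (bmono G T gs c :: ('a, 'r) rg) (P n) D"
    if c: "length c = d" "d * (p ^ n * k) < sum_list c" and D: "D \<in> rcosets (P n)" for c D
  proof -
    obtain y where y: "bprod (R.bvars n) c = of_nat p ^ k * y" using R.bprod_p_power[OF c] by blast
    show ?thesis unfolding represents_coeff[OF represents_bmono D] y app_of_nat_pow_mult by (simp add: pi_p)
  qed
  have "\<pi> ^ k dvd (bmono G T gs c :: ('a, 'r) rg) N C"
    if c: "length c = d" "d * (p ^ n * k) < sum_list c" for c C
  proof (cases "C \<in> rcosets N")
    case True
    show ?thesis unfolding RG_closed_part(4)[OF RG_bmono P_open_normal N n True]
      using 1[OF c] by (intro dvd_sum) auto
  qed (simp add: RG_closed_part(2)[OF RG_bmono N])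
  then show ?thesis by blast
qed

text \<open>Passing from level \<open>n\<close> to level \<open>m\<close> replaces exponents modulo
  p^n by exponents modulo p^m in the binomial function, which changes its values by multiples of
  p^k.\<close>

lemma clev_cauchy:
  assumes x: "x \<in> RG G T" and c: "length c = d"
  shows "\<exists>n0. \<forall>m\<ge>n0. \<forall>n\<ge>m. \<pi> ^ k dvd clev m c x - clev n c x"
proof -
  obtain n0 where n0: "\<And>a b. length a = length c \<Longrightarrow> length b = length c \<Longrightarrow>
    (\<And>i. i < length c \<Longrightarrow> a ! i mod p ^ n0 = b ! i mod p ^ n0) \<Longrightarrow> int p ^ k dvd int (mbinom a c) - int (mbinom b c)"
    using mbinom_p_continuous[OF p_prime, of c k] by blast
  have "\<pi> ^ k dvd clev m c x - clev n c x" if m: "n0 \<le> m" and mn: "m \<le> n" for m n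
  proof -
    have nm: "P n \<subseteq> P m" using mn by (rule S.P_anti)
    have "clev m c x = (\<Sum>D\<in>rcosets (P n). x (P n) D * cfun m c (P m <#> D))"
      unfolding clev_def by (rule RG_closed_part(3)[OF x P_open_normal P_open_normal nm])
    moreover have "\<pi> ^ k dvd x (P n) D * cfun m c (P m <#> D) - x (P n) D * cfun n c D" if D: "D \<in> rcosets (P n)" for D
    proof -
      obtain z where z: "z \<in> carrier G" "D = P n #> z" using rcos_P[OF D] by blast
      obtain a where a: "length a = d" "D = P n #> mprod G gs a" using B.gs_span[OF z(1)] z by metis
      have mc: "mprod G gs a \<in> carrier G" using gs_carrier by simp
      have "P m <#> D = P m #> mprod G gs a"
        unfolding a(2) by (rule refine_coset[OF P_open_normal P_open_normal nm mc])
      then have e: "cfun m c (P m <#> D) = of_nat (mbinom (map (\<lambda>x. x mod p ^ m) a) c)"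
        "cfun n c D = of_nat (mbinom (map (\<lambda>x. x mod p ^ n) a) c)"
        using a by (simp_all add: cfun_def ex_cs)
      have "int p ^ k dvd int (mbinom (map (\<lambda>x. x mod p ^ m) a) c) - int (mbinom (map (\<lambda>x. x mod p ^ n) a) c)"
        using a c m mn by (intro n0) (auto simp: mod_mod_cancel le_imp_power_dvd)
      then have "(of_int (int p ^ k) :: 'r) dvd of_int (int (mbinom (map (\<lambda>x. x mod p ^ m) a) c) - int (mbinom (map (\<lambda>x. x mod p ^ n) a) c))"
        by (rule of_int_dvd)
      then have "\<pi> ^ k dvd cfun m c (P m <#> D) - cfun n c D" unfolding e by (simp add: pi_p)
      then show ?thesis by (simp add: right_diff_distrib[symmetric] dvd_mult)
    qed
    ultimately show ?thesis unfolding clev_def[of n] by (simp add: dvd_sum_diff)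
  qed
  then show ?thesis by blast
qed

lemma clev_limit_ex:
  assumes x: "x \<in> RG G T" and c: "length c = d"
  shows "\<exists>L. \<forall>k. \<exists>n0. \<forall>n\<ge>n0. \<pi> ^ k dvd clev n c x - L"
proof (rule pi_complete)
  fix k
  obtain n0 where n0: "\<And>m n. n0 \<le> m \<Longrightarrow> m \<le> n \<Longrightarrow> \<pi> ^ k dvd clev m c x - clev n c x"
    using clev_cauchy[OF x c, of k] by blast
  have "\<pi> ^ k dvd clev m c x - clev n c x" if "n0 \<le> m" "n0 \<le> n" for m n
    using n0[of m n] n0[of n m] that pi_dvd_sym by (cases "m \<le> n") auto
  then show "\<exists>M. \<forall>m\<ge>M. \<forall>n\<ge>M. \<pi> ^ k dvd clev m c x - clev n c x" by blast
qed

text \<open>For one group element this is the binomial expansion of the product of the (1 +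
  b_i)^(a_i). Summing over all cosets with weights \<open>x (P n)\<close> and exchanging the sums
  produces \<open>clev\<close>, so over the box the expansion is exact.\<close>

lemma level_expand:
  assumes D: "D \<in> rcosets (P n)"
  shows "x (P n) D = (\<Sum>c\<in>ibox d (p ^ n). clev n c x * bmono G T gs c (P n) D)"
proof -
  let ?I = "ibox d (p ^ n)"
  define ind where "ind = (\<lambda>C. if C = D then (1 :: 'r) else 0)"
  have mod_id: "map (\<lambda>x. x mod p ^ n) a = a" if "a \<in> ?I" for a using that by (rule map_mod_ibox)
  have len: "length a = d" if "a \<in> ?I" for a using that by (simp add: ibox_def)
  have one: "ind (P n #> mprod G gs a) = (\<Sum>c\<in>?I. of_nat (mbinom a c) * bmono G T gs c (P n) D)" if a: "a \<in> ?I" for a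
  proof -
    have "ind (P n #> mprod G gs a) = app (opP n (mprod G gs a)) ind (P n)"
      using P_rcos[of n] by (simp add: app_opP)
    also have "\<dots> = (\<Sum>c\<in>?I. of_nat (mbinom a c) * app (bprod (R.bvars n) c) ind (P n))"
      unfolding R.u_mprod_expand[OF a] by (simp add: app_sum app_of_nat_mult)
    finally show ?thesis unfolding ind_def by (simp add: represents_coeff[OF represents_bmono D])
  qed
  have "x (P n) D = (\<Sum>C\<in>rcosets (P n). x (P n) C * ind C)"
    using D by (simp add: ind_def if_distrib sum.delta cong: if_cong)
  also have "\<dots> = (\<Sum>a\<in>?I. x (P n) (P n #> mprod G gs a) * ind (P n #> mprod G gs a))"
    by (rule sum.reindex_bij_betw[OF B.cs_mprod_bij, symmetric])
  also have "\<dots> = (\<Sum>a\<in>?I. \<Sum>c\<in>?I. x (P n) (P n #> mprod G gs a) * of_nat (mbinom a c) * bmono G T gs c (P n) D)"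
    by (simp add: one sum_distrib_left mult.assoc)
  also have "\<dots> = (\<Sum>c\<in>?I. \<Sum>a\<in>?I. x (P n) (P n #> mprod G gs a) * of_nat (mbinom a c) * bmono G T gs c (P n) D)"
    by (rule sum.swap)
  also have "\<dots> = (\<Sum>c\<in>?I. clev n c x * bmono G T gs c (P n) D)"
  proof (rule sum.cong[OF refl])
    fix c
    have "clev n c x = (\<Sum>a\<in>?I. x (P n) (P n #> mprod G gs a) * cfun n c (P n #> mprod G gs a))"
      unfolding clev_def by (rule sum.reindex_bij_betw[OF B.cs_mprod_bij, symmetric])
    also have "\<dots> = (\<Sum>a\<in>?I. x (P n) (P n #> mprod G gs a) * of_nat (mbinom a c))"
      by (intro sum.cong refl) (simp add: cfun_def ex_cs len mod_id)
    finally show "(\<Sum>a\<in>?I. x (P n) (P n #> mprod G gs a) * of_nat (mbinom a c) * bmono G T gs c (P n) D) =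
        clev n c x * bmono G T gs c (P n) D" by (simp add: sum_distrib_right)
  qed
  finally show ?thesis .
qed

end

subsection \<open>Expansions and their multiplication\<close>

context expansion_loc
begin

abbreviation "mi m \<equiv> multi_indices d m"
abbreviation "bm c \<equiv> (bmono G T gs c :: ('a, 'r) rg)"

lemma mi_D: "c \<in> mi m \<Longrightarrow> length c = d" "c \<in> mi m \<Longrightarrow> sum_list c \<le> m" by (auto simp: multi_indices_def)

text \<open>The bound \<open>M\<close> comes from the monomials alone, so it serves all coefficient
  families and all cosets at once.\<close>

lemma partial_sums_stable:
  assumes N: "open_normal G T N"
  shows "\<exists>M. \<forall>m\<ge>M. \<forall>m'\<ge>M. \<forall>(l :: nat list \<Rightarrow> 'r) C. \<pi> ^ k dvd (\<Sum>c\<in>mi m. l c * bm c N C) - (\<Sum>c\<in>mi m'. l c * bm c N C)"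
proof -
  obtain M where M: "\<And>c C. length c = d \<Longrightarrow> M < sum_list c \<Longrightarrow> \<pi> ^ k dvd bm c N C"
    using bmono_divisible[OF N, of k] by blast
  have 1: "\<pi> ^ k dvd (\<Sum>c\<in>mi m. l c * bm c N C) - (\<Sum>c\<in>mi M. l c * bm c N C)"
    if m: "M \<le> m" for m C and l :: "nat list \<Rightarrow> 'r"
  proof -
    have "(\<Sum>c\<in>mi m. l c * bm c N C) - (\<Sum>c\<in>mi M. l c * bm c N C) = (\<Sum>c\<in>mi m - mi M. l c * bm c N C)"
      using multi_indices_mono[OF m] by (simp add: sum_diff)
    also have "\<pi> ^ k dvd \<dots>"
      using M by (intro dvd_sum dvd_mult) (auto simp: multi_indices_def)
    finally show ?thesis .
  qed
  show ?thesis
    by (rule exI[of _ M], intro allI impI) (rule pi_dvd_cong[OF 1 pi_dvd_sym[OF 1]])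
qed

definition lam :: "('a, 'r) rg \<Rightarrow> nat list \<Rightarrow> 'r" where
  "lam x c = (if length c = d then SOME L. \<forall>k. \<exists>n0. \<forall>n\<ge>n0. \<pi> ^ k dvd clev n c x - L else 0)"

lemma lam_limit:
  assumes "x \<in> RG G T" "length c = d"
  shows "\<exists>n0. \<forall>n\<ge>n0. \<pi> ^ k dvd clev n c x - lam x c"
proof -
  have "\<forall>k. \<exists>n0. \<forall>n\<ge>n0. \<pi> ^ k dvd clev n c x - lam x c"
    unfolding lam_def using someI_ex[OF clev_limit_ex[OF assms]] assms(2) by simp
  then show ?thesis by blast
qed

text \<open>The exact expansion at a deeper level \<open>n'\<close> is pushed down to level
  \<open>n\<close>. There monomials of large degree vanish modulo \<pi>^k, and for the finitely many
  remaining exponents \<open>clev n'\<close> is already close to its limit.\<close>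

lemma has_expansion_level:
  assumes x: "x \<in> RG G T"
  shows "\<exists>m0. \<forall>m\<ge>m0. \<forall>D. \<pi> ^ k dvd x (P n) D - (\<Sum>c\<in>mi m. lam x c * bm c (P n) D)"
proof -
  obtain M where M: "\<And>c C. length c = d \<Longrightarrow> M < sum_list c \<Longrightarrow> \<pi> ^ k dvd bm c (P n) C"
    using bmono_divisible[OF P_open_normal, of k n] by blast
  obtain M2 where M2: "\<And>m m' D l. M2 \<le> m \<Longrightarrow> M2 \<le> m' \<Longrightarrow>
      \<pi> ^ k dvd (\<Sum>c\<in>mi m. l c * bm c (P n) D) - (\<Sum>c\<in>mi m'. l c * bm c (P n) D)"
    using partial_sums_stable[OF P_open_normal[of n], of k] by blast
  define m0 where "m0 = max M M2"
  have "\<exists>n0. \<forall>c\<in>mi m0. \<forall>n'\<ge>n0. \<pi> ^ k dvd clev n' c x - lam x c"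
  proof -
    have "\<forall>c\<in>mi m0. \<exists>n0. \<forall>n'\<ge>n0. \<pi> ^ k dvd clev n' c x - lam x c"
      using lam_limit[OF x mi_D(1)] by blast
    then obtain g where g: "\<And>c n'. c \<in> mi m0 \<Longrightarrow> g c \<le> n' \<Longrightarrow> \<pi> ^ k dvd clev n' c x - lam x c" by metis
    have "g c \<le> (\<Sum>c\<in>mi m0. g c)" if "c \<in> mi m0" for c
      using that by (intro member_le_sum) auto
    then have "\<forall>c\<in>mi m0. \<forall>n'\<ge>(\<Sum>c\<in>mi m0. g c). \<pi> ^ k dvd clev n' c x - lam x c"
      using g order_trans by blast
    then show ?thesis by blast
  qed
  then obtain n0 where n0: "\<And>c n'. c \<in> mi m0 \<Longrightarrow> n0 \<le> n' \<Longrightarrow> \<pi> ^ k dvd clev n' c x - lam x c" by blast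
  \<comment> \<open>Because \<open>n' < p ^ n'\<close>, the box at level \<open>n'\<close> contains
    every exponent vector of degree at most \<open>m0\<close>.\<close>
  define n' where "n' = max n (max n0 m0)"
  have n': "n \<le> n'" "n0 \<le> n'" "m0 < p ^ n'"
  proof -
    have "n' < p ^ n'" using B.p_gt1 by (simp add: power_gt_expt)
    then show "n \<le> n'" "n0 \<le> n'" "m0 < p ^ n'" unfolding n'_def by auto
  qed
  have Pn: "P n' \<subseteq> P n" using n'(1) by (rule S.P_anti)
  have mi_sub: "mi m0 \<subseteq> ibox d (p ^ n')"
  proof -
    have "ibox d (Suc m0) \<subseteq> ibox d (p ^ n')" using n'(3) by (fastforce simp: ibox_def)
    then show ?thesis using multi_indices_ibox by (rule subset_trans[rotated])
  qed
  have main: "\<pi> ^ k dvd x (P n) D - (\<Sum>c\<in>mi m0. lam x c * bm c (P n) D)" for D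
  proof (cases "D \<in> rcosets (P n)")
    case True
    have "x (P n) D = (\<Sum>E\<in>{E \<in> rcosets (P n'). E \<subseteq> D}. x (P n') E)"
      by (rule RG_closed_part(4)[OF x P_open_normal P_open_normal Pn True])
    also have "\<dots> = (\<Sum>E\<in>{E \<in> rcosets (P n'). E \<subseteq> D}. \<Sum>c\<in>ibox d (p ^ n'). clev n' c x * bm c (P n') E)"
      by (intro sum.cong refl level_expand) auto
    also have "\<dots> = (\<Sum>c\<in>ibox d (p ^ n'). clev n' c x * (\<Sum>E\<in>{E \<in> rcosets (P n'). E \<subseteq> D}. bm c (P n') E))"
      by (subst sum.swap) (simp add: sum_distrib_left)
    also have "\<dots> = (\<Sum>c\<in>ibox d (p ^ n'). clev n' c x * bm c (P n) D)"
      by (simp add: RG_closed_part(4)[OF RG_bmono P_open_normal P_open_normal Pn True])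
    also have "\<dots> = (\<Sum>c\<in>mi m0. clev n' c x * bm c (P n) D) + (\<Sum>c\<in>ibox d (p ^ n') - mi m0. clev n' c x * bm c (P n) D)"
      using mi_sub by (subst sum.subset_diff[of "mi m0"]) auto
    finally have e: "x (P n) D = (\<Sum>c\<in>mi m0. clev n' c x * bm c (P n) D) +
        (\<Sum>c\<in>ibox d (p ^ n') - mi m0. clev n' c x * bm c (P n) D)" .
    have "\<pi> ^ k dvd (\<Sum>c\<in>ibox d (p ^ n') - mi m0. clev n' c x * bm c (P n) D)"
    proof (intro dvd_sum dvd_mult)
      fix c assume "c \<in> ibox d (p ^ n') - mi m0"
      then have "length c = d" "M < sum_list c" by (auto simp: ibox_def multi_indices_def m0_def)
      then show "\<pi> ^ k dvd bm c (P n) D" by (rule M)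
    qed
    moreover have "\<pi> ^ k dvd (\<Sum>c\<in>mi m0. clev n' c x * bm c (P n) D) - (\<Sum>c\<in>mi m0. lam x c * bm c (P n) D)"
      using n0[OF _ n'(2)] by (intro dvd_sum_diff) (simp add: left_diff_distrib[symmetric] dvd_mult2)
    ultimately have "\<pi> ^ k dvd ((\<Sum>c\<in>mi m0. clev n' c x * bm c (P n) D) - (\<Sum>c\<in>mi m0. lam x c * bm c (P n) D)) +
        (\<Sum>c\<in>ibox d (p ^ n') - mi m0. clev n' c x * bm c (P n) D)" by (intro dvd_add)
    then show ?thesis unfolding e by (simp add: algebra_simps)
  qed (simp add: RG_closed_part(2)[OF x P_open_normal] RG_closed_part(2)[OF RG_bmono P_open_normal])
  have "\<pi> ^ k dvd x (P n) D - (\<Sum>c\<in>mi m. lam x c * bm c (P n) D)" if "m0 \<le> m" for m D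
    using main[of D] M2[of m0 m] that by (intro pi_dvd_cong[OF main M2]) (auto simp: m0_def)
  then show ?thesis by blast
qed

lemma has_expansion_lam:
  assumes x: "x \<in> RG G T" shows "has_expansion \<pi> G T gs x (lam x)"
  unfolding has_expansion_def
proof (intro conjI allI impI)
  show "lam x c = 0" if "length c \<noteq> d" for c using that by (simp add: lam_def)
  fix N k assume N: "open_normal G T N"
  obtain n where n: "P n \<subseteq> N" using P_cofinal[OF N] by blast
  obtain m0 where m0: "\<And>m D. m0 \<le> m \<Longrightarrow> \<pi> ^ k dvd x (P n) D - (\<Sum>c\<in>mi m. lam x c * bm c (P n) D)"
    using has_expansion_level[OF x, of k n] by blast
  have "\<pi> ^ k dvd x N C - (\<Sum>c\<in>mi m. lam x c * bm c N C)" if "m0 \<le> m" for m C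
  proof (cases "C \<in> rcosets N")
    case True
    let ?E = "{E \<in> rcosets (P n). E \<subseteq> C}"
    have "(\<Sum>c\<in>mi m. lam x c * bm c N C) = (\<Sum>c\<in>mi m. \<Sum>E\<in>?E. lam x c * bm c (P n) E)"
      by (simp add: RG_closed_part(4)[OF RG_bmono P_open_normal N n True] sum_distrib_left)
    also have "\<dots> = (\<Sum>E\<in>?E. \<Sum>c\<in>mi m. lam x c * bm c (P n) E)" by (rule sum.swap)
    finally show ?thesis unfolding RG_closed_part(4)[OF x P_open_normal N n True]
      using m0[OF that] by (simp add: dvd_sum_diff)
  qed (simp add: RG_closed_part(2)[OF x N] RG_closed_part(2)[OF RG_bmono N])
  then show "\<exists>n0. \<forall>n\<ge>n0. \<forall>C. \<pi> ^ k dvd x N C - (\<Sum>c\<in>mi n. lam x c * bm c N C)" by blast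
qed

lemma has_expansionD:
  assumes "has_expansion \<pi> G T gs x l" "open_normal G T N"
  shows "\<exists>m0. \<forall>m\<ge>m0. \<forall>C. \<pi> ^ k dvd x N C - (\<Sum>c\<in>mi m. l c * bm c N C)"
  using assms unfolding has_expansion_def by blast

text \<open>Pairing a truncated expansion with the binomial function isolates \<open>l c\<close> by
  \<open>cend_bprod\<close>. The level is independent of \<open>x\<close> and \<open>l\<close>, so
  two expansions can be compared at the same one.\<close>

lemma expansion_clev:
  assumes c: "length c = d"
  shows "\<exists>n0. \<forall>n\<ge>n0. \<forall>x l. has_expansion \<pi> G T gs x l \<longrightarrow> \<pi> ^ k dvd clev n c x - l c"
proof -
  obtain n0 where n0: "\<And>n a. n0 \<le> n \<Longrightarrow> length a = d \<Longrightarrow>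
      \<pi> ^ k dvd cend n c (bprod (R.bvars n) a) - (if a = c then 1 else 0)"
    using cend_bprod[OF c, of k] by blast
  have "\<pi> ^ k dvd clev n c x - l c" if n: "n0 \<le> n" and x: "has_expansion \<pi> G T gs x l" for n x l
  proof -
    obtain m0 where m0: "\<And>m C. m0 \<le> m \<Longrightarrow> \<pi> ^ k dvd x (P n) C - (\<Sum>a\<in>mi m. l a * bm a (P n) C)"
      using has_expansionD[OF x P_open_normal] by blast
    define m where "m = max m0 (sum_list c)"
    have cm: "c \<in> mi m" using c by (simp add: multi_indices_def m_def)
    have h1: "\<pi> ^ k dvd clev n c x - (\<Sum>C\<in>rcosets (P n). (\<Sum>a\<in>mi m. l a * bm a (P n) C) * cfun n c C)"
      unfolding clev_def using m0[of m]
      by (intro dvd_sum_diff) (simp add: left_diff_distrib[symmetric] dvd_mult2 m_def)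
    have h2: "(\<Sum>C\<in>rcosets (P n). (\<Sum>a\<in>mi m. l a * bm a (P n) C) * cfun n c C) =
        (\<Sum>a\<in>mi m. l a * clev n c (bm a))"
      unfolding clev_def by (simp add: sum_distrib_right sum_distrib_left mult.assoc) (rule sum.swap)
    have h3: "\<pi> ^ k dvd (\<Sum>a\<in>mi m. l a * clev n c (bm a)) - (\<Sum>a\<in>mi m. l a * (if a = c then 1 else 0))"
      using n0[OF n mi_D(1)]
      by (intro dvd_sum_diff) (simp only: right_diff_distrib[symmetric] cend_clev[OF represents_bmono] dvd_mult)
    have h4: "(\<Sum>a\<in>mi m. l a * (if a = c then 1 else 0)) = l c"
      using cm by (simp add: if_distrib sum.delta cong: if_cong)
    show ?thesis by (rule pi_dvd_cong[OF h1[unfolded h2] h3[unfolded h4]])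
  qed
  then show ?thesis by blast
qed

lemma expansion_unique:
  assumes "has_expansion \<pi> G T gs x l" "has_expansion \<pi> G T gs x l'"
  shows "l = l'"
proof
  fix c show "l c = l' c"
  proof (cases "length c = d")
    case True
    have "\<pi> ^ k dvd l c - l' c" for k
    proof -
      obtain n where "\<pi> ^ k dvd clev n c x - l c" "\<pi> ^ k dvd clev n c x - l' c"
        using expansion_clev[OF True, of k] assms by blast
      then show ?thesis using pi_dvd_cong pi_dvd_sym by blast
    qed
    then show ?thesis using pi_separated[of "l c - l' c"] by simp
  next
    case False
    then show ?thesis using assms by (simp add: has_expansion_def)
  qed
qed

lemma coeffs_eqI: "has_expansion \<pi> G T gs x l \<Longrightarrow> coeffs \<pi> G T gs x = l"
  unfolding coeffs_def using expansion_unique by blast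

abbreviation "cf x \<equiv> coeffs \<pi> G T gs x"

lemma has_expansion_cf: "x \<in> RG G T \<Longrightarrow> has_expansion \<pi> G T gs x (cf x)"
  using has_expansion_lam coeffs_eqI by metis

lemma cf_support: "x \<in> RG G T \<Longrightarrow> length c \<noteq> d \<Longrightarrow> cf x c = 0"
  using has_expansion_cf by (simp add: has_expansion_def)

lemma has_expansion_add:
  assumes "has_expansion \<pi> G T gs x l" "has_expansion \<pi> G T gs y l'"
  shows "has_expansion \<pi> G T gs (rg_add x y) (\<lambda>c. l c + l' c)"
  unfolding has_expansion_def
proof (intro conjI allI impI)
  show "l c + l' c = 0" if "length c \<noteq> d" for c using that assms by (simp add: has_expansion_def)
  fix N k assume N: "open_normal G T N"
  obtain m where m: "\<And>n C. m \<le> n \<Longrightarrow> \<pi> ^ k dvd x N C - (\<Sum>c\<in>mi n. l c * bm c N C)"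
    using has_expansionD[OF assms(1) N] by blast
  obtain m' where m': "\<And>n C. m' \<le> n \<Longrightarrow> \<pi> ^ k dvd y N C - (\<Sum>c\<in>mi n. l' c * bm c N C)"
    using has_expansionD[OF assms(2) N] by blast
  have "\<pi> ^ k dvd rg_add x y N C - (\<Sum>c\<in>mi n. (l c + l' c) * bm c N C)" if "max m m' \<le> n" for n C
  proof -
    have "\<pi> ^ k dvd (x N C - (\<Sum>c\<in>mi n. l c * bm c N C)) + (y N C - (\<Sum>c\<in>mi n. l' c * bm c N C))"
      using that by (intro dvd_add m m') auto
    then show ?thesis by (simp add: rg_add_def distrib_right sum.distrib algebra_simps)
  qed
  then show "\<exists>n0. \<forall>n\<ge>n0. \<forall>C. \<pi> ^ k dvd rg_add x y N C - (\<Sum>c\<in>mi n. (l c + l' c) * bm c N C)" by blast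
qed

lemma has_expansion_smult:
  assumes "has_expansion \<pi> G T gs x l"
  shows "has_expansion \<pi> G T gs (rg_smult a x) (\<lambda>c. a * l c)"
  unfolding has_expansion_def
proof (intro conjI allI impI)
  show "a * l c = 0" if "length c \<noteq> d" for c using that assms by (simp add: has_expansion_def)
  fix N k assume N: "open_normal G T N"
  obtain m where m: "\<And>n C. m \<le> n \<Longrightarrow> \<pi> ^ k dvd x N C - (\<Sum>c\<in>mi n. l c * bm c N C)"
    using has_expansionD[OF assms(1) N] by blast
  have "\<pi> ^ k dvd rg_smult a x N C - (\<Sum>c\<in>mi n. (a * l c) * bm c N C)" if "m \<le> n" for n C
  proof -
    have "\<pi> ^ k dvd a * (x N C - (\<Sum>c\<in>mi n. l c * bm c N C))" using m[OF that] by (rule dvd_mult)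
    then show ?thesis by (simp add: rg_smult_def right_diff_distrib sum_distrib_left mult.assoc)
  qed
  then show "\<exists>n0. \<forall>n\<ge>n0. \<forall>C. \<pi> ^ k dvd rg_smult a x N C - (\<Sum>c\<in>mi n. (a * l c) * bm c N C)" by blast
qed

lemma cf_add: "x \<in> RG G T \<Longrightarrow> y \<in> RG G T \<Longrightarrow> cf (rg_add x y) = (\<lambda>c. cf x c + cf y c)"
  by (intro coeffs_eqI has_expansion_add has_expansion_cf)

lemma cf_smult: "x \<in> RG G T \<Longrightarrow> cf (rg_smult a x) = (\<lambda>c. a * cf x c)"
  by (intro coeffs_eqI has_expansion_smult has_expansion_cf)

lemma RG_eqI:
  assumes x: "x \<in> RG G T" and y: "y \<in> RG G T" and e: "cf x = cf y" shows "x = y"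
proof (intro ext)
  fix N C show "x N C = y N C"
  proof (cases "open_normal G T N")
    case True
    have "\<pi> ^ k dvd x N C - y N C" for k
    proof -
      obtain m where m: "\<And>n C. m \<le> n \<Longrightarrow> \<pi> ^ k dvd x N C - (\<Sum>c\<in>mi n. cf x c * bm c N C)"
        using has_expansionD[OF has_expansion_cf[OF x] True] by blast
      obtain m' where m': "\<And>n C. m' \<le> n \<Longrightarrow> \<pi> ^ k dvd y N C - (\<Sum>c\<in>mi n. cf y c * bm c N C)"
        using has_expansionD[OF has_expansion_cf[OF y] True] by blast
      show ?thesis
        by (rule pi_dvd_cong[OF m[of "max m m'" C, unfolded e] pi_dvd_sym[OF m'[of "max m m'" C]]]) simp_all
    qed
    then show ?thesis using pi_separated[of "x N C - y N C"] by simp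
  qed (simp add: RG_closed_part(1)[OF x] RG_closed_part(1)[OF y])
qed

text \<open>The series converges at each level by \<open>partial_sums_stable\<close>, and
  compatibility between levels passes to the limit because it holds for every monomial.\<close>

lemma RG_of_coeffs:
  assumes l: "\<And>c. length c \<noteq> d \<Longrightarrow> l c = (0 :: 'r)"
  shows "\<exists>x\<in>RG G T. cf x = l"
proof -
  define s where "s N C m = (\<Sum>c\<in>mi m. l c * bm c N C)" for N C m
  have "\<exists>L. open_normal G T N \<longrightarrow> (\<forall>k. \<exists>M. \<forall>m\<ge>M. \<pi> ^ k dvd s N C m - L)" for N C
  proof (cases "open_normal G T N")
    case True
    have "\<exists>L. \<forall>k. \<exists>M. \<forall>m\<ge>M. \<pi> ^ k dvd s N C m - L"
    proof (rule pi_complete)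
      fix k
      obtain M where "\<And>m m' l C. M \<le> m \<Longrightarrow> M \<le> m' \<Longrightarrow>
          \<pi> ^ k dvd (\<Sum>c\<in>mi m. l c * bm c N C) - (\<Sum>c\<in>mi m'. l c * bm c N C)"
        using partial_sums_stable[OF True, of k] by blast
      then show "\<exists>M. \<forall>m\<ge>M. \<forall>n\<ge>M. \<pi> ^ k dvd s N C m - s N C n"
        unfolding s_def by (intro exI[of _ M]) simp
    qed
    then show ?thesis by blast
  qed simp
  then obtain L where L: "\<And>N C k. open_normal G T N \<Longrightarrow> \<exists>M. \<forall>m\<ge>M. \<pi> ^ k dvd s N C m - L N C" by metis
  define x where "x N C = (if open_normal G T N then L N C else 0)" for N C
  have lim: "\<exists>M. \<forall>m\<ge>M. \<forall>C. \<pi> ^ k dvd x N C - s N C m" if N: "open_normal G T N" for N k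
  proof -
    obtain M where M: "\<And>m m' C. M \<le> m \<Longrightarrow> M \<le> m' \<Longrightarrow> \<pi> ^ k dvd s N C m - s N C m'"
      using partial_sums_stable[OF N, of k] unfolding s_def by blast
    have "\<pi> ^ k dvd x N C - s N C m" if m: "M \<le> m" for m C
    proof -
      obtain M' where M': "\<And>m. M' \<le> m \<Longrightarrow> \<pi> ^ k dvd s N C m - L N C" using L[OF N] by blast
      have 1: "\<pi> ^ k dvd L N C - s N C (max M M')" by (rule pi_dvd_sym[OF M']) simp
      have 2: "\<pi> ^ k dvd s N C (max M M') - s N C m" by (rule M) (use m in simp_all)
      have "x N C = L N C" using N by (simp add: x_def)
      then show ?thesis using pi_dvd_cong[OF 1 2] by (simp only:)
    qed
    then show ?thesis by blast
  qed
  have "x \<in> RG G T"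
  proof (rule RG_I)
    show "x N C = 0" if "\<not> open_normal G T N" for N C using that by (simp add: x_def)
    show "x N C = 0" if N: "open_normal G T N" and C: "C \<notin> rcosets N" for N C
    proof (rule pi_separated)
      fix k
      obtain M where M: "\<pi> ^ k dvd x N C - s N C M" using lim[OF N, of k] by blast
      moreover have "s N C M = 0" unfolding s_def using RG_closed_part(2)[OF RG_bmono N C] by simp
      ultimately show "\<pi> ^ k dvd x N C" by simp
    qed
    fix N M f assume N: "open_normal G T N" and M: "open_normal G T M" and NM: "N \<subseteq> M"
    let ?l = "\<Sum>C\<in>rcosets M. x M C * f C" and ?r = "\<Sum>D\<in>rcosets N. x N D * f (M <#> D)"
    have "?l - ?r = 0"
    proof (rule pi_separated)
      fix k
      obtain m1 where m1: "\<And>m C. m1 \<le> m \<Longrightarrow> \<pi> ^ k dvd x M C - s M C m" using lim[OF M, of k] by blast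
      obtain m2 where m2: "\<And>m C. m2 \<le> m \<Longrightarrow> \<pi> ^ k dvd x N C - s N C m" using lim[OF N, of k] by blast
      let ?m = "max m1 m2"
      have 1: "\<pi> ^ k dvd ?l - (\<Sum>C\<in>rcosets M. s M C ?m * f C)"
        using m1[of ?m] by (intro dvd_sum_diff) (simp add: left_diff_distrib[symmetric] dvd_mult2)
      have 2: "\<pi> ^ k dvd ?r - (\<Sum>D\<in>rcosets N. s N D ?m * f (M <#> D))"
        using m2[of ?m] by (intro dvd_sum_diff) (simp add: left_diff_distrib[symmetric] dvd_mult2)
      have "(\<Sum>C\<in>rcosets M. s M C ?m * f C) = (\<Sum>c\<in>mi ?m. l c * (\<Sum>C\<in>rcosets M. bm c M C * f C))"
        unfolding s_def by (simp add: sum_distrib_right sum_distrib_left mult.assoc) (rule sum.swap)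
      also have "\<dots> = (\<Sum>c\<in>mi ?m. l c * (\<Sum>D\<in>rcosets N. bm c N D * f (M <#> D)))"
        unfolding RG_closed_part(3)[OF RG_bmono N M NM] ..
      also have "\<dots> = (\<Sum>D\<in>rcosets N. s N D ?m * f (M <#> D))"
        unfolding s_def by (simp add: sum_distrib_right sum_distrib_left mult.assoc) (rule sum.swap)
      finally have 3: "(\<Sum>C\<in>rcosets M. s M C ?m * f C) = (\<Sum>D\<in>rcosets N. s N D ?m * f (M <#> D))" .
      show "\<pi> ^ k dvd ?l - ?r" by (rule pi_dvd_cong[OF 1[unfolded 3] pi_dvd_sym[OF 2]])
    qed
    then show "?l = ?r" by simp
  qed
  moreover have "has_expansion \<pi> G T gs x l"
    unfolding has_expansion_def using l lim by (auto simp: s_def)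
  ultimately show ?thesis using coeffs_eqI by blast
qed

text \<open>Modulo \<pi>^k only the generators p^a b^c with this very exponent \<open>c\<close>
  contribute, and membership in \<open>F\<close> forces 2a to be at least D - |c|.\<close>

lemma cend_F:
  assumes c: "length c = d"
    and n: "\<And>a. length a = d \<Longrightarrow> \<pi> ^ k dvd cend n c (bprod (R.bvars n) a) - (if a = c then 1 else 0)"
    and f: "f \<in> R.F n D"
  shows "\<exists>r. \<pi> ^ k dvd cend n c f - \<pi> ^ ((Suc D - sum_list c) div 2) * r"
  using f unfolding R.F_def
proof (induction rule: aspan.induct)
  case zero show ?case by (rule exI[of _ 0]) (simp add: cend_zero)
next
  \<comment> \<open>Half of \<open>D - sum_list c\<close>, rounded up; truncated subtraction makes
    it 0 when the degree of \<open>c\<close> exceeds \<open>D\<close>.\<close>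
  let ?s = "(Suc D - sum_list c) div 2"
  have *: "\<exists>r. \<pi> ^ k dvd cend n c x - \<pi> ^ ?s * r"
    if g: "x \<in> {of_nat p ^ a * bprod (R.bvars n) c | a c. length c = d \<and> D \<le> 2 * a + sum_list c}" for x
  proof -
    obtain a e where x: "x = of_nat p ^ a * bprod (R.bvars n) e" "length e = d" "D \<le> 2 * a + sum_list e"
      using g by blast
    have dv: "\<pi> ^ k dvd \<pi> ^ a * (cend n c (bprod (R.bvars n) e) - (if e = c then 1 else 0))"
      using n[OF x(2)] by (rule dvd_mult)
    show ?thesis
    proof (cases "e = c")
      case True
      have "?s \<le> a" using x(3) True by simp
      then have pa: "\<pi> ^ ?s * \<pi> ^ (a - ?s) = \<pi> ^ a" by (simp flip: power_add)
      have "cend n c x - \<pi> ^ ?s * \<pi> ^ (a - ?s) = \<pi> ^ a * (cend n c (bprod (R.bvars n) e) - (if e = c then 1 else 0))"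
        unfolding pa x(1) cend_p_pow using True by (simp add: right_diff_distrib)
      then show ?thesis using dv by metis
    next
      case False
      then show ?thesis using dv unfolding x(1) by (intro exI[of _ 0]) (simp add: cend_p_pow)
    qed
  qed
  { case (plus x y)
    then obtain r r' where "\<pi> ^ k dvd cend n c x - \<pi> ^ ?s * r" "\<pi> ^ k dvd cend n c y - \<pi> ^ ?s * r'"
      using *[OF plus(1)] by blast
    then have "\<pi> ^ k dvd (cend n c y - \<pi> ^ ?s * r') + (cend n c x - \<pi> ^ ?s * r)" by (rule dvd_add[rotated])
    then show ?case by (intro exI[of _ "r' + r"]) (simp add: cend_add algebra_simps) }
  { case (minus x y)
    then obtain r r' where "\<pi> ^ k dvd cend n c x - \<pi> ^ ?s * r" "\<pi> ^ k dvd cend n c y - \<pi> ^ ?s * r'"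
      using *[OF minus(1)] by blast
    then have "\<pi> ^ k dvd (cend n c y - \<pi> ^ ?s * r') - (cend n c x - \<pi> ^ ?s * r)" by (rule dvd_diff[rotated])
    then show ?case by (intro exI[of _ "r' - r"]) (simp add: cend_diff algebra_simps) }
qed

definition gap :: "nat list \<Rightarrow> nat list \<Rightarrow> nat list \<Rightarrow> nat" where
  "gap a b c = (Suc (Suc (sum_list a + sum_list b)) - sum_list c) div 2"

text \<open>\<open>gap a b c\<close> is the rounded up half of \<open>\<bar>a\<bar> + \<bar>b\<bar> + 1 - \<bar>c\<bar>\<close>, so the correction terms of
  \<open>\<^bold>b\<^sup>a \<^bold>b\<^sup>b = \<^bold>b\<^sup>a\<^sup>+\<^sup>b + \<dots>\<close> contribute a multiple of \<open>\<pi>\<close> to that power at \<open>\<^bold>b\<^sup>c\<close>.\<close>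
lemma cf_mult:
  assumes x: "x \<in> RG G T" and y: "y \<in> RG G T" and c: "length c = d"
    and small: "\<And>a b. length a = d \<Longrightarrow> length b = d \<Longrightarrow> \<pi> ^ k dvd cf x a * cf y b * \<pi> ^ gap a b c"
  shows "\<pi> ^ k dvd cf (rg_mult G T x y) c -
    (\<Sum>(a, b)\<in>{(a, b). length a = d \<and> length b = d \<and> map2 (+) a b = c}. cf x a * cf y b)"
proof -
  let ?z = "rg_mult G T x y"
  have z: "?z \<in> RG G T" using x y by (rule RG_mult)
  obtain n1 where n1: "\<And>n. n1 \<le> n \<Longrightarrow> \<pi> ^ k dvd clev n c ?z - cf ?z c"
    using expansion_clev[OF c, of k] has_expansion_cf[OF z] by blast
  obtain n2 where n2: "\<And>n a. n2 \<le> n \<Longrightarrow> length a = d \<Longrightarrow>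
      \<pi> ^ k dvd cend n c (bprod (R.bvars n) a) - (if a = c then 1 else 0)"
    using cend_bprod[OF c, of k] by blast
  define n where "n = max n1 n2"
  have n1': "\<pi> ^ k dvd clev n c ?z - cf ?z c" using n1 by (simp add: n_def)
  have n2': "\<And>a. length a = d \<Longrightarrow> \<pi> ^ k dvd cend n c (bprod (R.bvars n) a) - (if a = c then 1 else 0)"
    using n2 by (simp add: n_def)
  obtain m1 where m1: "\<And>m C. m1 \<le> m \<Longrightarrow> \<pi> ^ k dvd x (P n) C - (\<Sum>a\<in>mi m. cf x a * bm a (P n) C)"
    using has_expansionD[OF has_expansion_cf[OF x] P_open_normal] by blast
  obtain m2 where m2: "\<And>m C. m2 \<le> m \<Longrightarrow> \<pi> ^ k dvd y (P n) C - (\<Sum>a\<in>mi m. cf y a * bm a (P n) C)"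
    using has_expansionD[OF has_expansion_cf[OF y] P_open_normal] by blast
  \<comment> \<open>Including \<open>sum_list c\<close> keeps every splitting of \<open>c\<close>
    into \<open>a\<close> and \<open>b\<close> inside the truncated sums.\<close>
  define m where "m = max (sum_list c) (max m1 m2)"
  define Xs where "Xs C = (\<Sum>a\<in>mi m. cf x a * bm a (P n) C)" for C
  define Ys where "Ys C = (\<Sum>a\<in>mi m. cf y a * bm a (P n) C)" for C
  have xX: "\<pi> ^ k dvd x (P n) C - Xs C" and yY: "\<pi> ^ k dvd y (P n) C - Ys C" for C
    unfolding Xs_def Ys_def using m1 m2 by (auto simp: m_def)
  let ?H = "rcosets (P n)"
  have "clev n c ?z = (\<Sum>D\<in>?H. \<Sum>E\<in>?H. x (P n) D * y (P n) E * cfun n c (D <#> E))"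
    unfolding clev_def by (rule rg_mult_pairing[OF P_open_normal])
  moreover have "\<pi> ^ k dvd x (P n) D * y (P n) E * cfun n c (D <#> E) - Xs D * Ys E * cfun n c (D <#> E)" for D E
  proof -
    have "x (P n) D * y (P n) E * cfun n c (D <#> E) - Xs D * Ys E * cfun n c (D <#> E) =
      ((x (P n) D - Xs D) * y (P n) E + Xs D * (y (P n) E - Ys E)) * cfun n c (D <#> E)"
      by (simp add: algebra_simps)
    then show ?thesis using xX yY by (simp only: dvd_mult2 dvd_mult dvd_add)
  qed
  ultimately have 1: "\<pi> ^ k dvd clev n c ?z - (\<Sum>D\<in>?H. \<Sum>E\<in>?H. Xs D * Ys E * cfun n c (D <#> E))"
    by (simp only: dvd_sum_diff)
  have "(\<Sum>D\<in>?H. \<Sum>E\<in>?H. Xs D * Ys E * cfun n c (D <#> E)) =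
     (\<Sum>D\<in>?H. \<Sum>E\<in>?H. \<Sum>a\<in>mi m. \<Sum>b\<in>mi m. cf x a * cf y b * (bm a (P n) D * bm b (P n) E * cfun n c (D <#> E)))"
    unfolding Xs_def Ys_def sum_product by (simp add: sum_distrib_right sum_distrib_left mult_ac)
  also have "\<dots> = (\<Sum>D\<in>?H. \<Sum>a\<in>mi m. \<Sum>b\<in>mi m. \<Sum>E\<in>?H. cf x a * cf y b * (bm a (P n) D * bm b (P n) E * cfun n c (D <#> E)))"
  proof (rule sum.cong[OF refl])
    fix D
    show "(\<Sum>E\<in>?H. \<Sum>a\<in>mi m. \<Sum>b\<in>mi m. cf x a * cf y b * (bm a (P n) D * bm b (P n) E * cfun n c (D <#> E))) =
      (\<Sum>a\<in>mi m. \<Sum>b\<in>mi m. \<Sum>E\<in>?H. cf x a * cf y b * (bm a (P n) D * bm b (P n) E * cfun n c (D <#> E)))"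
      by (subst sum.swap, intro sum.cong refl, rule sum.swap)
  qed
  also have "\<dots> = (\<Sum>a\<in>mi m. \<Sum>b\<in>mi m. \<Sum>D\<in>?H. \<Sum>E\<in>?H. cf x a * cf y b * (bm a (P n) D * bm b (P n) E * cfun n c (D <#> E)))"
    by (subst sum.swap, intro sum.cong refl, rule sum.swap)
  also have "\<dots> = (\<Sum>a\<in>mi m. \<Sum>b\<in>mi m. cf x a * cf y b * cend n c (bprod (R.bvars n) a * bprod (R.bvars n) b))"
  proof (intro sum.cong refl)
    fix a b
    have "cend n c (bprod (R.bvars n) a * bprod (R.bvars n) b) = clev n c (rg_mult G T (bm a) (bm b))"
      by (rule cend_clev[symmetric]) (intro represents_mult represents_bmono)
    also have "\<dots> = (\<Sum>D\<in>?H. \<Sum>E\<in>?H. bm a (P n) D * bm b (P n) E * cfun n c (D <#> E))"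
      unfolding clev_def by (rule rg_mult_pairing[OF P_open_normal])
    finally show "(\<Sum>D\<in>?H. \<Sum>E\<in>?H. cf x a * cf y b * (bm a (P n) D * bm b (P n) E * cfun n c (D <#> E))) =
       cf x a * cf y b * cend n c (bprod (R.bvars n) a * bprod (R.bvars n) b)"
      by (simp add: sum_distrib_left)
  qed
  finally have 2: "(\<Sum>D\<in>?H. \<Sum>E\<in>?H. Xs D * Ys E * cfun n c (D <#> E)) =
    (\<Sum>a\<in>mi m. \<Sum>b\<in>mi m. cf x a * cf y b * cend n c (bprod (R.bvars n) a * bprod (R.bvars n) b))" .
  have 3: "\<pi> ^ k dvd cf x a * cf y b * cend n c (bprod (R.bvars n) a * bprod (R.bvars n) b) -
      cf x a * cf y b * (if map2 (+) a b = c then 1 else 0)" if ab: "length a = d" "length b = d" for a b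
  proof -
    obtain f w where fw: "f \<in> R.F n (Suc (sum_list a + sum_list b))"
      "bprod (R.bvars n) a * bprod (R.bvars n) b = bprod (R.bvars n) (map2 (+) a b) + f + of_nat p ^ k * w"
      using R.bprod_mult[OF ab, of n k] by blast
    obtain r where r: "\<pi> ^ k dvd cend n c f - \<pi> ^ gap a b c * r"
      using cend_F[OF c n2' fw(1)] unfolding gap_def by blast
    let ?\<Lambda> = "cf x a * cf y b" and ?B = "cend n c (bprod (R.bvars n) (map2 (+) a b))"
    \<comment> \<open>Four errors: imperfect duality at \<open>map2 (+) a b\<close>, the
      approximation of the coefficient of \<open>f\<close>, its main part, which
      \<open>small\<close> controls, and a multiple of \<pi>^k.\<close>
    have "?\<Lambda> * cend n c (bprod (R.bvars n) a * bprod (R.bvars n) b) - ?\<Lambda> * (if map2 (+) a b = c then 1 else 0) =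
      ?\<Lambda> * (?B - (if map2 (+) a b = c then 1 else 0)) + ?\<Lambda> * (cend n c f - \<pi> ^ gap a b c * r) +
      (?\<Lambda> * \<pi> ^ gap a b c) * r + \<pi> ^ k * (?\<Lambda> * cend n c w)"
      unfolding fw(2) by (simp add: cend_add cend_p_pow algebra_simps)
    moreover have "\<pi> ^ k dvd ?B - (if map2 (+) a b = c then 1 else 0)" using ab by (intro n2') simp
    ultimately show ?thesis using r small[OF ab] by (simp only: dvd_add dvd_mult dvd_mult2 dvd_triv_left)
  qed
  have 4: "\<pi> ^ k dvd (\<Sum>a\<in>mi m. \<Sum>b\<in>mi m. cf x a * cf y b * cend n c (bprod (R.bvars n) a * bprod (R.bvars n) b)) -
     (\<Sum>a\<in>mi m. \<Sum>b\<in>mi m. cf x a * cf y b * (if map2 (+) a b = c then 1 else 0))"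
    by (intro dvd_sum_diff 3) (auto dest: mi_D)
  have "(\<Sum>a\<in>mi m. \<Sum>b\<in>mi m. cf x a * cf y b * (if map2 (+) a b = c then 1 else 0)) =
    (\<Sum>z\<in>mi m \<times> mi m. if map2 (+) (fst z) (snd z) = c then cf x (fst z) * cf y (snd z) else 0)"
    by (simp add: sum.cartesian_product case_prod_unfold if_distrib cong: if_cong)
  also have "\<dots> = (\<Sum>z\<in>{z \<in> mi m \<times> mi m. map2 (+) (fst z) (snd z) = c}. cf x (fst z) * cf y (snd z))"
    by (rule sum.inter_filter[symmetric]) simp
  also have "{z \<in> mi m \<times> mi m. map2 (+) (fst z) (snd z) = c} = {(a, b). length a = d \<and> length b = d \<and> map2 (+) a b = c}"
  proof -
    have sl: "sum_list (map2 (+) a b) = sum_list a + sum_list b" if "length a = length b" for a b :: "nat list"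
      using that by (induction a b rule: list_induct2) auto
    have "a \<in> mi m" "b \<in> mi m" if "length a = d" "length b = d" "map2 (+) a b = c" for a b
      using sl[of a b] that by (auto simp: multi_indices_def m_def)
    then show ?thesis by (auto dest: mi_D)
  qed
  finally have 5: "(\<Sum>a\<in>mi m. \<Sum>b\<in>mi m. cf x a * cf y b * (if map2 (+) a b = c then 1 else 0)) =
    (\<Sum>(a, b)\<in>{(a, b). length a = d \<and> length b = d \<and> map2 (+) a b = c}. cf x a * cf y b)"
    by (simp add: case_prod_unfold)
  show ?thesis
    using pi_dvd_cong[OF pi_dvd_cong[OF pi_dvd_sym[OF n1'] 1[unfolded 2]] 4[unfolded 5]] .
qed

end

subsection \<open>Lowest exponents and degrees\<close>

text \<open>Total degree comes first, so that a lowest exponent also has lowest degree.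
  \<open>lex\<close> compares lists of equal length only, which keeps it well-founded.\<close>

definition prec :: "(nat list \<times> nat list) set" where
  "prec = inv_image (less_than <*lex*> lex less_than) (\<lambda>a. (sum_list a, a))"

lemma prec_iff: "(a, b) \<in> prec \<longleftrightarrow> sum_list a < sum_list b \<or> sum_list a = sum_list b \<and> (a, b) \<in> lex less_than"
  by (simp add: prec_def)

lemma wf_prec: "wf prec" unfolding prec_def by (intro wf_inv_image wf_lex_prod wf_less_than wf_lex)

lemma trans_prec: "trans prec"
  unfolding prec_def by (intro trans_inv_image trans_lex_prod trans_less_than lex_transI)

lemma prec_irrefl: "(a, a) \<notin> prec" using wf_prec by (rule wf_not_refl)

lemma lex_total: "length a = length b \<Longrightarrow> a \<noteq> b \<Longrightarrow> (a, b) \<in> lex less_than \<or> (b, a) \<in> lex less_than" for a b :: "nat list"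
  by (induction a b rule: list_induct2) (auto simp: Cons_in_lex)

lemma prec_total: "length a = length b \<Longrightarrow> a \<noteq> b \<Longrightarrow> (a, b) \<in> prec \<or> (b, a) \<in> prec"
  using lex_total[of a b] by (auto simp: prec_iff)

lemma sum_list_map2_add: "length a = length b \<Longrightarrow> sum_list (map2 (+) a b) = sum_list a + (sum_list b :: nat)"
  by (induction a b rule: list_induct2) auto

lemma lex_add:
  "length a = length c \<Longrightarrow> length b = length c \<Longrightarrow> (a, b) \<in> lex less_than \<Longrightarrow>
    (map2 (+) c a, map2 (+) c b) \<in> lex less_than" for a b c :: "nat list"
proof (induction c arbitrary: a b)
  case (Cons z c)
  then obtain x a' y b' where e: "a = x # a'" "b = y # b'" by (metis length_Suc_conv)
  then show ?case using Cons by (auto simp: Cons_in_lex)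
qed simp

lemma prec_add:
  "length a = length c \<Longrightarrow> length b = length c \<Longrightarrow> (a, b) \<in> prec \<Longrightarrow> (map2 (+) c a, map2 (+) c b) \<in> prec"
  using lex_add[of a c b] by (auto simp: prec_iff sum_list_map2_add)

lemma map2_add_cancel: "length a = length c \<Longrightarrow> length b = length c \<Longrightarrow> map2 (+) a c = map2 (+) b c \<Longrightarrow> a = b" for a b c :: "nat list"
proof (induction c arbitrary: a b)
  case (Cons z c)
  then obtain x a' y b' where e: "a = x # a'" "b = y # b'" by (metis length_Suc_conv)
  then show ?case using Cons by auto
qed simp

lemma map2_sub_add:
  "list_all2 (\<le>) s c \<Longrightarrow> map2 (+) (map2 (-) c s) s = c" for s c :: "nat list"
  by (induction rule: list_all2_induct) auto

lemma list_all2_le_add: "length b = length s \<Longrightarrow> list_all2 (\<le>) s (map2 (+) b s)" for s b :: "nat list"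
  by (induction b s rule: list_induct2) auto

text \<open>Induction on the length. Finitely many tails \<open>T0\<close> lie below all tails;
  lifted to elements of \<open>S\<close> with heads at most \<open>A\<close>, they serve every
  \<open>s\<close> with head above \<open>A\<close>. The heads up to \<open>A\<close> give finitely
  many slices, each settled by its tails.\<close>

lemma dickson:
  fixes S :: "nat list set"
  assumes "\<And>s. s \<in> S \<Longrightarrow> length s = n"
  shows "\<exists>S0\<subseteq>S. finite S0 \<and> (\<forall>s\<in>S. \<exists>s0\<in>S0. list_all2 (\<le>) s0 s)"
  using assms
proof (induction n arbitrary: S)
  case 0
  then have "S \<subseteq> {[]}" by auto
  then show ?case using finite_subset[of S "{[]}"] by (intro exI[of _ S]) force
next
  case (Suc n)
  have split: "s = hd s # tl s \<and> length (tl s) = n" if "s \<in> S" for s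
    using Suc.prems[OF that] by (cases s) auto
  obtain T0 where T0: "T0 \<subseteq> tl ` S" "finite T0" "\<And>t. t \<in> tl ` S \<Longrightarrow> \<exists>t0\<in>T0. list_all2 (\<le>) t0 t"
    using Suc.IH[of "tl ` S"] split by blast
  have "\<forall>t\<in>T0. \<exists>s\<in>S. tl s = t" using T0(1) by blast
  then obtain r where r: "\<And>t. t \<in> T0 \<Longrightarrow> r t \<in> S \<and> tl (r t) = t" by metis
  define A where "A = (\<Sum>t\<in>T0. hd (r t))"
  have A: "hd (r t) \<le> A" if "t \<in> T0" for t
    unfolding A_def using that T0(2) by (intro member_le_sum) auto
  define Sa where "Sa a = {s \<in> S. hd s = a}" for a
  have "\<forall>a. \<exists>S0. S0 \<subseteq> tl ` Sa a \<and> finite S0 \<and> (\<forall>s\<in>tl ` Sa a. \<exists>s0\<in>S0. list_all2 (\<le>) s0 s)"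
    using split by (intro allI Suc.IH) (auto simp: Sa_def)
  then obtain Q where "\<forall>a. Q a \<subseteq> tl ` Sa a \<and> finite (Q a) \<and> (\<forall>s\<in>tl ` Sa a. \<exists>s0\<in>Q a. list_all2 (\<le>) s0 s)"
    by (rule choice[THEN exE])
  then have Q: "\<And>a. Q a \<subseteq> tl ` Sa a" "\<And>a. finite (Q a)"
    "\<And>a s. s \<in> tl ` Sa a \<Longrightarrow> \<exists>s0\<in>Q a. list_all2 (\<le>) s0 s" by auto
  define S0 where "S0 = r ` T0 \<union> (\<Union>a\<in>{..A}. (#) a ` Q a)"
  have "S0 \<subseteq> S"
  proof -
    have "a # q \<in> S" if "q \<in> Q a" for a q
    proof -
      have "q \<in> tl ` Sa a" using Q(1) that by blast
      then obtain s where "s \<in> S" "hd s = a" "q = tl s" unfolding Sa_def by blast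
      then show ?thesis using split by metis
    qed
    then show ?thesis unfolding S0_def using r by auto
  qed
  moreover have "finite S0" unfolding S0_def using T0(2) Q(2) by auto
  moreover have "\<exists>s0\<in>S0. list_all2 (\<le>) s0 s" if s: "s \<in> S" for s
  proof (cases "hd s \<le> A")
    case True
    have "s \<in> Sa (hd s)" using s by (simp add: Sa_def)
    then obtain q where q: "q \<in> Q (hd s)" "list_all2 (\<le>) q (tl s)" using Q(3) by blast
    have "list_all2 (\<le>) (hd s # q) (hd s # tl s)" using q by simp
    then have "list_all2 (\<le>) (hd s # q) s" using split[OF s] by metis
    then show ?thesis using q True unfolding S0_def by blast
  next
    case False
    obtain t where t: "t \<in> T0" "list_all2 (\<le>) t (tl s)" using T0(3) s by blast
    have "hd (r t) \<le> hd s" using A[OF t(1)] False by simp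
    then have "list_all2 (\<le>) (hd (r t) # t) (hd s # tl s)" using t by simp
    then have "list_all2 (\<le>) (r t) s" using split[OF s] split[of "r t"] r[OF t(1)] by metis
    then show ?thesis using t unfolding S0_def by blast
  qed
  ultimately show ?case by blast
qed

section \<open>Degree bounds and lowest exponents of products\<close>

context expansion_loc
begin

lemma val_dvd_iff:
  assumes "x \<noteq> 0" shows "\<pi> ^ k dvd x \<longleftrightarrow> k \<le> val \<pi> x"
proof -
  obtain v j where vj: "v dvd 1" "x = v * \<pi> ^ j" using pi_power_form[OF assms] by blast
  have iff: "\<pi> ^ k dvd x \<longleftrightarrow> k \<le> j" for k unfolding vj(2) by (rule pi_pow_dvd_unit_mult[OF vj(1)])
  have "val \<pi> x = j" unfolding val_def by (rule Greatest_equality) (auto simp: iff)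
  then show ?thesis using iff by simp
qed

lemma unit_if_not_dvd: "\<not> \<pi> dvd x \<Longrightarrow> \<exists>w. x * w = 1"
proof -
  assume n: "\<not> \<pi> dvd x"
  then have "x \<noteq> 0" by auto
  then obtain v j where vj: "v dvd 1" "x = v * \<pi> ^ j" using pi_power_form by blast
  have "j = 0" using n vj(2) by (cases j) auto
  obtain w where "1 = v * w" using vj(1) by (rule dvdE)
  then have "x * w = 1" using vj(2) \<open>j = 0\<close> by simp
  then show ?thesis ..
qed

definition dg :: "real \<Rightarrow> real \<Rightarrow> ('a, 'r) rg \<Rightarrow> bool" where
  "dg w D x \<longleftrightarrow> (\<forall>c. length c = d \<longrightarrow> cf x c \<noteq> 0 \<longrightarrow> D \<le> w * real (val \<pi> (cf x c)) + real (sum_list c))"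

lemma deg_w_iff: "ereal D \<le> deg_w \<pi> G T gs w x \<longleftrightarrow> dg w D x"
  unfolding deg_w_def dg_def by (subst le_Inf_iff) auto

text \<open>Divisibility adds up over sums and covers zero coefficients. The inequality on
  \<open>k\<close> says that a valuation of \<open>k - 1\<close> would violate the degree
  bound.\<close>

lemma dg_iff_dvd:
  assumes w: "w > 0"
  shows "dg w D x \<longleftrightarrow> (\<forall>c k. length c = d \<longrightarrow> w * (real k - 1) + real (sum_list c) < D \<longrightarrow> \<pi> ^ k dvd cf x c)"
proof (intro iffI allI impI)
  fix c k assume dg: "dg w D x" and c: "length c = d" and k: "w * (real k - 1) + real (sum_list c) < D"
  show "\<pi> ^ k dvd cf x c"
  proof (cases "cf x c = 0")
    case False
    have "D \<le> w * real (val \<pi> (cf x c)) + real (sum_list c)" using dg c False by (simp add: dg_def)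
    then have "w * (real k - 1) < w * real (val \<pi> (cf x c))" using k by simp
    then have "real k - 1 < real (val \<pi> (cf x c))" using w by simp
    then show ?thesis unfolding val_dvd_iff[OF False] by linarith
  qed simp
next
  assume a: "\<forall>c k. length c = d \<longrightarrow> w * (real k - 1) + real (sum_list c) < D \<longrightarrow> \<pi> ^ k dvd cf x c"
  show "dg w D x" unfolding dg_def
  proof (intro allI impI, rule ccontr)
    fix c assume c: "length c = d" "cf x c \<noteq> 0" and "\<not> D \<le> w * real (val \<pi> (cf x c)) + real (sum_list c)"
    then have "w * (real (Suc (val \<pi> (cf x c))) - 1) + real (sum_list c) < D" by simp
    then have "\<pi> ^ Suc (val \<pi> (cf x c)) dvd cf x c" using a c by blast
    then show False unfolding val_dvd_iff[OF c(2)] by simp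
  qed
qed

lemma finite_splits: "finite {(a, b). length a = d \<and> length b = d \<and> map2 (+) a b = (c :: nat list)}"
proof (rule finite_subset)
  show "{(a, b). length a = d \<and> length b = d \<and> map2 (+) a b = c} \<subseteq> mi (sum_list c) \<times> mi (sum_list c)"
    by (auto simp: multi_indices_def sum_list_map2_add)
qed simp

lemma dg_mult:
  assumes w: "w \<ge> 2" and x: "x \<in> RG G T" "dg w D x" and y: "y \<in> RG G T" "dg w E y"
  shows "dg w (D + E) (rg_mult G T x y)"
  unfolding dg_iff_dvd[OF less_le_trans[OF zero_less_numeral w]]
proof (intro allI impI)
  fix c k assume c: "length c = d" and k: "w * (real k - 1) + real (sum_list c) < D + E"
  have key: "\<pi> ^ k dvd cf x a * cf y b * \<pi> ^ g"
    if ab: "length a = d" "length b = d" "real (sum_list a) + real (sum_list b) - real (sum_list c) \<le> 2 * real g" for a b g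
  proof (cases "cf x a = 0 \<or> cf y b = 0")
    case False
    define v1 v2 where "v1 = val \<pi> (cf x a)" and "v2 = val \<pi> (cf y b)"
    have 1: "D \<le> w * real v1 + real (sum_list a)" using x(2) ab False by (simp add: dg_def v1_def)
    have 2: "E \<le> w * real v2 + real (sum_list b)" using y(2) ab False by (simp add: dg_def v2_def)
    \<comment> \<open>The corrections gain \<open>2 * g\<close> in the integral grading and, as
      \<open>w\<close> is at least 2, no less in the grading of weight \<open>w\<close>.\<close>
    have 3: "2 * real g \<le> w * real g" using w by (intro mult_right_mono) auto
    have "w * (real k - 1) < w * real v1 + w * real v2 + w * real g" using 1 2 3 k ab(3) by linarith
    then have "w * (real k - 1) < w * (real v1 + real v2 + real g)" by (simp add: distrib_left)
    then have "real k - 1 < real v1 + real v2 + real g" using w by simp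
    then have le: "k \<le> v1 + v2 + g" by linarith
    have "\<pi> ^ v1 dvd cf x a" "\<pi> ^ v2 dvd cf y b"
      using False by (simp_all add: val_dvd_iff v1_def v2_def)
    then have "\<pi> ^ v1 * \<pi> ^ v2 * \<pi> ^ g dvd cf x a * cf y b * \<pi> ^ g" by (intro mult_dvd_mono dvd_refl)
    then have "\<pi> ^ (v1 + v2 + g) dvd cf x a * cf y b * \<pi> ^ g" by (simp add: power_add)
    then show ?thesis using le by (meson dvd_trans le_imp_power_dvd)
  qed auto
  have "\<pi> ^ k dvd cf (rg_mult G T x y) c -
    (\<Sum>(a, b)\<in>{(a, b). length a = d \<and> length b = d \<and> map2 (+) a b = c}. cf x a * cf y b)"
  proof (rule cf_mult[OF x(1) y(1) c])
    fix a b :: "nat list" assume ab: "length a = d" "length b = d"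
    have "sum_list a + sum_list b - sum_list c \<le> 2 * gap a b c" unfolding gap_def by simp
    then have "real (sum_list a) + real (sum_list b) - real (sum_list c) \<le> 2 * real (gap a b c)" by linarith
    then show "\<pi> ^ k dvd cf x a * cf y b * \<pi> ^ gap a b c" by (rule key[OF ab])
  qed
  moreover have "\<pi> ^ k dvd (\<Sum>(a, b)\<in>{(a, b). length a = d \<and> length b = d \<and> map2 (+) a b = c}. cf x a * cf y b)"
  proof (rule dvd_sum)
    fix z assume "z \<in> {(a, b). length a = d \<and> length b = d \<and> map2 (+) a b = c}"
    then obtain a b where z: "z = (a, b)" "length a = d" "length b = d" "map2 (+) a b = c" by auto
    have "\<pi> ^ k dvd cf x a * cf y b * \<pi> ^ 0"
      using z sum_list_map2_add[of a b] by (intro key) auto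
    then show "\<pi> ^ k dvd (case z of (a, b) \<Rightarrow> cf x a * cf y b)" using z by simp
  qed
  ultimately show "\<pi> ^ k dvd cf (rg_mult G T x y) c" by (rule pi_dvd_transfer)
qed

lemma dg_add_neg:
  assumes w: "w > 0" and x: "dg w D x" and y: "dg w D y" and z: "\<And>c. cf z c = cf x c - cf y c"
  shows "dg w D z"
  using x y unfolding dg_iff_dvd[OF w] z by (simp add: dvd_diff)

definition lead :: "('a, 'r) rg \<Rightarrow> nat list \<Rightarrow> bool" where
  "lead f s \<longleftrightarrow> length s = d \<and> \<not> \<pi> dvd cf f s \<and> (\<forall>a. length a = d \<longrightarrow> (a, s) \<in> prec \<longrightarrow> \<pi> dvd cf f a)"

text \<open>Consider another splitting of \<open>c\<close> into \<open>a\<close> and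
  \<open>b\<close>. If \<open>b\<close> precedes \<open>s\<close>, then \<pi> divides its
  coefficient in \<open>f\<close>; if \<open>s\<close> precedes \<open>b\<close>, then
  \<open>map2 (+) a s\<close> precedes \<open>c\<close> and the coefficient of \<open>a\<close> in
  \<open>x\<close> vanishes.\<close>

lemma cf_mult_lead:
  assumes x: "x \<in> RG G T" and f: "f \<in> RG G T" and s: "lead f s" and c: "length c = d"
    and van: "\<And>b. length b = d \<Longrightarrow> (map2 (+) b s, c) \<in> prec \<Longrightarrow> cf x b = 0"
  shows "\<pi> dvd cf (rg_mult G T x f) c - (if list_all2 (\<le>) s c then cf x (map2 (-) c s) * cf f s else 0)"
proof -
  have sd: "length s = d" and low: "\<And>a. length a = d \<Longrightarrow> (a, s) \<in> prec \<Longrightarrow> \<pi> dvd cf f a"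
    using s by (auto simp: lead_def)
  let ?I = "{(a, b). length a = d \<and> length b = d \<and> map2 (+) a b = c}"
  have h1: "\<pi> ^ 1 dvd cf (rg_mult G T x f) c - (\<Sum>(a, b)\<in>?I. cf x a * cf f b)"
  proof (rule cf_mult[OF x f c])
    fix a b :: "nat list" assume ab: "length a = d" "length b = d"
    show "\<pi> ^ 1 dvd cf x a * cf f b * \<pi> ^ gap a b c"
    proof (cases "cf x a = 0 \<or> gap a b c \<noteq> 0")
      case True
      then show ?thesis by (cases "gap a b c") auto
    next
      \<comment> \<open>A correction term without a factor \<pi> has degree above that of its
        factors. As \<open>van\<close> bounds the degree of \<open>a\<close> from below,
        \<open>b\<close> then has smaller degree than \<open>s\<close>.\<close>
      case False
      then have "(Suc (Suc (sum_list a + sum_list b)) - sum_list c) div 2 = 0" by (simp add: gap_def)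
      then have "sum_list a + sum_list b < sum_list c" by linarith
      moreover have "\<not> sum_list a + sum_list s < sum_list c"
        using van[OF ab(1)] False sum_list_map2_add[of a s] ab sd by (auto simp: prec_iff)
      ultimately have "(b, s) \<in> prec" by (simp add: prec_iff)
      then show ?thesis using low[OF ab(2)] by simp
    qed
  qed
  have h2: "\<pi> dvd (\<Sum>(a, b)\<in>?I. cf x a * cf f b) - (if list_all2 (\<le>) s c then cf x (map2 (-) c s) * cf f s else 0)"
  proof -
    have other: "\<pi> dvd cf x a * cf f b" if ab: "(a, b) \<in> ?I" "b \<noteq> s" for a b
    proof (cases "(b, s) \<in> prec")
      case True then show ?thesis using low ab by simp
    next
      case False
      then have "(s, b) \<in> prec" using prec_total[of b s] ab sd by auto
      then have "(map2 (+) a s, map2 (+) a b) \<in> prec" using ab sd by (intro prec_add) auto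
      then have "cf x a = 0" using ab by (intro van) auto
      then show ?thesis by simp
    qed
    show ?thesis
    proof (cases "list_all2 (\<le>) s c")
      case True
      let ?a = "map2 (-) c s"
      have m: "(?a, s) \<in> ?I" using map2_sub_add[OF True] c sd by simp
      have "(\<Sum>(a, b)\<in>?I. cf x a * cf f b) = cf x ?a * cf f s + (\<Sum>(a, b)\<in>?I - {(?a, s)}. cf x a * cf f b)"
        by (subst sum.remove[OF finite_splits m]) simp
      moreover have "\<pi> dvd (\<Sum>(a, b)\<in>?I - {(?a, s)}. cf x a * cf f b)"
      proof (rule dvd_sum)
        fix z assume z: "z \<in> ?I - {(?a, s)}"
        then obtain a b where ab: "z = (a, b)" "(a, b) \<in> ?I" "(a, b) \<noteq> (?a, s)" by auto
        have "b \<noteq> s"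
        proof
          assume "b = s"
          then have "map2 (+) a s = map2 (+) ?a s" using ab m by auto
          then have "a = ?a" using ab c sd by (intro map2_add_cancel[of a s ?a]) auto
          then show False using ab \<open>b = s\<close> by simp
        qed
        then show "\<pi> dvd (case z of (a, b) \<Rightarrow> cf x a * cf f b)" using other ab by simp
      qed
      ultimately show ?thesis using True by simp
    next
      case False
      have "\<pi> dvd (\<Sum>(a, b)\<in>?I. cf x a * cf f b)"
      proof (rule dvd_sum)
        fix z assume z: "z \<in> ?I"
        then obtain a b where ab: "z = (a, b)" "(a, b) \<in> ?I" by auto
        have "b \<noteq> s"
        proof
          assume "b = s"
          then have "length a = length s" "map2 (+) a s = c" using ab(2) sd by auto
          then show False using list_all2_le_add[of a s] False by metis
        qed
        then show "\<pi> dvd (case z of (a, b) \<Rightarrow> cf x a * cf f b)" using other ab by simp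
      qed
      then show ?thesis using False by simp
    qed
  qed
  have "\<pi> ^ 1 dvd (\<Sum>(a, b)\<in>?I. cf x a * cf f b) -
      (if list_all2 (\<le>) s c then cf x (map2 (-) c s) * cf f s else 0)"
    using h2 by (simp only: power_one_right)
  from pi_dvd_cong[OF h1 this] show ?thesis by (simp only: power_one_right)
qed

end

subsection \<open>Division by a standard basis\<close>

locale torsion_free_loc = expansion_loc G T p gs \<pi>
  for G :: "'a monoid" (structure) and T p gs and \<pi> :: "'r::idom" +
  fixes J :: "('a, 'r) rg set"
  assumes J_ideal: "left_ideal_RG G T J"
    and J_tf: "quotient_p_torsion_free \<pi> G T J"
begin

lemma J_RG: "x \<in> J \<Longrightarrow> x \<in> RG G T"
  and J_zero: "(\<lambda>N C. 0) \<in> J"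
  and J_add: "x \<in> J \<Longrightarrow> y \<in> J \<Longrightarrow> rg_add x y \<in> J"
  and J_neg: "x \<in> J \<Longrightarrow> rg_smult (- 1) x \<in> J"
  and J_mult: "r \<in> RG G T \<Longrightarrow> x \<in> J \<Longrightarrow> rg_mult G T r x \<in> J"
  using J_ideal unfolding left_ideal_RG_def by blast+

text \<open>The exponents of the initial ideal of \<open>J\<close> modulo \<pi>.\<close>

definition leads :: "nat list set" where "leads = {s. \<exists>f\<in>J. lead f s}"

definition basis :: "nat list set" where
  "basis = (SOME S0. S0 \<subseteq> leads \<and> finite S0 \<and> (\<forall>s\<in>leads. \<exists>s0\<in>S0. list_all2 (\<le>) s0 s))"

lemma basis: "basis \<subseteq> leads" "finite basis" "s \<in> leads \<Longrightarrow> \<exists>s0\<in>basis. list_all2 (\<le>) s0 s"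
proof -
  have "\<exists>S0. S0 \<subseteq> leads \<and> finite S0 \<and> (\<forall>s\<in>leads. \<exists>s0\<in>S0. list_all2 (\<le>) s0 s)"
    by (rule dickson[of leads d]) (auto simp: leads_def lead_def)
  from someI_ex[OF this, folded basis_def]
  show "basis \<subseteq> leads" "finite basis" "s \<in> leads \<Longrightarrow> \<exists>s0\<in>basis. list_all2 (\<le>) s0 s" by auto
qed

definition fb :: "nat list \<Rightarrow> ('a, 'r) rg" where "fb s = (SOME f. f \<in> J \<and> lead f s)"

lemma fb: "s \<in> basis \<Longrightarrow> fb s \<in> J \<and> lead (fb s) s"
proof -
  assume "s \<in> basis"
  then have "\<exists>f. f \<in> J \<and> lead f s" using basis(1) by (auto simp: leads_def)
  from someI_ex[OF this] show ?thesis unfolding fb_def .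
qed

definition fw :: "nat list \<Rightarrow> 'r" where "fw s = (SOME w. cf (fb s) s * w = 1)"

lemma fw: "s \<in> basis \<Longrightarrow> fw s * cf (fb s) s = 1"
proof -
  assume "s \<in> basis"
  then have "\<exists>w. cf (fb s) s * w = 1" using fb by (intro unit_if_not_dvd) (simp add: lead_def)
  from someI_ex[OF this, folded fw_def] show ?thesis by (simp add: mult.commute)
qed

definition sel :: "nat list \<Rightarrow> nat list" where "sel c = (SOME s. s \<in> basis \<and> list_all2 (\<le>) s c)"

lemma sel: "c \<in> leads \<Longrightarrow> sel c \<in> basis \<and> list_all2 (\<le>) (sel c) c"
proof -
  assume "c \<in> leads"
  then have "\<exists>s. s \<in> basis \<and> list_all2 (\<le>) s c" using basis(3) by blast
  from someI_ex[OF this] show ?thesis unfolding sel_def .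
qed

definition ofc :: "(nat list \<Rightarrow> 'r) \<Rightarrow> ('a, 'r) rg" where "ofc l = (SOME x. x \<in> RG G T \<and> cf x = l)"

lemma ofc: "(\<And>c. length c \<noteq> d \<Longrightarrow> l c = 0) \<Longrightarrow> ofc l \<in> RG G T \<and> cf (ofc l) = l"
proof -
  assume "\<And>c. length c \<noteq> d \<Longrightarrow> l c = 0"
  then have "\<exists>x. x \<in> RG G T \<and> cf x = l" using RG_of_coeffs by blast
  from someI_ex[OF this] show ?thesis unfolding ofc_def .
qed

text \<open>Each exponent \<open>c\<close> to be cancelled is charged to the single basis element \<open>sel c\<close>, so a function
  \<open>\<rho>\<close> on exponents determines the quotients of all basis elements at once; \<open>A\<close> truncates them.\<close>
definition qc :: "(nat list \<Rightarrow> 'r) \<Rightarrow> nat list set \<Rightarrow> nat list \<Rightarrow> nat list \<Rightarrow> 'r" where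
  "qc \<rho> A s b = (if length b = d \<and> map2 (+) b s \<in> A \<inter> leads \<and> sel (map2 (+) b s) = s
     then \<rho> (map2 (+) b s) * fw s else 0)"

definition quo :: "(nat list \<Rightarrow> 'r) \<Rightarrow> nat list set \<Rightarrow> nat list \<Rightarrow> ('a, 'r) rg" where
  "quo \<rho> A s = ofc (qc \<rho> A s)"

lemma quo: "quo \<rho> A s \<in> RG G T" "cf (quo \<rho> A s) = qc \<rho> A s"
  using ofc[of "qc \<rho> A s"] by (auto simp: quo_def qc_def)

definition comb :: "(nat list \<Rightarrow> 'r) \<Rightarrow> nat list set \<Rightarrow> nat list set \<Rightarrow> ('a, 'r) rg" where
  "comb \<rho> A B = (\<lambda>N C. \<Sum>s\<in>B. rg_mult G T (quo \<rho> A s) (fb s) N C)"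

lemma quo_fb_J: "s \<in> basis \<Longrightarrow> rg_mult G T (quo \<rho> A s) (fb s) \<in> J"
  using fb quo(1) by (intro J_mult) auto

lemma comb_J_cf:
  assumes "B \<subseteq> basis"
  shows "comb \<rho> A B \<in> J \<and> (\<forall>c. cf (comb \<rho> A B) c = (\<Sum>s\<in>B. cf (rg_mult G T (quo \<rho> A s) (fb s)) c))"
proof -
  have "finite B" using assms basis(2) finite_subset by blast
  then show ?thesis using assms
  proof (induction B)
    case empty
    have "cf (rg_smult 0 (\<lambda>N C. 0)) = (\<lambda>c. 0)" using cf_smult[OF RG_zero, of 0] by simp
    then have "cf (\<lambda>N C. 0) = (\<lambda>c. 0)" by (simp add: rg_smult_def)
    then show ?case using J_zero by (simp add: comb_def)
  next
    case (insert s B)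
    have e: "comb \<rho> A (insert s B) = rg_add (rg_mult G T (quo \<rho> A s) (fb s)) (comb \<rho> A B)"
      using insert by (simp add: comb_def rg_add_def)
    have m: "rg_mult G T (quo \<rho> A s) (fb s) \<in> J" using insert quo_fb_J by simp
    show ?case unfolding e using insert m cf_add[OF J_RG[OF m] J_RG] J_add by simp
  qed
qed

definition dvn :: "(nat list \<Rightarrow> 'r) \<Rightarrow> nat list set \<Rightarrow> ('a, 'r) rg \<Rightarrow> ('a, 'r) rg" where
  "dvn \<rho> A j = rg_add j (rg_smult (- 1) (comb \<rho> A basis))"

lemma dvn_J: "j \<in> J \<Longrightarrow> dvn \<rho> A j \<in> J"
  unfolding dvn_def using comb_J_cf[OF order_refl] by (intro J_add J_neg) auto

lemma cf_dvn: "j \<in> J \<Longrightarrow> cf (dvn \<rho> A j) c = cf j c - (\<Sum>s\<in>basis. cf (rg_mult G T (quo \<rho> A s) (fb s)) c)"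
proof -
  assume j: "j \<in> J"
  have c: "comb \<rho> A basis \<in> J" using comb_J_cf[OF order_refl] by blast
  have "cf (rg_smult (- 1) (comb \<rho> A basis)) = (\<lambda>c. - 1 * cf (comb \<rho> A basis) c)"
    by (rule cf_smult[OF J_RG[OF c]])
  then show ?thesis unfolding dvn_def
    using cf_add[OF J_RG[OF j] J_RG[OF J_neg[OF c]]] comb_J_cf[OF order_refl] by simp
qed

text \<open>Above the range already treated, the correction with quotients supported on \<open>A\<close> removes
  exactly the coefficient prescribed by \<open>\<rho>\<close>.\<close>
lemma comb_lead:
  assumes c: "length c = d" and A: "\<And>e. (e, c) \<in> prec \<Longrightarrow> e \<notin> A"
  shows "\<pi> dvd (\<Sum>s\<in>basis. cf (rg_mult G T (quo \<rho> A s) (fb s)) c) - (if c \<in> A \<inter> leads then \<rho> c else 0)"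
proof -
  have 1: "\<pi> dvd cf (rg_mult G T (quo \<rho> A s) (fb s)) c - (if c \<in> A \<inter> leads \<and> sel c = s then \<rho> c else 0)"
    if s: "s \<in> basis" for s
  proof -
    have ls: "lead (fb s) s" using fb[OF s] by blast
    have sd: "length s = d" using ls by (simp add: lead_def)
    have "\<pi> dvd cf (rg_mult G T (quo \<rho> A s) (fb s)) c -
        (if list_all2 (\<le>) s c then cf (quo \<rho> A s) (map2 (-) c s) * cf (fb s) s else 0)"
    proof (rule cf_mult_lead[OF quo(1) J_RG ls c])
      fix b assume "length b = d" "(map2 (+) b s, c) \<in> prec"
      then show "cf (quo \<rho> A s) b = 0" using A by (simp add: quo(2) qc_def)
    qed (use fb[OF s] in blast)
    moreover have "(if list_all2 (\<le>) s c then cf (quo \<rho> A s) (map2 (-) c s) * cf (fb s) s else 0) =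
        (if c \<in> A \<inter> leads \<and> sel c = s then \<rho> c else 0)"
    proof (cases "list_all2 (\<le>) s c")
      case True
      have "length (map2 (-) c s) = d" using c sd by simp
      then show ?thesis using True fw[OF s] by (simp add: quo(2) qc_def map2_sub_add[OF True] mult.assoc)
    next
      case False
      then show ?thesis using sel[of c] by auto
    qed
    ultimately show ?thesis by simp
  qed
  have e: "(\<Sum>s\<in>basis. if c \<in> A \<inter> leads \<and> sel c = s then \<rho> c else 0) = (if c \<in> A \<inter> leads then \<rho> c else 0)"
  proof (cases "c \<in> A \<inter> leads")
    case True
    then have "sel c \<in> basis" using sel by blast
    then show ?thesis using True basis(2) by (simp add: sum.delta)
  qed auto
  have "\<pi> dvd (\<Sum>s\<in>basis. cf (rg_mult G T (quo \<rho> A s) (fb s)) c) -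
      (\<Sum>s\<in>basis. if c \<in> A \<inter> leads \<and> sel c = s then \<rho> c else 0)"
    by (rule dvd_sum_diff) (rule 1)
  then show ?thesis unfolding e .
qed

text \<open>Quotients are additive in the truncation set, which lets \<open>division\<close> compare
  a partial correction with the full one.\<close>

lemma cf_quo_split:
  assumes "A \<inter> B = {}" "s \<in> basis"
  shows "cf (rg_mult G T (quo \<rho> (A \<union> B) s) (fb s)) c =
    cf (rg_mult G T (quo \<rho> A s) (fb s)) c + cf (rg_mult G T (quo \<rho> B s) (fb s)) c"
proof -
  have "quo \<rho> (A \<union> B) s = rg_add (quo \<rho> A s) (quo \<rho> B s)"
  proof (rule RG_eqI[OF quo(1) RG_add[OF quo(1) quo(1)]])
    show "cf (quo \<rho> (A \<union> B) s) = cf (rg_add (quo \<rho> A s) (quo \<rho> B s))"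
      unfolding cf_add[OF quo(1) quo(1)] quo(2) using assms(1) by (auto simp: qc_def fun_eq_iff)
  qed
  moreover have "rg_mult G T (rg_add x y) z = rg_add (rg_mult G T x z) (rg_mult G T y z)" for x y z :: "('a, 'r) rg"
    unfolding rg_mult_def rg_add_def
    by (intro ext) (simp add: case_prod_unfold distrib_right sum.distrib)
  ultimately show ?thesis
    using cf_add[OF J_RG[OF quo_fb_J[OF assms(2)]] J_RG[OF quo_fb_J[OF assms(2)]]] by simp
qed

text \<open>\<open>\<rho> c\<close> is what remains at \<open>c\<close> after the earlier exponents
  have been charged. For \<open>c\<close> in \<open>leads\<close> the charge at \<open>c\<close>
  removes it modulo \<pi>. Otherwise \<pi> divides it already: the partial remainder lies in
  \<open>J\<close> and is divisible by \<pi> before \<open>c\<close>, so it would have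
  \<open>c\<close> as lowest exponent.\<close>

lemma division:
  assumes j: "j \<in> J" and low: "\<And>c. length c = d \<Longrightarrow> sum_list c < m \<Longrightarrow> \<pi> dvd cf j c"
  shows "\<exists>\<rho>. \<forall>c. \<pi> dvd cf (dvn \<rho> {e. m \<le> sum_list e} j) c"
proof -
  define U0 where "U0 = {e :: nat list. m \<le> sum_list e}"
  define below where "below c = U0 \<inter> {e. (e, c) \<in> prec}" for c
  define \<rho> where "\<rho> = wfrec prec (\<lambda>r c. cf (dvn r (below c) j) c)"
  have rho: "\<rho> c = cf (dvn \<rho> (below c) j) c" for c
  proof -
    \<comment> \<open>All members of \<open>below c\<close> precede \<open>c\<close>, so the
      recursion consults \<rho> at earlier arguments only.\<close>
    have "\<rho> c = cf (dvn (cut \<rho> prec c) (below c) j) c"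
      unfolding \<rho>_def by (subst wfrec[OF wf_prec]) simp
    also have "dvn (cut \<rho> prec c) (below c) j = dvn \<rho> (below c) j"
    proof -
      have "qc (cut \<rho> prec c) (below c) = qc \<rho> (below c)"
        by (intro ext) (auto simp: qc_def below_def cut_apply)
      then have "quo (cut \<rho> prec c) (below c) = quo \<rho> (below c)" by (intro ext) (simp add: quo_def)
      then show ?thesis by (simp add: dvn_def comb_def)
    qed
    finally show ?thesis .
  qed
  \<comment> \<open>For \<open>e\<close> equal to \<open>c\<close> or before it, charging the
    exponents that do not precede \<open>c\<close> changes the coefficient at \<open>e\<close>
    modulo \<pi> only by a charge at \<open>e\<close> itself.\<close>
  have tail: "\<pi> dvd cf (dvn \<rho> U0 j) e - (cf (dvn \<rho> (below c) j) e - (if e \<in> U0 - below c \<and> e \<in> leads then \<rho> e else 0))"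
    if e: "length e = d" and ec: "\<And>e'. (e', e) \<in> prec \<Longrightarrow> (e', c) \<in> prec" for c e
  proof -
    have U: "below c \<union> (U0 - below c) = U0" "below c \<inter> (U0 - below c) = {}" by (auto simp: below_def)
    have "cf (dvn \<rho> U0 j) e = cf (dvn \<rho> (below c) j) e - (\<Sum>s\<in>basis. cf (rg_mult G T (quo \<rho> (U0 - below c) s) (fb s)) e)"
      using cf_quo_split[OF U(2)] unfolding U(1) by (simp add: cf_dvn[OF j] sum.distrib)
    moreover have "\<pi> dvd (\<Sum>s\<in>basis. cf (rg_mult G T (quo \<rho> (U0 - below c) s) (fb s)) e) - (if e \<in> (U0 - below c) \<inter> leads then \<rho> e else 0)"
      using ec by (intro comb_lead[OF e]) (auto simp: below_def)
    ultimately show ?thesis using pi_dvd_sym[of 1] by (simp add: Int_iff)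
  qed
  have "\<pi> dvd cf (dvn \<rho> U0 j) c" if "length c = d" for c
    using wf_prec that
  proof (induction c rule: wf_induct_rule)
    case (less c)
    show ?case
    proof (cases "c \<in> U0")
      case False
      have "\<pi> dvd (\<Sum>s\<in>basis. cf (rg_mult G T (quo \<rho> U0 s) (fb s)) c) - (if c \<in> U0 \<inter> leads then \<rho> c else 0)"
        using False by (intro comb_lead[OF less.prems]) (auto simp: U0_def prec_iff)
      moreover have "\<pi> dvd cf j c" using low[OF less.prems] False by (simp add: U0_def)
      ultimately show ?thesis using False by (simp add: cf_dvn[OF j] dvd_diff)
    next
      case True
      have nb: "c \<notin> below c" by (simp add: below_def prec_irrefl)
      have t: "\<pi> dvd cf (dvn \<rho> U0 j) c - (\<rho> c - (if c \<in> leads then \<rho> c else 0))"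
        using tail[OF less.prems, of c] True nb by (simp add: rho[symmetric])
      show ?thesis
      proof (cases "c \<in> leads")
        case True
        then show ?thesis using t by simp
      next
        case nl: False
        have "\<pi> dvd cf (dvn \<rho> (below c) j) e" if e: "length e = d" "(e, c) \<in> prec" for e
        proof -
          have tt: "\<pi> dvd cf (dvn \<rho> U0 j) e - (cf (dvn \<rho> (below c) j) e - (if e \<in> U0 - below c \<and> e \<in> leads then \<rho> e else 0))"
            using e(2) trans_prec by (intro tail[OF e(1)]) (blast dest: transD)
          have "\<not> e \<in> U0 - below c" using e by (auto simp: below_def)
          then have "(if e \<in> U0 - below c \<and> e \<in> leads then \<rho> e else 0) = 0" by (simp only: simp_thms if_False)
          then have "\<pi> dvd cf (dvn \<rho> U0 j) e - cf (dvn \<rho> (below c) j) e" using tt by (simp only: diff_0_right)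
          moreover have "\<pi> dvd cf (dvn \<rho> U0 j) e" using less.IH e by blast
          ultimately have "\<pi> dvd cf (dvn \<rho> U0 j) e - (cf (dvn \<rho> U0 j) e - cf (dvn \<rho> (below c) j) e)"
            by (rule dvd_diff[rotated])
          moreover have "u - (u - v) = v" for u v :: 'r by simp
          ultimately show ?thesis by (simp only:)
        qed
        then have "\<pi> dvd \<rho> c"
          using nl dvn_J[OF j, of \<rho> "below c"] less.prems unfolding leads_def lead_def rho[of c] by blast
        moreover have "(if c \<in> leads then \<rho> c else 0) = 0" using nl by (simp only: if_False)
        ultimately have "\<pi> dvd (cf (dvn \<rho> U0 j) c - \<rho> c) + \<rho> c"
          using t by (simp only: diff_0_right dvd_add)
        then show ?thesis by (simp only: diff_add_cancel)
      qed
    qed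
  qed
  then have "\<pi> dvd cf (dvn \<rho> U0 j) c" for c
    using cf_support[OF J_RG[OF dvn_J[OF j]], of c] by (cases "length c = d") auto
  then show ?thesis unfolding U0_def by blast
qed

text \<open>The 2 serves \<open>dg_mult\<close>; the sum bounds every \<open>sum_list s\<close> and
  also makes sense for an empty basis.\<close>

definition w_min :: real where "w_min = 2 + (\<Sum>s\<in>basis. real (sum_list s))"

text \<open>A coefficient prime to \<pi> sits at an exponent of degree at least that of
  \<open>s\<close>, because \<open>prec\<close> is graded. Every other nonzero term has degree at
  least \<open>w\<close>, which exceeds the degree of \<open>s\<close>.\<close>

lemma dg_fb:
  assumes s: "s \<in> basis" and w: "w_min \<le> w" shows "dg w (real (sum_list s)) (fb s)"
  unfolding dg_def
proof (intro allI impI)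
  fix c assume c: "length c = d" "cf (fb s) c \<noteq> 0"
  have ls: "lead (fb s) s" using fb[OF s] by blast
  have "real (sum_list s) \<le> (\<Sum>s\<in>basis. real (sum_list s))"
    using s basis(2) by (intro member_le_sum) auto
  then have sw: "real (sum_list s) \<le> w" "w \<ge> 0" using w by (auto simp: w_min_def)
  show "real (sum_list s) \<le> w * real (val \<pi> (cf (fb s) c)) + real (sum_list c)"
  proof (cases "val \<pi> (cf (fb s) c)")
    case 0
    then have "\<not> \<pi> dvd cf (fb s) c" using val_dvd_iff[OF c(2), of 1] by simp
    then have "(c, s) \<notin> prec" using ls c by (auto simp: lead_def)
    then have "\<not> sum_list c < sum_list s" by (simp add: prec_iff)
    then show ?thesis using 0 by simp
  next
    case (Suc k)
    have "w * 1 \<le> w * real (val \<pi> (cf (fb s) c))" using Suc sw by (intro mult_left_mono) auto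
    then show ?thesis using sw by simp
  qed
qed

text \<open>The quotient of \<open>s\<close> is supported on exponents \<open>b\<close> with
  \<open>map2 (+) b s\<close> of degree at least \<open>m\<close>, and \<open>fb s\<close> has
  degree at least that of \<open>s\<close>; the two bounds add up to \<open>m\<close>.\<close>

lemma dg_comb:
  assumes w: "w_min \<le> w"
  shows "dg w (real m) (comb \<rho> {e. m \<le> sum_list e} basis)"
proof -
  let ?A = "{e :: nat list. m \<le> sum_list e}"
  have w2: "w \<ge> 2" using w unfolding w_min_def by (smt (verit) of_nat_0_le_iff sum_nonneg)
  have 1: "dg w (real m) (rg_mult G T (quo \<rho> ?A s) (fb s))" if s: "s \<in> basis" for s
  proof -
    have sd: "length s = d" using fb[OF s] by (simp add: lead_def)
    have "dg w (real m - real (sum_list s)) (quo \<rho> ?A s)"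
      unfolding dg_def
    proof (intro allI impI)
      fix b assume b: "length b = d" "cf (quo \<rho> ?A s) b \<noteq> 0"
      then have "m \<le> sum_list b + sum_list s"
        using sd by (auto simp: quo(2) qc_def sum_list_map2_add split: if_splits)
      then have "real m - real (sum_list s) \<le> real (sum_list b)" by linarith
      moreover have "0 \<le> w * real (val \<pi> (cf (quo \<rho> ?A s) b))" using w2 by simp
      ultimately show "real m - real (sum_list s) \<le> w * real (val \<pi> (cf (quo \<rho> ?A s) b)) + real (sum_list b)" by linarith
    qed
    from dg_mult[OF w2 quo(1) this J_RG dg_fb[OF s w]] fb[OF s] show ?thesis by simp
  qed
  show ?thesis
    using 1 w2 comb_J_cf[OF order_refl, of \<rho> ?A] unfolding dg_iff_dvd[OF less_le_trans[OF zero_less_numeral w2]]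
    by (auto intro!: dvd_sum)
qed

theorem gr_torsion_free:
  assumes w: "w_min \<le> w"
  shows "gr_tw_torsion_free \<pi> G T gs J w"
  unfolding gr_tw_torsion_free_def
proof (intro allI impI)
  fix \<mu> x assume x: "x \<in> quot_filt \<pi> G T gs J w \<mu>"
    and px: "rg_smult \<pi> x \<in> quot_filt_less \<pi> G T gs J w (\<mu> - w)"
  have xR: "x \<in> RG G T" using x by (simp add: quot_filt_def)
  have w0: "w > 0" using w unfolding w_min_def by (smt (verit) of_nat_0_le_iff sum_nonneg)
  obtain \<nu> j where \<nu>: "\<nu> < \<mu> - w" and j: "j \<in> J" and z: "dg w (- \<nu>) (rg_add (rg_smult \<pi> x) j)"
    using px unfolding quot_filt_less_def quot_filt_def deg_w_iff by blast
  have cz: "cf (rg_add (rg_smult \<pi> x) j) c = \<pi> * cf x c + cf j c" for c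
    using cf_add[OF RG_smult[OF xR] J_RG[OF j]] cf_smult[OF xR] by simp
  \<comment> \<open>Monomials have integral degree, so the real bound is rounded up;
    \<open>nat\<close> turns a negative bound into 0.\<close>
  define m where "m = nat \<lceil>- \<nu>\<rceil>"
  have m\<nu>: "- \<nu> \<le> real m" unfolding m_def by linarith
  have low: "\<pi> dvd cf j c" if c: "length c = d" "sum_list c < m" for c
  proof -
    have "real (sum_list c) < - \<nu>" using c(2) unfolding m_def by linarith
    then have "w * (real 1 - 1) + real (sum_list c) < - \<nu>" by simp
    then have "\<pi> ^ 1 dvd \<pi> * cf x c + cf j c"
      using z c(1) unfolding dg_iff_dvd[OF w0] cz by blast
    then have "\<pi> dvd \<pi> * cf x c + cf j c" by simp
    then show ?thesis by (simp only: dvd_add_right_iff dvd_triv_left)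
  qed
  obtain \<rho> where \<rho>: "\<And>c. \<pi> dvd cf (dvn \<rho> {e. m \<le> sum_list e} j) c" using division[OF j low] by blast
  define k where "k = comb \<rho> {e. m \<le> sum_list e} basis"
  define r where "r = dvn \<rho> {e. m \<le> sum_list e} j"
  have kJ: "k \<in> J" unfolding k_def using comb_J_cf[OF order_refl] by blast
  have rJ: "r \<in> J" unfolding r_def by (rule dvn_J[OF j])
  have cr: "cf r c = cf j c - cf k c" for c
    unfolding r_def k_def cf_dvn[OF j] using comb_J_cf[OF order_refl] by simp
  have "\<forall>c. \<exists>y. cf r c = \<pi> * y" using \<rho> unfolding r_def by (auto elim: dvdE)
  then obtain g where g: "\<And>c. cf r c = \<pi> * g c" by metis
  have g0: "g c = 0" if "length c \<noteq> d" for c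
    using g[of c] cf_support[OF J_RG[OF rJ] that] pi_nz by simp
  define y where "y = ofc g"
  have y: "y \<in> RG G T" "cf y = g" using ofc[of g] g0 by (auto simp: y_def)
  have "rg_smult \<pi> y = r"
    using g by (intro RG_eqI RG_smult y J_RG rJ) (simp add: cf_smult[OF y(1)] y(2) fun_eq_iff)
  then have yJ: "y \<in> J" using J_tf rJ y unfolding quotient_p_torsion_free_def by blast
  have cxy: "cf (rg_add x y) c = cf x c + g c" for c using cf_add[OF xR y(1)] y(2) by simp
  have dk: "dg w (- \<nu>) k"
    using dg_comb[OF w, of m \<rho>] m\<nu> unfolding k_def dg_def by (meson order_trans)
  have pxy: "dg w (- \<nu>) (rg_smult \<pi> (rg_add x y))"
  proof (rule dg_add_neg[OF w0 z dk])
    fix c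
    have "\<pi> * g c = cf j c - cf k c" using g[of c] cr[of c] by simp
    then show "cf (rg_smult \<pi> (rg_add x y)) c = cf (rg_add (rg_smult \<pi> x) j) c - cf k c"
      unfolding cf_smult[OF RG_add[OF xR y(1)]] cxy cz by (simp add: distrib_left)
  qed
  have "dg w (- (\<nu> + w)) (rg_add x y)"
    unfolding dg_iff_dvd[OF w0]
  proof (intro allI impI)
    fix c i assume c: "length c = d" and i: "w * (real i - 1) + real (sum_list c) < - (\<nu> + w)"
    have "w * (real (Suc i) - 1) + real (sum_list c) < - \<nu>" using i by (simp add: algebra_simps)
    then have "\<pi> ^ Suc i dvd cf (rg_smult \<pi> (rg_add x y)) c"
      using pxy c unfolding dg_iff_dvd[OF w0] by blast
    then show "\<pi> ^ i dvd cf (rg_add x y) c"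
      unfolding cf_smult[OF RG_add[OF xR y(1)]] using pi_nz by simp
  qed
  then have "x \<in> quot_filt \<pi> G T gs J w (\<nu> + w)"
    unfolding quot_filt_def deg_w_iff using xR yJ by blast
  then show "x \<in> quot_filt_less \<pi> G T gs J w \<mu>"
    unfolding quot_filt_less_def using \<nu> by (intro UN_I[of "\<nu> + w"]) auto
qed

end

theorem theorem10p11:
  fixes p :: nat and G :: "'g monoid" and T :: "'g topology" and gs :: "'g list"
    and J :: "('g, 'r::idom) rg set"
  assumes "Factorial_Ring.prime p"
    and "complete_dvr_unif (of_nat p :: 'r)"
    and "uniform_pro_p p G T"
    and "minimal_top_gens G T gs"
    and "left_ideal_RG G T J"
    and "quotient_p_torsion_free (of_nat p) G T J"
  shows "\<exists>w0>1. \<forall>w\<ge>w0. gr_tw_torsion_free (of_nat p) G T gs J w"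
proof -
  have pro: "pro_p_group p G T" using assms(3) by (simp add: uniform_pro_p_def powerful_def)
  then have prof: "profinite_group G T" by (simp add: pro_p_group_def)
  then have tg: "topological_group G T" by (simp add: profinite_group_def)
  interpret group G using tg by (simp add: topological_group_def)
  interpret torsion_free_loc G T p gs "of_nat p :: 'r" J
  proof
    show "topspace T = carrier G" "continuous_map (prod_topology T T) T (\<lambda>(x, y). x \<otimes>\<^bsub>G\<^esub> y)"
      "continuous_map T T (\<lambda>x. inv\<^bsub>G\<^esub> x)" using tg by (auto simp: topological_group_def)
    show "compact_space T" "Hausdorff_space T" "totally_disconnected_space T"
      using prof by (auto simp: profinite_group_def)
    show "Factorial_Ring.prime p" by fact
    show "\<exists>k. idx G (carrier G) N = p ^ k" if "open_normal G T N" for N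
      using pro that by (simp add: pro_p_group_def)
  qed (use assms in auto)
  have "w_min > 1" unfolding w_min_def by (smt (verit) of_nat_0_le_iff sum_nonneg)
  then show ?thesis using gr_torsion_free by blast
qed

end
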